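(* Let $d \geq 2$ be an integer and let $\delta > 0$. There is a constant $c = c(d,\delta) > 0$ such that the following holds. Let $0 < \epsilon \leq 1$, let $P$ be a set of $n$ points in general position in $\mathbb{R}^d$, and let $E \subseteq \binom{P}{d+1}$ be a collection of $(d+1)$-element subsets of $P$ with $|E| \geq \epsilon \binom{n}{d+1}$. Then there is a point $x \in \mathbb{R}^d$ that pierces at least $$c\, \epsilon^{(d^4+d)(d+1)+\delta} \binom{n}{d+1}$$ of the simplices $\operatorname{conv}(\tau)$, $\tau \in E$.
   Context: A point set in $\mathbb{R}^d$ is in general position if no $d+1$ of its points lie on a common hyperplane, so that every $(d+1)$-element subset $\tau$ spans a $d$-dimensional simplex $\operatorname{conv}(\tau)$. A point $x$ pierces $\operatorname{conv}(\tau)$ if $x$ lies in the relative interior of $\operatorname{conv}(\tau)$. $\binom{P}{k}$ denotes the family of all $k$-element subsets of $P$. *)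

theory Defs
  imports "HOL-Analysis.Analysis" "HOL-Library.Ramsey"
begin

definition general_position :: "(real ^ 'd) set \<Rightarrow> bool" where
  "general_position P \<longleftrightarrow>
     (\<forall>T \<in> nsets P (CARD('d) + 1). \<not> (\<exists>a b. a \<noteq> 0 \<and> T \<subseteq> {x. a \<bullet> x = b}))"

definition pierces :: "real ^ 'd \<Rightarrow> (real ^ 'd) set \<Rightarrow> bool" where
  "pierces x \<tau> \<longleftrightarrow> x \<in> rel_interior (convex hull \<tau>)"

end

theory Submission
  imports Defs "HOL-Probability.Probability"
begin

text \<open>
  Put \<open>m = d + 1\<close> and let \<open>orient f\<close> be the determinant of the homogenised points of an ordered
  simplex \<open>f\<close>. Greedy refinement by affine functionals \<open>x \<mapsto> orient (g(j := x))\<close> yields a partition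
  of \<open>P\<close> in which two random points of a common cell are almost never separated by such a
  functional: every violating functional raises the entropy of the partition, while \<open>T\<close>
  functionals cut out at most \<open>(2 T + 1) ^ d\<close> cells, so few of them suffice.

  Choose \<open>m\<close> random cells and in each of them \<open>m\<close> random points; this gives \<open>m\<close> layers, each of
  them an ordered simplex, and by convexity all layers belong to \<open>E\<close> with probability at least
  about \<open>\<epsilon> ^ m\<close>. Typically all simplices mixed from the layers have the same orientation, and
  moreover all cross ratios of their orientations are close to 1. The latter is one-dimensional:
  by the Pluecker relation \<open>orient (f(i := p, k := q)) = s p * s q * (x p - x q)\<close>, so a pair of
  points in a cell is an interval, orientation changes correspond to intersecting intervals, and
  random intervals that rarely intersect can rarely be long compared with their distance.

  Cross ratios near 1 force every mixed determinant, suitably normalised, to be near 1. Expanding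
  determinants along a shortest heavy cycle shows that all cycle products of off-diagonal entries
  are small, so the matrices can be scaled to be diagonally dominant, and the layers have a common
  interior point.

  Finally, \<open>m\<close> convex compact sets with a common point always contain one set \<open>K\<close> that meets the
  point of smallest norm in the intersection of the other ones. Resampling that layer alone shows
  that a single point lies in a positive proportion of the simplices of \<open>E\<close> spanned by the chosen
  cells.
\<close>

section \<open>Paths, cycles and potentials\<close>

text \<open>The exponent comes from balancing two probabilities. Against the \<epsilon>^m for layers
  in E stands a probability of order sqrt(\<eta> + m^2/n) for inconsistent layers, where \<eta>
  bounds the separation in the partition and m^2/n accounts for repeated vertices. The square root
  arises because the chance that a random interval covers a fixed point is controlled only through
  the chance that two such intervals meet. Hence \<eta> is taken of order \<epsilon>^(2m). The
  entropy bound then works with T of order \<eta>^(-4/3), so with about \<epsilon>^(-8dm/3) cells;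
  choosing m cells costs the m-th power of this number, and the exponent becomes m + 8dm^2/3. If n
  is too small for m^2/n to be absorbed by \<eta>, a single simplex already satisfies the claim.

  Ordered simplices replace sets throughout, which changes counts by factors depending on d only.
  The type \<open>'d option\<close> has d + 1 elements and indexes vertices, homogeneous coordinates
  and layers alike. The number of layers is the dimension plus one because the selection of the
  common point rests on Helly's theorem.\<close>

fun path_weight :: "('a \<Rightarrow> 'a \<Rightarrow> real) \<Rightarrow> 'a list \<Rightarrow> real" where
  "path_weight W (x # y # zs) = W x y * path_weight W (y # zs)"
| "path_weight W _ = 1"

lemma path_weight_append:
  "path_weight W (xs @ y # zs) = path_weight W (xs @ [y]) * path_weight W (y # zs)"
proof (induction xs)
  case (Cons x xs)
  then show ?case by (cases xs) auto
qed auto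

lemma path_weight_snoc:
  "xs \<noteq> [] \<Longrightarrow> path_weight W (xs @ [y]) = path_weight W xs * W (last xs) y"
proof (induction xs)
  case (Cons x xs)
  then show ?case by (cases xs) auto
qed auto

lemma path_weight_nonneg:
  assumes "\<And>x y. 0 \<le> W x y"
  shows "0 \<le> path_weight W xs"
  using assms by (induction xs rule: induct_list012) auto

lemma finite_distinct_lists: "finite {xs :: 'a :: finite list. distinct xs}"
proof (rule finite_subset)
  show "{xs :: 'a list. distinct xs} \<subseteq> {xs. set xs \<subseteq> UNIV \<and> length xs \<le> CARD('a)}"
    by (auto simp flip: distinct_card intro!: card_mono)
qed (rule finite_lists_length_le, simp)

text \<open>Multiplicative form of the potentials known from shortest paths: \<open>v x\<close> is
  the largest weight of a simple path ending in \<open>x\<close>. Extending such a path by an edge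
  to \<open>y\<close> either keeps it simple or closes a cycle, and a cycle of weight at most 1 can
  be cut off without loss.\<close>

lemma potential_exists:
  fixes W :: "'a :: finite \<Rightarrow> 'a \<Rightarrow> real"
  assumes W: "\<And>x y. 0 \<le> W x y"
    and cyc: "\<And>x xs. distinct (x # xs) \<Longrightarrow> path_weight W (x # xs @ [x]) \<le> 1"
  obtains v where "\<And>x. 0 < v x" "\<And>x y. v x * W x y \<le> v y"
proof
  define L where "L x = {xs :: 'a list. distinct xs \<and> xs \<noteq> [] \<and> last xs = x}" for x
  define v where "v x = Max (path_weight W ` L x)" for x
  have fin: "finite (path_weight W ` L x)" for x
    unfolding L_def using finite_distinct_lists by (auto intro: finite_subset[rotated])
  have ge: "path_weight W xs \<le> v x" if "xs \<in> L x" for x xs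
    unfolding v_def using fin that by auto
  show "0 < v x" for x
    using ge[of "[x]" x] by (simp add: L_def)
  fix x y
  have ne: "L x \<noteq> {}"
  proof -
    have "[x] \<in> L x" by (simp add: L_def)
    then show ?thesis by blast
  qed
  have "v x \<in> path_weight W ` L x"
    unfolding v_def using fin ne by (intro Max_in) auto
  then obtain xs where xs: "xs \<in> L x" "v x = path_weight W xs" by auto
  show "v x * W x y \<le> v y"
  proof (cases "y \<in> set xs")
    case False
    then have "xs @ [y] \<in> L y" using xs by (auto simp: L_def)
    then show ?thesis using ge[of "xs @ [y]" y] xs by (auto simp: L_def path_weight_snoc)
  next
    case True
    then obtain as bs where ab: "xs = as @ y # bs" by (auto simp: in_set_conv_decomp)
    have "v x * W x y = path_weight W (xs @ [y])"
      using xs by (auto simp: L_def path_weight_snoc)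
    also have "\<dots> = path_weight W (as @ [y]) * path_weight W (y # bs @ [y])"
      using path_weight_append[of W as y "bs @ [y]"] ab by simp
    also have "\<dots> \<le> path_weight W (as @ [y])"
      using cyc[of y bs] xs ab path_weight_nonneg[OF W]
      by (auto simp: L_def intro!: mult_left_le)
    also have "\<dots> \<le> v y"
      using xs ab by (intro ge) (auto simp: L_def)
    finally show ?thesis .
  qed
qed

section \<open>Determinants with small cycles\<close>

lemma inj_on_Suc_mod: "inj_on (\<lambda>t. Suc t mod K) {..<K}"
proof (rule inj_onI)
  fix s t assume "s \<in> {..<K}" "t \<in> {..<K}" "Suc s mod K = Suc t mod K"
  then show "s = t"
    by (cases "Suc s = K"; cases "Suc t = K") auto
qed

text \<open>Meant for permutations that send every index of a cycle to itself or to its successor: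
  the moved indices are closed under the successor, so none or all of them are moved.\<close>

lemma closed_under_Suc_mod:
  assumes "t \<in> M" "M \<subseteq> {..<K}" "\<And>t. t \<in> M \<Longrightarrow> Suc t mod K \<in> M"
  shows "M = {..<K}"
proof -
  have "(t + i) mod K \<in> M" for i
  proof (induction i)
    case 0
    then show ?case using assms by auto
  next
    case (Suc i)
    have "(t + Suc i) mod K = Suc ((t + i) mod K) mod K" by (simp add: mod_Suc_eq)
    then show ?case using assms(3)[OF Suc] by simp
  qed
  note * = this
  have "u \<in> M" if "u < K" for u
  proof -
    have "t < K" using assms by auto
    then have "(t + (K - t + u)) mod K = u" using that by simp
    then show ?thesis using *[of "K - t + u"] by simp
  qed
  then show ?thesis using assms by auto
qed

text \<open>Conjugation with the diagonal matrix of the \<open>U t\<close> leaves every Leibniz term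
  unchanged and gives the edges of the cycle modulus 1, except for the closing edge of modulus
  \<open>Q\<close>. The identity contributes 1 and the full cycle \<open>Q\<close> in absolute
  value. Any other permutation either moves an index off the cycle and has a zero factor, or uses a
  chord and gains a factor \<open>\<beta>\<close>.\<close>

lemma det_cycle_lower_bound:
  fixes A :: "real ^ 'n ^ 'n" and X :: "nat \<Rightarrow> 'n"
  assumes K: "2 \<le> K" and X: "inj_on X {..<K}"
    and diag: "\<And>i. A $ i $ i = 1"
    and off: "\<And>i j. i \<notin> X ` {..<K} \<Longrightarrow> j \<noteq> i \<Longrightarrow> A $ i $ j = 0"
    and U: "\<And>t. t < K \<Longrightarrow> 0 < U t" "U 0 = 1"
    and edge: "\<And>t. Suc t < K \<Longrightarrow> \<bar>A $ X t $ X (Suc t)\<bar> * U t = U (Suc t)"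
    and Q: "\<bar>A $ X (K - 1) $ X 0\<bar> * U (K - 1) = Q"
    and \<beta>: "0 \<le> \<beta>" "\<beta> \<le> 1"
    and chord: "\<And>a b. a < K \<Longrightarrow> b < K \<Longrightarrow> b \<noteq> a \<Longrightarrow> b \<noteq> Suc a mod K \<Longrightarrow>
      \<bar>A $ X a $ X b\<bar> * U a \<le> \<beta> * U b"
  shows "Q - fact CARD('n) * (\<beta> * max 1 Q) \<le> \<bar>det A - 1\<bar>"
proof -
  define V where "V = X ` {..<K}"
  define T where "T q = of_int (sign q) * (\<Prod>i\<in>UNIV. A $ i $ q i)" for q :: "'n \<Rightarrow> 'n"
  define S where "S = {q :: 'n \<Rightarrow> 'n. q permutes UNIV}"
  have finS: "finite S" unfolding S_def by (simp add: finite_permutations)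
  have cardS: "card S = fact CARD('n)" unfolding S_def by (simp add: card_permutations)
  have det: "det A = (\<Sum>q\<in>S. T q)" unfolding det_def S_def T_def by simp
  have absT: "\<bar>T q\<bar> = (\<Prod>i\<in>UNIV. \<bar>A $ i $ q i\<bar>)" for q
    by (simp add: T_def abs_mult abs_prod sign_def)
  have Q0: "0 \<le> Q" using Q U(1)[of "K - 1"] K by (auto simp flip: Q)
  have ind: "\<exists>t<K. i = X t" if "i \<in> V" for i using that by (auto simp: V_def)

  \<comment> \<open>The factors \<open>U t / U (r t)\<close> may be inserted because
    \<open>r\<close> is a permutation, so that their product is 1.\<close>
  have term_eq: "\<bar>T q\<bar> = (\<Prod>t<K. \<bar>A $ X t $ X (r t)\<bar> * U t / U (r t))"
    if q: "\<And>i. i \<notin> V \<Longrightarrow> q i = i" and r: "bij_betw r {..<K} {..<K}"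
      "\<And>t. t < K \<Longrightarrow> q (X t) = X (r t)" for q r
  proof -
    have "\<bar>T q\<bar> = (\<Prod>i\<in>V. \<bar>A $ i $ q i\<bar>)"
      unfolding absT by (rule prod.mono_neutral_right) (auto simp: q diag)
    also have "\<dots> = (\<Prod>t<K. \<bar>A $ X t $ X (r t)\<bar>)"
      unfolding V_def by (subst prod.reindex[OF X]) (auto simp: r)
    also have "\<dots> = (\<Prod>t<K. \<bar>A $ X t $ X (r t)\<bar>) * ((\<Prod>t<K. U t) / (\<Prod>t<K. U (r t)))"
    proof -
      have "(\<Prod>t<K. U (r t)) = (\<Prod>t<K. U t)"
        by (rule prod.reindex_bij_betw[OF r(1)])
      moreover have "(\<Prod>t<K. U t) > 0" using U by (intro prod_pos) auto
      ultimately show ?thesis by (simp del: prod_zero_iff)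
    qed
    also have "\<dots> = (\<Prod>t<K. \<bar>A $ X t $ X (r t)\<bar> * U t / U (r t))"
      by (simp add: prod.distrib prod_dividef)
    finally show ?thesis .
  qed

  define p where "p i = (if i \<in> V then X (Suc (inv_into {..<K} X i) mod K) else i)" for i
  have pX: "p (X t) = X (Suc t mod K)" if "t < K" for t
    using that X by (auto simp: p_def V_def)
  have sucK: "Suc t mod K < K" for t using K by auto
  have bijs: "bij_betw (\<lambda>t. Suc t mod K) {..<K} {..<K}"
    using inj_on_Suc_mod by (intro bij_betw_imageI endo_inj_surj) (auto simp: sucK)
  have "p permutes V"
  proof (rule inj_imp_permutes)
    show "inj_on p V"
    proof (rule inj_onI)
      fix i j assume "i \<in> V" "j \<in> V" "p i = p j"
      then obtain s t where st: "s < K" "t < K" "i = X s" "j = X t" using ind by blast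
      then have "X (Suc s mod K) = X (Suc t mod K)" using \<open>p i = p j\<close> pX by simp
      then have "Suc s mod K = Suc t mod K" using inj_onD[OF X] sucK by simp
      then have "s = t" using st inj_onD[OF inj_on_Suc_mod, of s K t] by simp
      then show "i = j" using st by simp
    qed
    show "p i \<in> V" if "i \<in> V" for i
      using ind[OF that] pX sucK by (auto simp: V_def)
  qed (auto simp: V_def p_def)
  then have "p \<in> S" unfolding S_def using permutes_superset[of p V UNIV] by (auto intro: permutes_subset)
  have "\<bar>T p\<bar> = (\<Prod>t<K. if t = K - 1 then Q else 1)"
  proof -
    have "\<bar>T p\<bar> = (\<Prod>t<K. \<bar>A $ X t $ X (Suc t mod K)\<bar> * U t / U (Suc t mod K))"
      using pX bijs by (intro term_eq) (auto simp: p_def)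
    also have "\<dots> = (\<Prod>t<K. if t = K - 1 then Q else 1)"
    proof (rule prod.cong)
      fix t assume t: "t \<in> {..<K}"
      show "\<bar>A $ X t $ X (Suc t mod K)\<bar> * U t / U (Suc t mod K) = (if t = K - 1 then Q else 1)"
      proof (cases "Suc t = K")
        case True
        then show ?thesis using Q U by auto
      next
        case False
        then have "Suc t < K" using t by auto
        then show ?thesis using edge[of t] U(1)[of "Suc t"] by auto
      qed
    qed simp
    finally show ?thesis .
  qed
  then have Tp: "\<bar>T p\<bar> = Q" using K by (simp add: prod.delta)
  have "p \<noteq> id"
  proof
    assume "p = id"
    then have "X 0 = X 1" using pX[of 0] K by simp
    then show False using inj_onD[OF X, of 0 1] K by auto
  qed
  have "id \<in> S" unfolding S_def by (simp add: permutes_id)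
  have Tid: "T id = 1" by (simp add: T_def diag)

  have other: "\<bar>T q\<bar> \<le> \<beta> * max 1 Q" if "q \<in> S - {id, p}" for q
  proof (cases "\<forall>i. i \<notin> V \<longrightarrow> q i = i")
    case False
    then obtain i where "i \<notin> V" "q i \<noteq> i" by auto
    then have "\<bar>T q\<bar> = 0" unfolding absT using off[of i "q i"] by (auto simp: V_def)
    then show ?thesis using \<beta> by simp
  next
    case True
    have injq: "inj q" using that by (auto simp: S_def permutes_inj)
    have qV: "q i \<in> V" if "i \<in> V" for i
      using True injq that by (metis injD)
    define r where "r t = inv_into {..<K} X (q (X t))" for t
    have rK: "r t < K" "q (X t) = X (r t)" if "t < K" for t
    proof -
      have "q (X t) \<in> X ` {..<K}" using qV[of "X t"] that by (auto simp: V_def)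
      from inv_into_into[OF this] f_inv_into_f[OF this] show "r t < K" "q (X t) = X (r t)"
        by (simp_all add: r_def)
    qed
    have "inj_on r {..<K}"
    proof (rule inj_onI)
      fix s t assume st: "s \<in> {..<K}" "t \<in> {..<K}" "r s = r t"
      then have "q (X s) = q (X t)" using rK by auto
      then have "X s = X t" using injq by (auto dest: injD)
      then show "s = t" using inj_onD[OF X] st by auto
    qed
    then have bijr: "bij_betw r {..<K} {..<K}"
      using rK by (intro bij_betw_imageI endo_inj_surj) auto
    have "\<exists>t<K. r t \<noteq> t \<and> r t \<noteq> Suc t mod K"
    proof (rule ccontr)
      assume neg: "\<not> ?thesis"
      define M where "M = {t. t < K \<and> r t \<noteq> t}"
      have "q \<noteq> id" using that by auto
      then obtain i where "q i \<noteq> i" by (metis eq_id_iff)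
      then have "i \<in> V" using True by auto
      then obtain t where "t < K" "i = X t" using ind by blast
      then have "t \<in> M" using \<open>q i \<noteq> i\<close> rK by (auto simp: M_def)
      moreover have "Suc t mod K \<in> M" if "t \<in> M" for t
      proof -
        have *: "r t = Suc t mod K" "t < K" "Suc t mod K \<noteq> t" using that neg by (auto simp: M_def)
        have "r (Suc t mod K) \<noteq> Suc t mod K"
        proof
          assume "r (Suc t mod K) = Suc t mod K"
          then have "r (Suc t mod K) = r t" using * by simp
          then have "Suc t mod K = t"
            using inj_onD[OF \<open>inj_on r {..<K}\<close>, of "Suc t mod K" t] * sucK by simp
          then show False using * by simp
        qed
        then show ?thesis using sucK by (auto simp: M_def)
      qed
      ultimately have "M = {..<K}" by (intro closed_under_Suc_mod) (auto simp: M_def)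
      then have "r t = Suc t mod K" if "t < K" for t using that neg by (auto simp: M_def)
      then have rt: "r t = Suc t mod K" if "t < K" for t using that by simp
      have "q i = p i" for i
      proof (cases "i \<in> V")
        case True
        then obtain t where "t < K" "i = X t" using ind by blast
        then show ?thesis using rK(2) rt pX by simp
      qed (use True p_def in auto)
      then have "q = p" by blast
      then show False using that by simp
    qed
    then obtain t0 where t0: "t0 < K" "r t0 \<noteq> t0" "r t0 \<noteq> Suc t0 mod K" by auto
    have "\<bar>T q\<bar> = (\<Prod>t<K. \<bar>A $ X t $ X (r t)\<bar> * U t / U (r t))"
      using True rK bijr by (intro term_eq) auto
    \<comment> \<open>The chord at \<open>t0\<close> supplies \<open>\<beta>\<close>, the closing
      edge, if used, at most \<open>max 1 Q\<close>; the remaining factors are at most 1.\<close>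
    also have "\<dots> \<le> (\<Prod>t<K. (if t = t0 then \<beta> else 1) * (if t = K - 1 then max 1 Q else 1))"
    proof (rule prod_mono, intro conjI)
      fix t assume "t \<in> {..<K}"
      then have t: "t < K" by simp
      have Ur: "0 < U (r t)" "0 < U t" using rK t U by auto
      then show "0 \<le> \<bar>A $ X t $ X (r t)\<bar> * U t / U (r t)" by simp
      consider "r t = t" | "r t \<noteq> t" "r t = Suc t mod K" | "r t \<noteq> t" "r t \<noteq> Suc t mod K" by blast
      then show "\<bar>A $ X t $ X (r t)\<bar> * U t / U (r t)
        \<le> (if t = t0 then \<beta> else 1) * (if t = K - 1 then max 1 Q else 1)"
      proof cases
        case 1
        then show ?thesis using t0 Ur diag by auto
      next
        case 2
        then have "t \<noteq> t0" using t0 by auto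
        show ?thesis
        proof (cases "Suc t = K")
          case True
          then show ?thesis using 2 Q U \<open>t \<noteq> t0\<close> by auto
        next
          case False
          then have "Suc t < K" using t by auto
          then show ?thesis using edge[of t] U(1)[of "Suc t"] 2 \<open>t \<noteq> t0\<close> by auto
        qed
      next
        case 3
        have "\<bar>A $ X t $ X (r t)\<bar> * U t / U (r t) \<le> \<beta>"
          using chord[OF t _ 3] rK t Ur by (simp add: divide_simps)
        also have "\<dots> \<le> (if t = t0 then \<beta> else 1) * 1" using \<beta> by auto
        also have "\<dots> \<le> (if t = t0 then \<beta> else 1) * (if t = K - 1 then max 1 Q else 1)"
          using \<beta> by (intro mult_left_mono) auto
        finally show ?thesis .
      qed
    qed
    also have "\<dots> = \<beta> * max 1 Q"
      using t0 K by (simp add: prod.distrib prod.delta)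
    finally show ?thesis .
  qed
  have "det A - 1 = T p + (\<Sum>q\<in>S - {id, p}. T q)"
  proof -
    have "det A = T id + (\<Sum>q\<in>S - {id}. T q)"
      unfolding det using finS \<open>id \<in> S\<close> by (rule sum.remove)
    also have "(\<Sum>q\<in>S - {id}. T q) = T p + (\<Sum>q\<in>S - {id} - {p}. T q)"
      using finS \<open>p \<in> S\<close> \<open>p \<noteq> id\<close> by (intro sum.remove) auto
    also have "S - {id} - {p} = S - {id, p}" by auto
    finally show ?thesis using Tid by linarith
  qed
  moreover have "\<bar>\<Sum>q\<in>S - {id, p}. T q\<bar> \<le> fact CARD('n) * (\<beta> * max 1 Q)"
  proof -
    have "\<bar>\<Sum>q\<in>S - {id, p}. T q\<bar> \<le> (\<Sum>q\<in>S - {id, p}. \<beta> * max 1 Q)"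
      using other by (intro order_trans[OF sum_abs] sum_mono) auto
    also have "\<dots> \<le> (\<Sum>q\<in>S. \<beta> * max 1 Q)"
      using finS \<beta> by (intro sum_mono2) auto
    finally show ?thesis using cardS by simp
  qed
  ultimately show ?thesis using Tp by linarith
qed

section \<open>Small cycles in families of near-identity matrices\<close>

text \<open>\<open>R s j\<close> is row \<open>j\<close> of the matrix with index \<open>s\<close>.
  The edge from \<open>j\<close> to \<open>i\<close> is weighted by the worst case over all
  \<open>s\<close>; loops get weight 0, so the unit diagonal produces no cycles.\<close>

definition max_entry :: "('s :: finite \<Rightarrow> 'n \<Rightarrow> real ^ 'n) \<Rightarrow> 'n \<Rightarrow> 'n \<Rightarrow> real" where
  "max_entry R j i = (if i = j then 0 else Max (range (\<lambda>s. \<bar>R s j $ i\<bar>)))"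

lemma max_entry_ge: "i \<noteq> j \<Longrightarrow> \<bar>R s j $ i\<bar> \<le> max_entry R j i"
  by (auto simp: max_entry_def)

lemma max_entry_attained: "i \<noteq> j \<Longrightarrow> \<exists>s. \<bar>R s j $ i\<bar> = max_entry R j i"
proof -
  have "Max (range (\<lambda>s. \<bar>R s j $ i\<bar>)) \<in> range (\<lambda>s. \<bar>R s j $ i\<bar>)" by (rule Max_in) auto
  then obtain s where "Max (range (\<lambda>s. \<bar>R s j $ i\<bar>)) = \<bar>R s j $ i\<bar>" by (rule imageE)
  then show "i \<noteq> j \<Longrightarrow> ?thesis" by (auto simp: max_entry_def)
qed

lemma max_entry_nonneg: "0 \<le> max_entry R j i"
proof (cases "i = j")
  case False
  then show ?thesis using max_entry_ge[of i j R undefined] by linarith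
qed (simp add: max_entry_def)

text \<open>The determinant condition covers all matrices that take each row \<open>j\<close> from
  an arbitrary index \<open>\<sigma> j\<close>, so the largest entries of different rows can be
  realised simultaneously. The identity matrix at \<open>s0\<close> supplies unit rows outside a
  given cycle.\<close>

definition near_identity :: "real \<Rightarrow> 's \<Rightarrow> ('s \<Rightarrow> 'n \<Rightarrow> real ^ 'n) \<Rightarrow> bool" where
  "near_identity \<theta> s0 R \<longleftrightarrow> (\<forall>s j. R s j $ j = 1) \<and> (\<forall>j. R s0 j = axis j 1) \<and>
     (\<forall>\<sigma>. \<bar>det (\<chi> j. R (\<sigma> j) j) - 1\<bar> \<le> \<theta>)"

text \<open>
  After rescaling by the potential \<open>U\<close> all edges of the cycle but the closing one have weight 1, and a
  chord completes a path of the cycle to a shorter cycle, so it is small. Hence only the identity and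
  the cycle itself contribute substantially to the determinant.
\<close>

lemma long_cycle_weight_le:
  fixes R :: "'s :: finite \<Rightarrow> 'n \<Rightarrow> real ^ 'n"
  assumes R: "near_identity \<theta> s0 R" and \<theta>: "\<theta> \<le> e / 2"
    and e: "0 < e" "e \<le> 1"
    and short: "\<And>x xs. distinct (x # xs) \<Longrightarrow> length (x # xs) < length zs \<Longrightarrow>
      path_weight (max_entry R) (x # xs @ [x]) \<le> e\<^sup>2 / (2 * fact CARD('n))"
    and zs: "distinct zs" "2 \<le> length zs"
  shows "path_weight (max_entry R) (zs @ [hd zs]) \<le> e"
proof (rule ccontr)
  define W where "W = max_entry R"
  define K where "K = length zs"
  define Q where "Q = path_weight W (zs @ [hd zs])"
  define U where "U t = path_weight W (take (Suc t) zs)" for t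
  \<comment> \<open>One factor \<open>e\<close> is lost when a forward chord is compared with the
    cycle weight \<open>Q > e\<close>; what remains,
    \<open>\<beta> = e / (2 * fact CARD('n))\<close>, keeps the sum of all error terms below
    \<open>Q / 2\<close>.\<close>
  define \<eta> where "\<eta> = e\<^sup>2 / (2 * fact CARD('n))"
  define \<beta> where "\<beta> = \<eta> / e"
  assume "\<not> ?thesis"
  then have Qe: "e < Q" by (simp add: Q_def W_def)
  have W0: "0 \<le> W x y" for x y by (simp add: W_def max_entry_nonneg)
  have K: "2 \<le> K" using zs by (simp add: K_def)
  then have zsne: "zs \<noteq> []" by (auto simp: K_def)
  have hd: "hd zs = zs ! 0" using zsne by (simp add: hd_conv_nth)
  have inj: "inj_on ((!) zs) {..<K}" using zs by (auto simp: inj_on_def K_def nth_eq_iff_index_eq)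
  have sucK: "Suc t mod K < K" for t using K by auto
  have \<eta>0: "0 < \<eta>" using e by (simp add: \<eta>_def)
  have \<beta>: "\<beta> = e / (2 * fact CARD('n))" using e by (simp add: \<beta>_def \<eta>_def power2_eq_square)
  have fact1: "(1::real) \<le> fact CARD('n)" by (rule fact_ge_1)
  have \<beta>01: "0 < \<beta>" "\<beta> \<le> 1" using e fact1 by (auto simp: \<beta> divide_simps intro: order_trans[of e 2])

  have split: "path_weight W (take t zs @ [zs ! t]) * path_weight W (drop t zs @ [hd zs]) = Q"
    if "t < K" for t
    using path_weight_append[of W "take t zs" "zs ! t" "drop (Suc t) zs @ [hd zs]"] that
    by (simp add: Q_def K_def Cons_nth_drop_Suc id_take_nth_drop[symmetric] flip: append_Cons)
       (simp add: append_assoc[symmetric] del: append_assoc)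
  have U_alt: "U t = path_weight W (take t zs @ [zs ! t])" if "t < K" for t
    using that by (simp add: U_def take_Suc_conv_app_nth K_def)
  have U_split: "U t * path_weight W (drop t zs @ [hd zs]) = Q" if "t < K" for t
    using split[OF that] U_alt[OF that] by simp
  have Upos: "0 < U t" if "t < K" for t
    using U_split[OF that] Qe e path_weight_nonneg[of W, OF W0]
    by (metis U_def less_eq_real_def less_trans mult_zero_left not_less_iff_gr_or_eq)
  have last: "last (take (Suc t) zs) = zs ! t" if "t < K" for t
    using that by (simp add: take_Suc_conv_app_nth K_def)
  have U_snoc: "path_weight W (take (Suc t) zs @ [y]) = U t * W (zs ! t) y" if "t < K" for t y
    using path_weight_snoc[of "take (Suc t) zs" W y] zsne last[OF that] by (simp add: U_def)
  have U_Suc: "U (Suc t) = U t * W (zs ! t) (zs ! Suc t)" if "Suc t < K" for t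
    using U_alt[of "Suc t"] U_snoc[of t] that by simp
  have Q_alt: "Q = U (K - 1) * W (zs ! (K - 1)) (zs ! 0)"
    using U_snoc[of "K - 1" "hd zs"] K hd by (simp add: Q_def K_def)

  \<comment> \<open>Rows on the cycle are chosen to attain the weight of the outgoing edge; all
    other rows are unit vectors from \<open>s0\<close>.\<close>
  have "\<exists>s. (j \<notin> set zs \<longrightarrow> s = s0) \<and>
      (\<forall>t<K. zs ! t = j \<longrightarrow> \<bar>R s j $ (zs ! (Suc t mod K))\<bar> = W j (zs ! (Suc t mod K)))" for j
  proof (cases "j \<in> set zs")
    case True
    then obtain t where t: "t < K" "zs ! t = j" by (auto simp: in_set_conv_nth K_def)
    have "Suc t mod K \<noteq> t" using t K by (cases "Suc t = K") auto
    then have "zs ! (Suc t mod K) \<noteq> j"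
      using t inj_onD[OF inj, of "Suc t mod K" t] sucK[of t] by auto
    then obtain s where s: "\<bar>R s j $ (zs ! (Suc t mod K))\<bar> = W j (zs ! (Suc t mod K))"
      using max_entry_attained unfolding W_def by metis
    have "t' = t" if "t' < K" "zs ! t' = j" for t'
      using inj_onD[OF inj, of t' t] that t by simp
    then show ?thesis using s True by blast
  qed (auto simp: K_def)
  then obtain \<sigma> where \<sigma>: "\<And>j. j \<notin> set zs \<Longrightarrow> \<sigma> j = s0"
    "\<And>j t. t < K \<Longrightarrow> zs ! t = j \<Longrightarrow> \<bar>R (\<sigma> j) j $ (zs ! (Suc t mod K))\<bar> = W j (zs ! (Suc t mod K))"
    by metis
  define A where "A = (\<chi> j. R (\<sigma> j) j)"
  have AW: "\<bar>A $ j $ i\<bar> \<le> W j i" if "i \<noteq> j" for i j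
    using max_entry_ge[OF that] by (simp add: A_def W_def)

  have "Q - fact CARD('n) * (\<beta> * max 1 Q) \<le> \<bar>det A - 1\<bar>"
  proof (rule det_cycle_lower_bound[where X = "(!) zs" and K = K and U = U])
    show "A $ i $ i = 1" for i using R by (simp add: A_def near_identity_def)
    show "A $ i $ j = 0" if "i \<notin> (!) zs ` {..<K}" "j \<noteq> i" for i j
    proof -
      have "i \<notin> set zs" using that by (auto simp: in_set_conv_nth K_def)
      then show ?thesis using R \<sigma>(1) that by (auto simp: A_def near_identity_def axis_def)
    qed
    show "U 0 = 1" using zsne by (cases zs) (auto simp: U_def)
    show "\<bar>A $ (zs ! t) $ (zs ! Suc t)\<bar> * U t = U (Suc t)" if "Suc t < K" for t
      using \<sigma>(2)[of t "zs ! t"] U_Suc that by (simp add: A_def)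
    show "\<bar>A $ (zs ! (K - 1)) $ (zs ! 0)\<bar> * U (K - 1) = Q"
      using \<sigma>(2)[of "K - 1" "zs ! (K - 1)"] Q_alt K by (simp add: A_def)
    fix a b assume ab: "a < K" "b < K" "b \<noteq> a" "b \<noteq> Suc a mod K"
    have "zs ! b \<noteq> zs ! a" using inj_onD[OF inj, of b a] ab by auto
    then have "\<bar>A $ (zs ! a) $ (zs ! b)\<bar> * U a \<le> W (zs ! a) (zs ! b) * U a"
      using AW Upos[OF ab(1)] by (intro mult_right_mono) auto
    also have "\<dots> \<le> \<beta> * U b"
    proof (cases "b < a")
      case True
      \<comment> \<open>A backward chord closes the stretch of the cycle from \<open>zs ! b\<close>
        to \<open>zs ! a\<close>.\<close>
      define ys where "ys = drop (Suc b) (take (Suc a) zs)"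
      have tk: "take (Suc a) zs = take b zs @ zs ! b # ys"
        using id_take_nth_drop[of b "take (Suc a) zs"] True ab by (simp add: ys_def K_def min_def)
      have "length (zs ! b # ys) < length zs"
        using ab True by (cases "Suc a = K") (auto simp: ys_def K_def)
      moreover have "distinct (zs ! b # ys)"
        using distinct_take[OF zs(1), of "Suc a"] unfolding tk by simp
      ultimately have "path_weight W (zs ! b # ys @ [zs ! b]) \<le> \<eta>"
        using short by (auto simp: W_def \<eta>_def)
      moreover have "U a * W (zs ! a) (zs ! b) = U b * path_weight W (zs ! b # ys @ [zs ! b])"
        using U_snoc[of a "zs ! b"] path_weight_append[of W "take b zs" "zs ! b" "ys @ [zs ! b]"]
          U_alt ab by (simp add: tk)
      ultimately have "W (zs ! a) (zs ! b) * U a \<le> U b * \<eta>"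
        using Upos[OF ab(2)] by (simp add: mult.commute)
      also have "\<dots> \<le> U b * \<beta>"
        using Upos[OF ab(2)] e \<eta>0 by (intro mult_left_mono) (auto simp: \<beta>_def divide_simps)
      finally show ?thesis by (simp add: mult.commute)
    next
      case False
      then have lt: "Suc a < b" using ab by (cases "Suc a = K") auto
      \<comment> \<open>A forward chord skips vertices: the shorter cycle runs from
        \<open>zs ! b\<close> over the closing edge to \<open>zs ! a\<close> and back along the
        chord. Its first stretch has weight \<open>Q / U b\<close>, which leads to a division by
        \<open>Q > e\<close>.\<close>
      define ys where "ys = drop (Suc b) zs @ take (Suc a) zs"
      have dr: "drop b zs = zs ! b # drop (Suc b) zs"
        using ab by (simp add: Cons_nth_drop_Suc K_def)
      have "length (zs ! b # ys) < length zs"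
        using ab lt by (auto simp: ys_def K_def)
      moreover have "distinct (zs ! b # ys)"
      proof -
        have "distinct (take (Suc a) zs @ drop b zs)"
          using zs(1) set_take_disj_set_drop_if_distinct[OF zs(1), of "Suc a" b] lt by simp
        then show ?thesis unfolding dr ys_def by auto
      qed
      ultimately have le: "path_weight W (zs ! b # ys @ [zs ! b]) \<le> \<eta>"
        using short by (auto simp: W_def \<eta>_def)
      have "path_weight W (zs ! b # ys @ [zs ! b])
        = path_weight W (drop b zs @ [hd zs]) * path_weight W (take (Suc a) zs @ [zs ! b])"
      proof -
        have "zs ! b # ys @ [zs ! b] = drop b zs @ hd zs # (tl (take (Suc a) zs) @ [zs ! b])"
          unfolding dr ys_def using zsne by (cases zs) simp_all
        moreover have "take (Suc a) zs @ [zs ! b] = hd zs # (tl (take (Suc a) zs) @ [zs ! b])"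
          using zsne by (cases zs) simp_all
        ultimately show ?thesis using path_weight_append by metis
      qed
      also have "path_weight W (take (Suc a) zs @ [zs ! b]) = U a * W (zs ! a) (zs ! b)"
        using U_snoc ab by simp
      finally have "U b * path_weight W (drop b zs @ [hd zs]) * (U a * W (zs ! a) (zs ! b)) \<le> U b * \<eta>"
        using le Upos[OF ab(2)] by (simp add: mult.assoc)
      then have "Q * (U a * W (zs ! a) (zs ! b)) \<le> U b * \<eta>"
        using U_split[OF ab(2)] by simp
      moreover have "e * (U a * W (zs ! a) (zs ! b)) \<le> Q * (U a * W (zs ! a) (zs ! b))"
        using Qe Upos[OF ab(1)] W0 by (intro mult_right_mono) auto
      ultimately show ?thesis using e by (simp add: \<beta>_def field_simps)
    qed
    finally show "\<bar>A $ (zs ! a) $ (zs ! b)\<bar> * U a \<le> \<beta> * U b" .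
  qed (use K inj Upos \<beta>01 in auto)
  also have "\<bar>det A - 1\<bar> \<le> e / 2"
    using R \<theta> order_trans unfolding near_identity_def A_def by blast
  finally have "Q - fact CARD('n) * (\<beta> * max 1 Q) \<le> e / 2" .
  moreover have "fact CARD('n) * (\<beta> * max 1 Q) \<le> Q / 2"
  proof -
    have "max 1 Q \<le> Q / e"
      using Qe e by (auto simp: field_simps)
    then have "e / 2 * max 1 Q \<le> e / 2 * (Q / e)" using e by (intro mult_left_mono) auto
    then show ?thesis using e by (simp add: \<beta>)
  qed
  ultimately show False using Qe by linarith
qed

text \<open>Induction on the cycle length with \<open>e\<close> arbitrary: to bound cycles of one
  length by \<open>e\<close>, all shorter ones must obey the much smaller bound
  \<open>e\<^sup>2 / (2 * fact CARD('n))\<close>, with \<open>e\<close> capped at 1. As lengths do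
  not exceed \<open>CARD('n)\<close>, finitely many thresholds are combined.\<close>

lemma cycle_weights_small:
  fixes s0 :: "'s :: finite" and e :: real
  assumes "0 < e"
  shows "\<exists>\<theta>>0. \<forall>R :: 's \<Rightarrow> 'n :: finite \<Rightarrow> real ^ 'n. near_identity \<theta> s0 R \<longrightarrow>
    (\<forall>x xs. distinct (x # xs) \<longrightarrow> path_weight (max_entry R) (x # xs @ [x]) \<le> e)"
proof -
  have "\<exists>\<theta>>0. \<forall>R :: 's \<Rightarrow> 'n :: finite \<Rightarrow> real ^ 'n. near_identity \<theta> s0 R \<longrightarrow>
    (\<forall>x xs. distinct (x # xs) \<longrightarrow> length (x # xs) \<le> k \<longrightarrow> path_weight (max_entry R) (x # xs @ [x]) \<le> e)"
    if "0 < e" for k and e :: real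
    using that
  proof (induction k arbitrary: e)
    case 0
    then show ?case by (auto intro: exI[of _ 1])
  next
    case (Suc k)
    define e1 where "e1 = min e 1"
    define \<eta> where "\<eta> = e1\<^sup>2 / (2 * fact CARD('n))"
    have e1: "0 < e1" "e1 \<le> 1" "e1 \<le> e" using Suc.prems by (auto simp: e1_def)
    have "0 < \<eta>" using e1 by (simp add: \<eta>_def)
    from Suc.IH[OF this] obtain \<theta> where \<theta>: "0 < \<theta>"
      "\<And>R :: 's \<Rightarrow> 'n \<Rightarrow> real ^ 'n. \<And>x xs. near_identity \<theta> s0 R \<Longrightarrow> distinct (x # xs) \<Longrightarrow>
        length (x # xs) \<le> k \<Longrightarrow> path_weight (max_entry R) (x # xs @ [x]) \<le> \<eta>"
      by blast
    have "path_weight (max_entry R) (x # xs @ [x]) \<le> e"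
      if R: "near_identity (min \<theta> (e1 / 2)) s0 R" and d: "distinct (x # xs)" and l: "length (x # xs) \<le> Suc k"
      for R :: "'s \<Rightarrow> 'n \<Rightarrow> real ^ 'n" and x xs
    proof (cases xs)
      case Nil
      then show ?thesis using Suc.prems by (simp add: max_entry_def)
    next
      case (Cons y ys)
      have R': "near_identity \<theta> s0 R" using R by (auto simp: near_identity_def)
      have "path_weight (max_entry R) ((x # xs) @ [hd (x # xs)]) \<le> e1"
      proof (rule long_cycle_weight_le[OF R _ e1(1,2)])
        show "path_weight (max_entry R) (z # zs @ [z]) \<le> e1\<^sup>2 / (2 * fact CARD('n))"
          if "distinct (z # zs)" "length (z # zs) < length (x # xs)" for z zs
          using \<theta>(2)[OF R' that(1)] that(2) l by (simp add: \<eta>_def)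
      qed (use d Cons in auto)
      then show ?thesis using e1 by simp
    qed
    then show ?case using \<theta>(1) e1(1) by (intro exI[of _ "min \<theta> (e1 / 2)"]) auto
  qed
  from this[OF assms, of "CARD('n)"] show ?thesis
    by (metis distinct_card card_mono finite subset_UNIV)
qed

section \<open>Common positive combinations of rows\<close>

text \<open>Taking the determinant as a function of the family of rows turns the replacement of a
  row into a function update.\<close>

definition fdet :: "('n \<Rightarrow> real ^ 'n) \<Rightarrow> real" where
  "fdet f = det (\<chi> i. f i)"

lemma fdet_upd: "fdet (f(k := p)) = det (\<chi> i. if i = k then p else f i)"
  by (simp add: fdet_def fun_upd_def)

lemma fdet_upd_sum:
  "finite S \<Longrightarrow> fdet (f(k := (\<Sum>i\<in>S. c i *\<^sub>R p i))) = (\<Sum>i\<in>S. c i * fdet (f(k := p i)))"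
  unfolding fdet_upd scalar_mult_eq_scaleR[symmetric]
  by (subst det_linear_row_sum) (simp_all add: det_row_mul)

lemma fdet_identical: "i \<noteq> j \<Longrightarrow> f i = f j \<Longrightarrow> fdet f = 0"
  unfolding fdet_def by (rule det_identical_rows[of i j]) (auto simp: row_def)

lemma fdet_cramer:
  assumes "fdet f \<noteq> 0"
  shows "p = (\<Sum>i\<in>UNIV. (fdet (f(i := p)) / fdet f) *\<^sub>R f i)"
proof -
  let ?A = "\<chi> i. f i"
  have "invertible (transpose ?A)"
    using assms by (simp add: invertible_det_nz fdet_def det_transpose)
  then obtain B where B: "transpose ?A ** B = mat 1" unfolding invertible_def by auto
  define c where "c = B *v p"
  have "transpose ?A *v c = p"
    unfolding c_def matrix_vector_mul_assoc B by simp
  then have p: "p = (\<Sum>i\<in>UNIV. (c $ i) *\<^sub>R f i)"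
    by (auto simp: matrix_vector_mult_def transpose_def vec_eq_iff mult.commute)
  have "fdet (f(k := p)) = c $ k * fdet f" for k
    using cramer_lemma_transpose[of k c ?A]
    by (subst p) (simp add: fdet_upd row_def scalar_mult_eq_scaleR fdet_def cong: if_cong)
  then show ?thesis using p assms by simp
qed

lemma fdet_mult:
  assumes "\<And>j. p j = (\<Sum>i\<in>UNIV. c j i *\<^sub>R b i)"
  shows "fdet p = fdet (\<lambda>j. \<chi> i. c j i) * fdet b"
proof -
  have "(\<chi> j. p j) = (\<chi> j. \<chi> i. c j i) ** (\<chi> i. b i)"
    by (simp add: matrix_matrix_mult_def assms vec_eq_iff)
  then show ?thesis unfolding fdet_def by (simp add: det_mul)
qed

lemma fdet_scale: "fdet (\<lambda>j. c j *\<^sub>R p j) = prod c UNIV * fdet p"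
  unfolding fdet_def scalar_mult_eq_scaleR[symmetric] by (rule det_rows_mul)

lemma path_weight_divide:
  "path_weight (\<lambda>x y. W x y / \<tau>) xs = path_weight W xs / \<tau> ^ (length xs - 1)"
  by (induction xs rule: induct_list012) auto

text \<open>Diagonal dominance: in terms of \<open>u j = w j / v j\<close> the system says that
  \<open>u i\<close> plus a perturbation equals 1, and the perturbation is at most a quarter of
  \<open>B\<close>, the maximum of all \<open>\<bar>u j\<bar>\<close>. Hence
  \<open>B \<le> 4 / 3\<close>, and every \<open>u i\<close> is at least 2/3.\<close>

lemma positive_combination:
  fixes R :: "'s \<Rightarrow> 'n :: finite \<Rightarrow> real ^ 'n"
  assumes diag: "\<And>j. R s j $ j = 1" and det: "fdet (R s) \<noteq> 0"
    and v: "\<And>j. 0 < v j"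
    and off: "\<And>i j. i \<noteq> j \<Longrightarrow> v j * \<bar>R s j $ i\<bar> \<le> v i / (4 * CARD('n))"
  shows "\<exists>w. (\<forall>j. 0 < w j) \<and> (\<chi> i. v i) = (\<Sum>j\<in>UNIV. w j *\<^sub>R R s j)"
proof -
  obtain w where w: "(\<chi> i. v i) = (\<Sum>j\<in>UNIV. w j *\<^sub>R R s j)"
    by (rule that[OF fdet_cramer[OF det]])
  define u where "u j = w j / v j" for j
  define B where "B = Max (range (\<lambda>j. \<bar>u j\<bar>))"
  have uB: "\<bar>u j\<bar> \<le> B" for j by (simp add: B_def)
  then have B0: "0 \<le> B" using abs_ge_zero order_trans by blast
  have wj: "w j = u j * v j" for j using v[of j] by (simp add: u_def)
  have dev: "\<bar>1 - u i\<bar> \<le> B / 4" for i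
  proof -
    have "v i = (\<Sum>j\<in>UNIV. w j * R s j $ i)"
      using arg_cong[OF w, of "\<lambda>x. x $ i"] by simp
    also have "\<dots> = w i + (\<Sum>j\<in>UNIV - {i}. w j * R s j $ i)"
      by (subst sum.remove[of _ i]) (auto simp: diag)
    finally have "v i - w i = (\<Sum>j\<in>UNIV - {i}. w j * R s j $ i)" by simp
    then have "\<bar>v i - w i\<bar> \<le> (\<Sum>j\<in>UNIV - {i}. \<bar>w j * R s j $ i\<bar>)" by simp
    also have "\<dots> \<le> (\<Sum>j\<in>UNIV - {i}. B * (v i / (4 * CARD('n))))"
    proof (rule sum_mono)
      fix j assume "j \<in> UNIV - {i}"
      then have "\<bar>w j * R s j $ i\<bar> = \<bar>u j\<bar> * (v j * \<bar>R s j $ i\<bar>)"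
        using v[of j] by (simp add: wj abs_mult)
      also have "\<dots> \<le> B * (v i / (4 * CARD('n)))"
        using uB off[of i j] \<open>j \<in> _\<close> v[of j] B0 by (intro mult_mono) auto
      finally show "\<bar>w j * R s j $ i\<bar> \<le> B * (v i / (4 * CARD('n)))" .
    qed
    also have "\<dots> \<le> (\<Sum>j\<in>(UNIV::'n set). B * (v i / (4 * CARD('n))))"
      using B0 v[of i] by (intro sum_mono2) auto
    also have "\<dots> = v i * (B / 4)" by simp
    also have "v i - w i = v i * (1 - u i)" by (simp add: wj algebra_simps)
    finally have "v i * \<bar>1 - u i\<bar> \<le> v i * (B / 4)"
      using v[of i] by (simp add: abs_mult)
    then show ?thesis using v[of i] by simp
  qed
  have "B \<in> range (\<lambda>j. \<bar>u j\<bar>)" unfolding B_def by (rule Max_in) auto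
  then obtain i where "B = \<bar>u i\<bar>" by auto
  then have "B \<le> 4 / 3" using dev[of i] by linarith
  then have "0 < u j" for j using dev[of j] by linarith
  then have "0 < w j" for j using v wj by simp
  then show ?thesis using w by blast
qed

text \<open>The potential of the weights \<open>max_entry R x y / \<tau>\<close> is itself the
  common vector, as it dominates the off-diagonal entries of all matrices at once. A cycle has at
  most \<open>CARD('n)\<close> edges, so the bound \<open>\<tau> ^ CARD('n)\<close> on cycle weights
  survives the division of every edge by \<open>\<tau>\<close>.\<close>

lemma near_identity_common_point:
  fixes s0 :: "'s :: finite"
  shows "\<exists>\<theta>>0. \<forall>R :: 's \<Rightarrow> 'n :: finite \<Rightarrow> real ^ 'n. near_identity \<theta> s0 R \<longrightarrow>
    (\<exists>v. (\<forall>i. 0 < v i) \<and>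
      (\<forall>s. \<exists>w. (\<forall>j. 0 < w j) \<and> (\<chi> i. v i) = (\<Sum>j\<in>UNIV. w j *\<^sub>R R s j)))"
proof -
  define \<tau> :: real where "\<tau> = 1 / (4 * CARD('n))"
  have "1 \<le> real CARD('n)" by (simp add: Suc_le_eq)
  then have \<tau>: "0 < \<tau>" "\<tau> \<le> 1" by (auto simp: \<tau>_def divide_simps intro: order_trans[of 1 "real CARD('n)"])
  obtain \<theta> where \<theta>: "\<theta> > 0"
    "\<And>R :: 's \<Rightarrow> 'n \<Rightarrow> real ^ 'n. \<And>x xs. near_identity \<theta> s0 R \<Longrightarrow> distinct (x # xs) \<Longrightarrow>
      path_weight (max_entry R) (x # xs @ [x]) \<le> \<tau> ^ CARD('n)"
    using cycle_weights_small[of "\<tau> ^ CARD('n)" s0] \<tau> by (auto simp del: distinct.simps)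
  have "\<exists>v. (\<forall>i. 0 < v i) \<and>
      (\<forall>s. \<exists>w. (\<forall>j. 0 < w j) \<and> (\<chi> i. v i) = (\<Sum>j\<in>UNIV. w j *\<^sub>R R s j))"
    if R: "near_identity (min \<theta> (1/2)) s0 R" for R :: "'s \<Rightarrow> 'n \<Rightarrow> real ^ 'n"
  proof -
    have R': "near_identity \<theta> s0 R" using R by (auto simp: near_identity_def)
    have cyc: "path_weight (\<lambda>x y. max_entry R x y / \<tau>) (x # xs @ [x]) \<le> 1"
      if "distinct (x # xs)" for x xs
    proof -
      have "path_weight (max_entry R) (x # xs @ [x]) \<le> \<tau> ^ CARD('n)" by (rule \<theta>(2)[OF R' that])
      also have "\<dots> \<le> \<tau> ^ length (x # xs)"
        using \<tau> card_mono[of UNIV "set (x # xs)"] distinct_card[OF that]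
        by (intro power_decreasing) auto
      finally show ?thesis using \<tau> by (simp add: path_weight_divide)
    qed
    obtain v where v: "\<And>x. 0 < v x" "\<And>x y. v x * (max_entry R x y / \<tau>) \<le> v y"
      using potential_exists[of "\<lambda>x y. max_entry R x y / \<tau>", OF _ cyc] max_entry_nonneg \<tau>
      by (metis divide_nonneg_pos)
    have "\<exists>w. (\<forall>j. 0 < w j) \<and> (\<chi> i. v i) = (\<Sum>j\<in>UNIV. w j *\<^sub>R R s j)" for s
    proof (rule positive_combination)
      have "\<bar>det (\<chi> j. R s j) - 1\<bar> \<le> 1/2"
        using R unfolding near_identity_def by (auto dest!: spec[of _ "\<lambda>_. s"])
      then show "fdet (R s) \<noteq> 0" by (auto simp: fdet_def)
      fix i j :: 'n assume "i \<noteq> j"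
      have "v j * \<bar>R s j $ i\<bar> \<le> v j * max_entry R j i"
        using max_entry_ge[OF \<open>i \<noteq> j\<close>] v(1)[of j] by (intro mult_left_mono) (auto intro: less_imp_le)
      also have "\<dots> \<le> v i * \<tau>" using v(2)[of j i] \<tau> by (simp add: field_simps)
      finally show "v j * \<bar>R s j $ i\<bar> \<le> v i / (4 * CARD('n))" by (simp add: \<tau>_def)
    qed (use R v in \<open>auto simp: near_identity_def\<close>)
    then show ?thesis using v by blast
  qed
  then show ?thesis using \<theta>(1) by (intro exI[of _ "min \<theta> (1/2)"]) auto
qed

section \<open>From cross ratios to a common point of all layers\<close>

text \<open>The logarithm of \<open>g\<close> has mixed second differences near 0, so it is nearly a
  sum of functions of single coordinates. Coordinates are switched from \<open>s0\<close> to
  \<open>\<sigma>\<close> one by one; the contribution of a coordinate is carried past at most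
  \<open>CARD('n)\<close> others, each at the cost of a factor \<open>q\<close>.\<close>

lemma cross_ratio_factorization:
  fixes g :: "('n :: finite \<Rightarrow> 's) \<Rightarrow> real"
  assumes pos: "\<And>\<sigma>. 0 < g \<sigma>" and base: "g (\<lambda>_. s0) = 1" and q: "0 < q" "q \<le> 1"
    and cr: "\<And>\<sigma> i k s s'. i \<noteq> k \<Longrightarrow>
      q * (g (\<sigma>(i := s)) * g (\<sigma>(k := s'))) \<le> g \<sigma> * g (\<sigma>(i := s, k := s'))"
  defines "h \<equiv> \<lambda>\<sigma>. \<Prod>j\<in>UNIV. g ((\<lambda>_. s0)(j := \<sigma> j))"
  shows "q ^ (CARD('n) * CARD('n)) * h \<sigma> \<le> g \<sigma>" "q ^ (CARD('n) * CARD('n)) * g \<sigma> \<le> h \<sigma>"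
proof -
  define r where "r J = (\<lambda>j. if j \<in> J then \<sigma> j else s0)" for J
  define c where "c j = g ((\<lambda>_. s0)(j := \<sigma> j))" for j
  have r_insert: "r (insert k J) = (r J)(k := \<sigma> k)" for k J by (auto simp: r_def)
  have r_empty: "r {} = (\<lambda>_. s0)" by (auto simp: r_def)
  have r_single: "g (r {i}) = c i" for i unfolding r_insert r_empty c_def ..
  have step: "q ^ card J * (g (r J) * c i) \<le> g (r (insert i J)) \<and>
      q ^ card J * g (r (insert i J)) \<le> g (r J) * c i" if "i \<notin> J" for i J
    using finite[of J] that
  proof (induction J rule: finite_induct)
    case empty
    then show ?case using r_single by (simp add: r_empty base)
  next
    case (insert k J)
    have ik: "i \<noteq> k" "i \<notin> J" "k \<notin> J" using insert by auto
    have IH: "q ^ card J * (g (r J) * c i) \<le> g (r (insert i J))"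
      "q ^ card J * g (r (insert i J)) \<le> g (r J) * c i"
      using insert.IH ik by auto
    have 1: "q * (g (r (insert i J)) * g (r (insert k J))) \<le> g (r J) * g (r (insert i (insert k J)))"
      using cr[OF ik(1), of "r J" "\<sigma> i" "\<sigma> k"] by (simp add: r_insert fun_upd_twist[OF ik(1)])
    have undo: "(r (insert i J))(i := s0) = r J" "(r (insert i J))(i := s0, k := \<sigma> k) = r (insert k J)"
      "(r (insert i J))(k := \<sigma> k) = r (insert i (insert k J))"
      using ik by (auto simp: r_def)
    \<comment> \<open>The reverse estimate is the hypothesis read from the neighbouring corner of
      the same square, where coordinate \<open>i\<close> is switched back to
      \<open>s0\<close>.\<close>
    have 2: "q * (g (r J) * g (r (insert i (insert k J)))) \<le> g (r (insert i J)) * g (r (insert k J))"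
      using cr[OF ik(1), of "r (insert i J)" s0 "\<sigma> k"] unfolding undo unfolding r_insert[of k] .
    have card: "card (insert k J) = Suc (card J)" using insert by simp
    have "g (r J) * (q ^ Suc (card J) * (g (r (insert k J)) * c i))
      = (q ^ card J * (g (r J) * c i)) * (q * g (r (insert k J)))" by simp
    also have "\<dots> \<le> g (r (insert i J)) * (q * g (r (insert k J)))"
      using IH(1) pos q by (intro mult_right_mono) (auto intro: less_imp_le)
    also have "\<dots> \<le> g (r J) * g (r (insert i (insert k J)))"
      using 1 by (simp add: mult_ac)
    finally have a: "q ^ Suc (card J) * (g (r (insert k J)) * c i) \<le> g (r (insert i (insert k J)))"
      using pos[of "r J"] by (simp only: mult_le_cancel_left_pos)
    have "g (r J) * (q ^ Suc (card J) * g (r (insert i (insert k J))))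
      = q ^ card J * (q * (g (r J) * g (r (insert i (insert k J)))))" by simp
    also have "\<dots> \<le> q ^ card J * (g (r (insert i J)) * g (r (insert k J)))"
      using 2 q by (intro mult_left_mono) auto
    also have "\<dots> = (q ^ card J * g (r (insert i J))) * g (r (insert k J))" by simp
    also have "\<dots> \<le> (g (r J) * c i) * g (r (insert k J))"
      using IH(2) pos by (intro mult_right_mono) (auto intro: less_imp_le)
    finally have b: "q ^ Suc (card J) * g (r (insert i (insert k J))) \<le> g (r (insert k J)) * c i"
      using pos[of "r J"] by (simp add: mult_ac mult_le_cancel_left_pos)
    show ?case using a b unfolding card by blast
  qed
  have cpos: "0 < c j" for j by (simp add: c_def pos)
  have main: "q ^ (card J * CARD('n)) * prod c J \<le> g (r J) \<and>
      q ^ (card J * CARD('n)) * g (r J) \<le> prod c J" for J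
    using finite[of J]
  proof (induction J rule: finite_induct)
    case empty
    then show ?case by (simp add: r_empty base)
  next
    case (insert i J)
    let ?m = "CARD('n)"
    have card: "q ^ (card (insert i J) * ?m) = q ^ (card J * ?m) * q ^ ?m"
      using insert by (simp add: power_add)
    have qm: "q ^ ?m \<le> q ^ card J" using q by (intro power_decreasing card_mono) auto
    have "q ^ (card (insert i J) * ?m) * prod c (insert i J)
      = (q ^ (card J * ?m) * prod c J) * (q ^ ?m * c i)"
      unfolding card using insert by simp
    also have "\<dots> \<le> g (r J) * (q ^ card J * c i)"
      using insert.IH qm cpos q pos by (intro mult_mono mult_right_mono) (auto intro: less_imp_le)
    also have "\<dots> \<le> g (r (insert i J))" using step[OF insert(2)] by (simp add: mult_ac)
    finally have 1: "q ^ (card (insert i J) * ?m) * prod c (insert i J) \<le> g (r (insert i J))" .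
    have "q ^ (card (insert i J) * ?m) * g (r (insert i J))
      = q ^ (card J * ?m) * (q ^ ?m * g (r (insert i J)))" unfolding card by simp
    also have "\<dots> \<le> q ^ (card J * ?m) * (q ^ card J * g (r (insert i J)))"
      using q qm pos by (intro mult_left_mono mult_right_mono) (auto intro: less_imp_le)
    also have "\<dots> \<le> q ^ (card J * ?m) * (g (r J) * c i)"
      using step[OF insert(2)] q by (intro mult_left_mono) auto
    also have "\<dots> = (q ^ (card J * ?m) * g (r J)) * c i" by simp
    also have "\<dots> \<le> prod c J * c i"
      using insert.IH cpos by (intro mult_right_mono) (auto intro: less_imp_le)
    finally show ?case using 1 insert by (simp add: mult.commute)
  qed
  have "r UNIV = \<sigma>" by (auto simp: r_def)
  then show "q ^ (CARD('n) * CARD('n)) * h \<sigma> \<le> g \<sigma>" "q ^ (CARD('n) * CARD('n)) * g \<sigma> \<le> h \<sigma>"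
    using main[of UNIV] by (auto simp: h_def c_def)
qed

text \<open>\<open>Y j s\<close> is vertex \<open>j\<close> of layer \<open>s\<close>, and
  \<open>\<sigma>\<close> mixes the layers by choosing one for every vertex. The case
  \<open>\<sigma> = \<sigma>'\<close> of the first condition excludes the value 0. Cross ratios are
  bounded from below only; as \<open>\<sigma>\<close>, \<open>s\<close> and \<open>s'\<close> range
  freely, this bounds them from above as well.\<close>

definition consistent_layers :: "real \<Rightarrow> (('n \<Rightarrow> 'a) \<Rightarrow> real) \<Rightarrow> ('n \<Rightarrow> 's \<Rightarrow> 'a) \<Rightarrow> bool" where
  "consistent_layers \<theta> D Y \<longleftrightarrow>
     (\<forall>\<sigma> \<sigma>'. 0 < D (\<lambda>j. Y j (\<sigma> j)) * D (\<lambda>j. Y j (\<sigma>' j))) \<and>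
     (\<forall>\<sigma> i k s s'. i \<noteq> k \<longrightarrow>
       (1 - \<theta>) * (D (\<lambda>j. Y j ((\<sigma>(i := s)) j)) * D (\<lambda>j. Y j ((\<sigma>(k := s')) j)))
         \<le> D (\<lambda>j. Y j (\<sigma> j)) * D (\<lambda>j. Y j ((\<sigma>(i := s, k := s')) j)))"

lemma one_minus_power_ge:
  fixes e :: real
  assumes "0 < e"
  obtains \<theta> where "0 < \<theta>" "\<theta> < 1" "(1 - \<theta>) ^ N * (1 + e) \<ge> 1"
proof
  define \<theta> where "\<theta> = e / ((1 + e) * (real N + 1))"
  show "0 < \<theta>" using assms by (simp add: \<theta>_def)
  show "\<theta> < 1"
  proof -
    have "e * 1 < (1 + e) * (real N + 1)" using assms by (intro mult_less_le_imp_less) auto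
    then show ?thesis using assms by (simp add: \<theta>_def)
  qed
  have "real N * \<theta> \<le> e / (1 + e)"
  proof -
    have "real N * \<theta> = e / (1 + e) * (real N / (real N + 1))" by (simp add: \<theta>_def)
    also have "\<dots> \<le> e / (1 + e) * 1" using assms by (intro mult_left_mono) auto
    finally show ?thesis by simp
  qed
  then have "1 / (1 + e) \<le> 1 - real N * \<theta>" using assms by (simp add: field_simps)
  also have "\<dots> \<le> (1 - \<theta>) ^ N"
    using Bernoulli_inequality[of "- \<theta>" N] \<open>\<theta> < 1\<close> by simp
  finally show "(1 - \<theta>) ^ N * (1 + e) \<ge> 1" using assms by (simp add: field_simps)
qed

text \<open>In coordinates with respect to the layer \<open>s0\<close>, and with rows scaled to
  diagonal 1, a mixed determinant equals \<open>g \<sigma>\<close> divided by the product of the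
  values of \<open>g\<close> at single switches. This quotient measures the failure of
  \<open>g\<close> to factorise, so cross ratios near 1 bring it near 1.\<close>

theorem layers_common_point:
  "\<exists>\<theta>>0. \<forall>Y :: 'n :: finite \<Rightarrow> 's :: finite \<Rightarrow> real ^ 'n. consistent_layers \<theta> fdet Y \<longrightarrow>
    (\<exists>z. \<forall>s. \<exists>w. (\<forall>j. 0 < w j) \<and> z = (\<Sum>j\<in>UNIV. w j *\<^sub>R Y j s))"
proof -
  define s0 :: 's where "s0 = undefined"
  obtain \<theta>1 where \<theta>1: "0 < \<theta>1" "\<And>R :: 's \<Rightarrow> 'n \<Rightarrow> real ^ 'n. near_identity \<theta>1 s0 R \<Longrightarrow>
    \<exists>v. (\<forall>i. 0 < v i) \<and>
      (\<forall>s. \<exists>w. (\<forall>j. 0 < w j) \<and> (\<chi> i. v i) = (\<Sum>j\<in>UNIV. w j *\<^sub>R R s j))"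
    using near_identity_common_point[where 'n = 'n, of s0] by blast
  obtain \<theta> where \<theta>: "0 < \<theta>" "\<theta> < 1" "(1 - \<theta>) ^ (CARD('n) * CARD('n)) * (1 + \<theta>1) \<ge> 1"
    using one_minus_power_ge[OF \<theta>1(1)] by blast
  have "\<exists>z. \<forall>s. \<exists>w. (\<forall>j. 0 < w j) \<and> z = (\<Sum>j\<in>UNIV. w j *\<^sub>R Y j s)"
    if Y: "consistent_layers \<theta> fdet Y" for Y :: "'n \<Rightarrow> 's \<Rightarrow> real ^ 'n"
  proof -
    define y where "y s j = Y j s" for s j
    have sign: "0 < fdet (\<lambda>j. y (\<sigma> j) j) * fdet (y s0)" for \<sigma>
      using Y[unfolded consistent_layers_def, THEN conjunct1, rule_format, of \<sigma> "\<lambda>_. s0"]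
      by (simp add: y_def[abs_def])
    have cr: "(1 - \<theta>) * (fdet (\<lambda>j. y ((\<sigma>(i := s)) j) j) * fdet (\<lambda>j. y ((\<sigma>(k := s')) j) j))
        \<le> fdet (\<lambda>j. y (\<sigma> j) j) * fdet (\<lambda>j. y ((\<sigma>(i := s, k := s')) j) j)" if "i \<noteq> k" for \<sigma> i k s s'
      using Y that unfolding consistent_layers_def y_def by blast
    define b where "b = y s0"
    define g where "g \<sigma> = fdet (\<lambda>j. y (\<sigma> j) j) / fdet b" for \<sigma>
    have b: "fdet b \<noteq> 0" using sign[of "\<lambda>_. s0"] by (auto simp: b_def)
    have gpos: "0 < g \<sigma>" for \<sigma>
      using sign[of \<sigma>] by (auto simp: g_def b_def zero_less_divide_iff zero_less_mult_iff)
    define lam where "lam p = (\<chi> i. fdet (b(i := p)) / fdet b)" for p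
    have lam: "p = (\<Sum>i\<in>UNIV. (lam p $ i) *\<^sub>R b i)" for p
      using fdet_cramer[OF b, of p] by (simp add: lam_def)
    have g_single: "g ((\<lambda>_. s0)(j := s)) = lam (y s j) $ j" for s j
      unfolding g_def lam_def by (auto simp: b_def intro!: arg_cong[where f = fdet])
    have lpos: "0 < lam (y s j) $ j" for s j using gpos g_single by metis
    define R where "R s j = (1 / lam (y s j) $ j) *\<^sub>R lam (y s j)" for s j
    have R_det: "fdet (\<lambda>j. R (\<sigma> j) j) = g \<sigma> / (\<Prod>j\<in>UNIV. g ((\<lambda>_. s0)(j := \<sigma> j)))" for \<sigma>
    proof -
      have "fdet (\<lambda>j. y (\<sigma> j) j) = fdet (\<lambda>j. lam (y (\<sigma> j) j)) * fdet b"
        using fdet_mult[of "\<lambda>j. y (\<sigma> j) j" "\<lambda>j i. lam (y (\<sigma> j) j) $ i" b, OF lam] by simp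
      then have "g \<sigma> = fdet (\<lambda>j. lam (y (\<sigma> j) j))" using b by (simp add: g_def)
      then show ?thesis unfolding R_def g_single
        by (subst fdet_scale) (simp add: prod_dividef)
    qed
    have fact: "(1 - \<theta>) ^ (CARD('n) * CARD('n)) * (\<Prod>j\<in>UNIV. g ((\<lambda>_. s0)(j := \<sigma> j))) \<le> g \<sigma>"
      "(1 - \<theta>) ^ (CARD('n) * CARD('n)) * g \<sigma> \<le> (\<Prod>j\<in>UNIV. g ((\<lambda>_. s0)(j := \<sigma> j)))" for \<sigma>
    proof -
      have "g (\<lambda>_. s0) = 1" using b by (simp add: g_def b_def)
      moreover have "(1 - \<theta>) * (g (\<sigma>(i := s)) * g (\<sigma>(k := s'))) \<le> g \<sigma> * g (\<sigma>(i := s, k := s'))"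
        if "i \<noteq> k" for \<sigma> i k s s'
        using divide_right_mono[OF cr[OF that, of \<sigma> s s'], of "fdet b * fdet b"] by (simp add: g_def)
      ultimately show "(1 - \<theta>) ^ (CARD('n) * CARD('n)) * (\<Prod>j\<in>UNIV. g ((\<lambda>_. s0)(j := \<sigma> j))) \<le> g \<sigma>"
        "(1 - \<theta>) ^ (CARD('n) * CARD('n)) * g \<sigma> \<le> (\<Prod>j\<in>UNIV. g ((\<lambda>_. s0)(j := \<sigma> j)))"
        using cross_ratio_factorization[of g s0 "1 - \<theta>" \<sigma>] gpos \<theta> by auto
    qed
    have "near_identity \<theta>1 s0 R"
      unfolding near_identity_def
    proof (intro conjI allI)
      show "R s j $ j = 1" for s j using lpos[of s j] by (simp add: R_def)
      show "R s0 j = axis j 1" for j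
      proof -
        have "lam (y s0 j) = axis j 1"
        proof -
          have "fdet (b(i := b j)) = 0" if "i \<noteq> j" for i
            using that by (intro fdet_identical[of i j]) auto
          then show ?thesis using b by (auto simp: lam_def vec_eq_iff axis_def b_def[symmetric])
        qed
        then show ?thesis by (simp add: R_def)
      qed
      fix \<sigma>
      let ?h = "\<Prod>j\<in>UNIV. g ((\<lambda>_. s0)(j := \<sigma> j))" and ?Q = "(1 - \<theta>) ^ (CARD('n) * CARD('n))"
      have h: "0 < ?h" using gpos by (intro prod_pos) auto
      have Q: "0 < ?Q" using \<theta> by simp
      define r where "r = g \<sigma> / ?h"
      have rpos: "0 < r" using h gpos by (simp add: r_def)
      have 1: "?Q \<le> r" "?Q * r \<le> 1" using fact[of \<sigma>] h by (simp_all add: r_def field_simps)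
      have "r \<le> 1 + \<theta>1"
      proof -
        have "r * 1 \<le> r * (?Q * (1 + \<theta>1))" using \<theta>(3) rpos by (intro mult_left_mono) auto
        also have "\<dots> = (?Q * r) * (1 + \<theta>1)" by simp
        also have "\<dots> \<le> 1 * (1 + \<theta>1)" using 1 \<theta>1(1) by (intro mult_right_mono) auto
        finally show ?thesis by simp
      qed
      moreover have "1 - \<theta>1 \<le> r"
      proof -
        have "(1 - \<theta>1) * (1 + \<theta>1) \<le> 1" by (simp add: algebra_simps)
        also have "\<dots> \<le> ?Q * (1 + \<theta>1)" by (rule \<theta>(3))
        finally have "1 - \<theta>1 \<le> ?Q" using \<theta>1(1) by simp
        then show ?thesis using 1 by simp
      qed
      ultimately have "\<bar>r - 1\<bar> \<le> \<theta>1" by simp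
      then show "\<bar>det (\<chi> j. R (\<sigma> j) j) - 1\<bar> \<le> \<theta>1"
        using R_det[of \<sigma>] by (simp add: r_def fdet_def)
    qed
    from \<theta>1(2)[OF this] obtain v where v: "\<And>i. 0 < v i"
      "\<And>s. \<exists>w. (\<forall>j. 0 < w j) \<and> (\<chi> i. v i) = (\<Sum>j\<in>UNIV. w j *\<^sub>R R s j)" by blast
    have "\<exists>w'. (\<forall>j. 0 < w' j) \<and> (\<Sum>i\<in>UNIV. v i *\<^sub>R b i) = (\<Sum>j\<in>UNIV. w' j *\<^sub>R y s j)" for s
    proof -
      obtain w where w: "\<And>j. 0 < w j" "(\<chi> i. v i) = (\<Sum>j\<in>UNIV. w j *\<^sub>R R s j)" using v(2) by blast
      \<comment> \<open>Undoing the row scaling keeps the coefficients positive because the diagonal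
        coordinates are positive.\<close>
      define w' where "w' j = w j / lam (y s j) $ j" for j
      have vi: "v i = (\<Sum>j\<in>UNIV. w' j * lam (y s j) $ i)" for i
        using arg_cong[OF w(2), of "\<lambda>x. x $ i"] by (simp add: R_def w'_def)
      have "(\<Sum>i\<in>UNIV. v i *\<^sub>R b i) = (\<Sum>i\<in>UNIV. \<Sum>j\<in>UNIV. w' j *\<^sub>R (lam (y s j) $ i) *\<^sub>R b i)"
        by (simp add: vi scaleR_sum_left)
      also have "\<dots> = (\<Sum>j\<in>UNIV. w' j *\<^sub>R (\<Sum>i\<in>UNIV. (lam (y s j) $ i) *\<^sub>R b i))"
        unfolding scaleR_sum_right by (rule sum.swap)
      also have "\<dots> = (\<Sum>j\<in>UNIV. w' j *\<^sub>R y s j)" by (simp flip: lam)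
      finally have "(\<Sum>i\<in>UNIV. v i *\<^sub>R b i) = (\<Sum>j\<in>UNIV. w' j *\<^sub>R y s j)" .
      moreover have "0 < w' j" for j using w lpos by (simp add: w'_def)
      ultimately show ?thesis by blast
    qed
    then show ?thesis unfolding y_def by blast
  qed
  then show ?thesis using \<theta>(1) by blast
qed

section \<open>Orientations of simplices\<close>

lemma fdet_upd_add: "fdet (f(k := p + q)) = fdet (f(k := p)) + fdet (f(k := q))"
  unfolding fdet_upd by (rule det_row_add)

lemma fdet_swap:
  assumes "i \<noteq> k"
  shows "fdet (f(i := p, k := q)) = - fdet (f(i := q, k := p))"
proof -
  have zero: "fdet (f(i := x, k := x)) = 0" for x
    using assms by (intro fdet_identical[of i k]) auto
  have add_i: "fdet (f(i := x + y, k := z)) = fdet (f(i := x, k := z)) + fdet (f(i := y, k := z))" for x y z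
    using fdet_upd_add[of "f(k := z)" i x y] assms by (simp add: fun_upd_twist)
  show ?thesis
    using zero[of "p + q"] zero[of p] zero[of q] by (simp add: add_i fdet_upd_add)
qed

text \<open>Cramer's rule expands \<open>p\<close> in the rows of \<open>f(i := w, k := u)\<close>.
  Substituted into row \<open>i\<close> of \<open>f(i := p, k := q)\<close>, only the rows
  \<open>w\<close> and \<open>u\<close> survive, since every other row then occurs twice.\<close>

lemma fdet_pluecker:
  assumes ik: "i \<noteq> k" and nz: "fdet (f(i := w, k := u)) \<noteq> 0"
  shows "fdet (f(i := p, k := q)) * fdet (f(i := w, k := u)) =
    fdet (f(i := p, k := u)) * fdet (f(i := w, k := q)) -
    fdet (f(i := q, k := u)) * fdet (f(i := w, k := p))"
proof -
  define b where "b = f(i := w, k := u)"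
  define c where "c j = fdet (b(j := p)) / fdet b" for j
  have "p = (\<Sum>j\<in>UNIV. c j *\<^sub>R b j)"
    unfolding c_def by (rule fdet_cramer) (use nz b_def in simp)
  then have "fdet (f(i := p, k := q)) = fdet ((f(k := q))(i := \<Sum>j\<in>UNIV. c j *\<^sub>R b j))"
    using ik by (simp add: fun_upd_twist)
  also have "\<dots> = (\<Sum>j\<in>UNIV. c j * fdet ((f(k := q))(i := b j)))"
    by (simp add: fdet_upd_sum)
  also have "\<dots> = (\<Sum>j\<in>{i, k}. c j * fdet ((f(k := q))(i := b j)))"
  proof (rule sum.mono_neutral_right)
    show "\<forall>j\<in>UNIV - {i, k}. c j * fdet ((f(k := q))(i := b j)) = 0"
    proof
      fix j assume "j \<in> UNIV - {i, k}"
      then have "fdet ((f(k := q))(i := b j)) = 0"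
        by (intro fdet_identical[of i j]) (auto simp: b_def)
      then show "c j * fdet ((f(k := q))(i := b j)) = 0" by simp
    qed
  qed auto
  also have "\<dots> = c i * fdet (f(i := w, k := q)) + c k * fdet (f(i := u, k := q))"
    using ik by (simp add: b_def fun_upd_twist)
  finally have "fdet (f(i := p, k := q)) * fdet b =
      fdet (b(i := p)) * fdet (f(i := w, k := q)) + fdet (b(k := p)) * fdet (f(i := u, k := q))"
    using nz by (simp add: c_def b_def field_simps)
  moreover have "b(i := p) = f(i := p, k := u)" "b(k := p) = f(i := w, k := p)"
    using ik by (auto simp: b_def fun_upd_twist)
  ultimately show ?thesis
    using fdet_swap[OF ik, of f u q] by (simp add: b_def algebra_simps)
qed

text \<open>Homogenisation with \<open>None\<close> as the additional coordinate. Since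
  \<open>'d option\<close> indexes the vertices as well, the matrix behind \<open>orient\<close> is
  square.\<close>

definition hat :: "real ^ 'd \<Rightarrow> real ^ 'd option" where
  "hat x = (\<chi> i. case i of None \<Rightarrow> 1 | Some k \<Rightarrow> x $ k)"

lemma hat_nth [simp]: "hat x $ None = 1" "hat x $ Some k = x $ k"
  by (simp_all add: hat_def)

definition orient :: "('d :: finite option \<Rightarrow> real ^ 'd) \<Rightarrow> real" where
  "orient f = fdet (\<lambda>j. hat (f j))"

lemma orient_upd: "orient (f(j := x)) = fdet ((\<lambda>i. hat (f i))(j := hat x))"
  unfolding orient_def by (rule arg_cong[where f = fdet]) auto

lemma orient_upd2: "orient (f(i := x, k := y)) = fdet ((\<lambda>i. hat (f i))(i := hat x, k := hat y))"
  unfolding orient_def by (rule arg_cong[where f = fdet]) auto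

lemma sum_UNIV_option: "(\<Sum>i\<in>(UNIV :: 'd :: finite option set). f i) = f None + (\<Sum>k\<in>UNIV. f (Some k))"
  by (simp add: UNIV_option_conv sum.reindex)

lemma orient_affine: "\<exists>a b. \<forall>x. orient (f(j := x)) = a \<bullet> x - b"
proof -
  define h where "h = (\<lambda>i. hat (f i))"
  have "orient (f(j := x)) = fdet (h(j := \<Sum>i\<in>UNIV. (hat x $ i) *\<^sub>R axis i 1))" for x
    by (simp add: orient_upd h_def basis_expansion flip: scalar_mult_eq_scaleR)
  also have "\<dots> x = (\<Sum>i\<in>UNIV. hat x $ i * fdet (h(j := axis i 1)))" for x
    by (simp add: fdet_upd_sum)
  also have "\<dots> x = (\<chi> k. fdet (h(j := axis (Some k) 1))) \<bullet> x - (- fdet (h(j := axis None 1)))" for x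
    by (simp add: sum_UNIV_option inner_vec_def mult.commute)
  finally show ?thesis by blast
qed

lemma orient_pluecker:
  assumes "i \<noteq> k" "orient (f(i := w, k := u)) \<noteq> 0"
  shows "orient (f(i := p, k := q)) * orient (f(i := w, k := u)) =
    orient (f(i := p, k := u)) * orient (f(i := w, k := q)) -
    orient (f(i := q, k := u)) * orient (f(i := w, k := p))"
  using fdet_pluecker[of i k "\<lambda>j. hat (f j)"] assms by (simp add: orient_upd2)

lemma orient_nonzero_independent:
  assumes "orient f \<noteq> 0"
  shows "inj f" "\<not> affine_dependent (range f)"
proof -
  have lin: "c k = 0" if "(\<Sum>j\<in>UNIV. c j *\<^sub>R hat (f j)) = 0" for c k
  proof -
    let ?h = "\<lambda>j. hat (f j)"
    have "fdet (?h(k := 0)) = 0" using fdet_upd_add[of ?h k 0 0] by simp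
    then have "0 = (\<Sum>j\<in>UNIV. c j * fdet (?h(k := ?h j)))"
      using fdet_upd_sum[of UNIV ?h k c ?h] that by simp
    also have "\<dots> = (\<Sum>j\<in>{k}. c j * fdet (?h(k := ?h j)))"
    proof (rule sum.mono_neutral_right)
      show "\<forall>j\<in>UNIV - {k}. c j * fdet (?h(k := ?h j)) = 0"
      proof
        fix j assume "j \<in> UNIV - {k}"
        then have "fdet (?h(k := ?h j)) = 0" by (intro fdet_identical[of j k]) auto
        then show "c j * fdet (?h(k := ?h j)) = 0" by simp
      qed
    qed auto
    also have "\<dots> = c k * fdet (?h(k := ?h k))" by simp
    also have "?h(k := ?h k) = ?h" by auto
    finally have "0 = c k * orient f" by (simp add: orient_def)
    then show ?thesis using assms by simp
  qed
  show inj: "inj f"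
  proof (rule injI, rule ccontr)
    fix i j assume "f i = f j" "i \<noteq> j"
    then have "orient f = 0" unfolding orient_def by (intro fdet_identical[of i j]) auto
    then show False using assms by simp
  qed
  show "\<not> affine_dependent (range f)"
  proof
    assume "affine_dependent (range f)"
    then obtain U v where U: "sum U (range f) = 0" "v \<in> range f" "U v \<noteq> 0" "(\<Sum>v\<in>range f. U v *\<^sub>R v) = 0"
      using affine_dependent_explicit_finite[of "range f"] by auto
    have "(\<Sum>j\<in>UNIV. U (f j)) = 0" "(\<Sum>j\<in>UNIV. U (f j) *\<^sub>R f j) = 0"
      using U inj by (simp_all add: sum.reindex)
    then have "(\<Sum>j\<in>UNIV. U (f j) *\<^sub>R hat (f j)) $ i = 0" for i
      by (cases i) (simp_all add: vec_eq_iff)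
    then have "(\<Sum>j\<in>UNIV. U (f j) *\<^sub>R hat (f j)) = 0"
      by (simp only: vec_eq_iff zero_index) simp
    then have "U (f j) = 0" for j by (rule lin)
    then show False using U by auto
  qed
qed

text \<open>The coordinate \<open>None\<close> of \<open>z\<close> is the sum of the weights.
  Division by it gives a convex combination with positive coefficients, and for affinely independent
  vertices such points make up the relative interior.\<close>

lemma rel_interior_simplexI:
  assumes f: "orient f \<noteq> 0" and w: "\<And>j. 0 < w j" and z: "z = (\<Sum>j\<in>UNIV. w j *\<^sub>R hat (f j))"
  shows "(\<chi> k. z $ Some k / z $ None) \<in> rel_interior (convex hull (range f))"
proof -
  note ind = orient_nonzero_independent[OF f]
  define u where "u p = w (inv f p) / z $ None" for p
  have N: "z $ None = sum w UNIV" by (simp add: z)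
  have pos: "0 < z $ None" unfolding N using w by (intro sum_pos) auto
  have "(\<chi> k. z $ Some k / z $ None) = (\<Sum>j\<in>UNIV. (w j / z $ None) *\<^sub>R f j)"
    by (simp add: vec_eq_iff z sum_divide_distrib)
  then have "(\<chi> k. z $ Some k / z $ None) = (\<Sum>p\<in>range f. u p *\<^sub>R p)"
    using ind(1) by (simp add: sum.reindex u_def)
  moreover have "sum u (range f) = 1"
    using ind(1) pos by (simp add: sum.reindex u_def N flip: sum_divide_distrib)
  moreover have "\<forall>p\<in>range f. 0 < u p" using ind(1) w pos by (auto simp: u_def)
  ultimately show ?thesis
    unfolding rel_interior_convex_hull_explicit[OF ind(2)] by auto
qed

text \<open>A kernel vector of the matrix of homogenised points is the equation of a hyperplane
  through all of them. Its \<open>Some\<close> coordinates form the normal, which cannot vanish, as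
  otherwise the \<open>None\<close> coordinate would vanish too.\<close>

lemma orient_nonzero:
  fixes f :: "'d :: finite option \<Rightarrow> real ^ 'd"
  assumes gp: "general_position P" and f: "inj f" "range f \<subseteq> P"
  shows "orient f \<noteq> 0"
proof
  let ?A = "\<chi> j. hat (f j)"
  assume "orient f = 0"
  then have "det ?A = 0" by (simp add: orient_def fdet_def)
  then obtain a where a: "a \<noteq> 0" "?A *v a = 0"
    using invertible_det_nz[of ?A] invertible_left_inverse[of ?A] matrix_left_invertible_ker[of ?A]
    by auto
  define n where "n = (\<chi> k. a $ Some k)"
  have eq: "n \<bullet> f j = - a $ None" for j
  proof -
    have "(?A *v a) $ j = 0" using a by simp
    then have "a $ None + (\<Sum>k\<in>UNIV. f j $ k * a $ Some k) = 0"
      by (simp add: matrix_vector_mult_def sum_UNIV_option)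
    then show ?thesis by (simp add: n_def inner_vec_def mult.commute)
  qed
  have "n \<noteq> 0"
  proof
    assume "n = 0"
    then have "a $ Some k = 0" for k by (auto simp: n_def vec_eq_iff)
    moreover have "a $ None = 0" using eq[of None] \<open>n = 0\<close> by simp
    ultimately have "a $ i = 0" for i by (cases i) auto
    then show False using a by (simp add: vec_eq_iff)
  qed
  moreover have "range f \<in> nsets P (CARD('d) + 1)"
    using f by (auto simp: nsets_def card_image)
  moreover have "range f \<subseteq> {x. n \<bullet> x = - a $ None}" using eq by auto
  ultimately show False using gp unfolding general_position_def by blast
qed

theorem simplices_common_point:
  "\<exists>\<theta>>0. \<forall>Y :: 'd :: finite option \<Rightarrow> 's :: finite \<Rightarrow> real ^ 'd. consistent_layers \<theta> orient Y \<longrightarrow>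
    (\<exists>x. \<forall>s. x \<in> rel_interior (convex hull (range (\<lambda>j. Y j s))))"
proof -
  obtain \<theta> where \<theta>: "\<theta> > 0"
    "\<And>Y :: 'd option \<Rightarrow> 's \<Rightarrow> real ^ 'd option. consistent_layers \<theta> fdet Y \<Longrightarrow>
      \<exists>z. \<forall>s. \<exists>w. (\<forall>j. 0 < w j) \<and> z = (\<Sum>j\<in>UNIV. w j *\<^sub>R Y j s)"
    using layers_common_point[where 'n = "'d option" and 's = 's] by blast
  have "\<exists>x. \<forall>s. x \<in> rel_interior (convex hull (range (\<lambda>j. Y j s)))"
    if Y: "consistent_layers \<theta> orient Y" for Y :: "'d option \<Rightarrow> 's \<Rightarrow> real ^ 'd"
  proof -
    have "consistent_layers \<theta> fdet (\<lambda>j s. hat (Y j s))"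
      using Y unfolding consistent_layers_def orient_def .
    from \<theta>(2)[OF this] obtain z
      where z: "\<And>s. \<exists>w. (\<forall>j. 0 < w j) \<and> z = (\<Sum>j\<in>UNIV. w j *\<^sub>R hat (Y j s))" by blast
    have "(\<chi> k. z $ Some k / z $ None) \<in> rel_interior (convex hull (range (\<lambda>j. Y j s)))" for s
    proof -
      obtain w where w: "\<And>j. 0 < w j" "z = (\<Sum>j\<in>UNIV. w j *\<^sub>R hat (Y j s))" using z by blast
      have "0 < orient (\<lambda>j. Y j s) * orient (\<lambda>j. Y j s)"
        using Y[unfolded consistent_layers_def, THEN conjunct1, rule_format, of "\<lambda>_. s" "\<lambda>_. s"] .
      then have "orient (\<lambda>j. Y j s) \<noteq> 0" by auto
      then show ?thesis using rel_interior_simplexI w by blast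
    qed
    then show ?thesis by blast
  qed
  then show ?thesis using \<theta>(1) by blast
qed

section \<open>Partitions with few orientation changes\<close>

definition sign_pattern :: "('a :: real_inner \<times> real) list \<Rightarrow> 'a \<Rightarrow> real list" where
  "sign_pattern L x = map (\<lambda>(a, b). sgn (a \<bullet> x - b)) L"

lemma sgn_real_cases: "sgn (x :: real) \<in> {-1, 0, 1}"
  by (auto simp: sgn_if)

lemma finite_sign_patterns: "finite (sign_pattern L ` V)"
proof (rule finite_subset)
  show "sign_pattern L ` V \<subseteq> {xs. set xs \<subseteq> {-1, 0, 1 :: real} \<and> length xs = length L}"
    by (auto simp: sign_pattern_def sgn_if split: if_splits)
qed (rule finite_lists_length_eq, simp)

text \<open>Closes the induction in \<open>card_sign_patterns\<close>, where each further functional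
  raises \<open>N = 2 * length L + 1\<close> by 2.\<close>

lemma power_step:
  fixes N :: nat
  assumes "0 < k"
  shows "N ^ k + 2 * N ^ (k - 1) \<le> (N + 2) ^ k"
  using assms
proof (induction k rule: nat_induct_non_zero)
  case (Suc k)
  have "N ^ Suc k + 2 * N ^ (Suc k - 1) = N * (N ^ k) + 2 * N ^ k" by simp
  also have "\<dots> = (N + 2) * N ^ k" by (simp add: algebra_simps)
  also have "\<dots> \<le> (N + 2) * (N + 2) ^ k" by (intro mult_left_mono power_mono) auto
  finally show ?case by simp
qed simp

text \<open>Intermediate value argument on the segment from \<open>x\<close> to \<open>y\<close>:
  the functional vanishes somewhere on it, while functionals with equal signs at both ends keep
  their sign on the whole segment.\<close>

lemma zero_between:
  fixes V :: "'a :: real_inner set"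
  assumes V: "convex V" "x \<in> V" "y \<in> V" and L: "sign_pattern L x = sign_pattern L y"
    and neq: "sgn (a \<bullet> x - b) \<noteq> sgn (a \<bullet> y - b)"
  shows "\<exists>z\<in>V. a \<bullet> z = b \<and> sign_pattern L z = sign_pattern L x"
proof -
  define f where "f = a \<bullet> x - b"
  define g where "g = a \<bullet> y - b"
  define t where "t = f / (f - g)"
  have fg: "f \<noteq> g" "f * g \<le> 0"
    using neq unfolding f_def[symmetric] g_def[symmetric]
    by (auto simp: sgn_if mult_le_0_iff split: if_splits)
  have t: "0 \<le> t" "t \<le> 1"
    using fg by (auto simp: t_def divide_simps mult_le_0_iff split: if_splits)
  define z where "z = (1 - t) *\<^sub>R x + t *\<^sub>R y"
  have "z \<in> V" unfolding z_def using V t by (intro convexD) auto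
  have comb: "c \<bullet> z - e = (1 - t) * (c \<bullet> x - e) + t * (c \<bullet> y - e)" for c e
    by (simp add: z_def algebra_simps inner_add_right)
  have "a \<bullet> z - b = (1 - t) * f + t * g" by (simp add: comb f_def g_def)
  also have "\<dots> = f - t * (f - g)" by (simp add: algebra_simps)
  also have "\<dots> = 0" using fg by (simp add: t_def)
  finally have "a \<bullet> z = b" by simp
  have "sgn (c \<bullet> z - e) = sgn (c \<bullet> x - e)" if "(c, e) \<in> set L" for c e
  proof -
    have s: "sgn (c \<bullet> x - e) = sgn (c \<bullet> y - e)"
      using L that by (auto simp: sign_pattern_def)
    consider "c \<bullet> x - e = 0" | "0 < c \<bullet> x - e" | "c \<bullet> x - e < 0" by linarith
    then show ?thesis
    proof cases
      case 1
      then show ?thesis using s unfolding comb by (simp add: sgn_0_0)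
    next
      case 2
      then have "0 < c \<bullet> y - e" using s by (metis sgn_greater)
      then have "0 < c \<bullet> z - e" unfolding comb using 2 t
        by (cases "t = 0") (auto intro!: add_nonneg_pos)
      then show ?thesis using 2 by simp
    next
      case 3
      then have "c \<bullet> y - e < 0" using s by (metis sgn_less)
      then have "c \<bullet> z - e < 0" unfolding comb using 3 t
        by (cases "t = 0") (auto intro!: add_nonpos_neg mult_nonneg_nonpos mult_pos_neg)
      then show ?thesis using 3 by simp
    qed
  qed
  then have "sign_pattern L z = sign_pattern L x" by (auto simp: sign_pattern_def)
  then show ?thesis using \<open>z \<in> V\<close> \<open>a \<bullet> z = b\<close> by blast
qed

text \<open>Induction on the list for all affine subspaces. An old pattern \<open>p\<close> extends
  in one default way \<open>c p\<close>; if it also extends differently, some point of the new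
  hyperplane \<open>H\<close> realises \<open>p\<close>. So the additional patterns number at most
  twice those on \<open>V \<inter> H\<close>, whose dimension is smaller unless the new sign is
  constant on \<open>V\<close>.\<close>

theorem card_sign_patterns:
  fixes V :: "'a :: euclidean_space set"
  assumes "affine V" "V \<noteq> {}"
  shows "card (sign_pattern L ` V) \<le> (2 * length L + 1) ^ nat (aff_dim V)"
  using assms
proof (induction L arbitrary: V)
  case Nil
  then show ?case by (simp add: sign_pattern_def image_constant_conv)
next
  case (Cons ab L)
  obtain a b where ab: "ab = (a, b)" by (rule prod.exhaust)
  define H where "H = {x. a \<bullet> x = b}"
  define N where "N = 2 * length L + 1"
  define S where "S = sign_pattern L"
  \<comment> \<open>The new sign at an arbitrary representative of the old pattern
    \<open>p\<close>.\<close>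
  define c where "c p = sgn (a \<bullet> (SOME x. x \<in> V \<and> S x = p) - b)" for p
  have S_Cons: "sign_pattern (ab # L) x = sgn (a \<bullet> x - b) # S x" for x
    by (simp add: sign_pattern_def ab S_def)
  have conv: "convex V" using Cons.prems affine_imp_convex by blast
  let ?S = "(\<lambda>p. c p # p) ` S ` V \<union> (\<Union>p\<in>S ` (V \<inter> H). (\<lambda>s. s # p) ` ({-1, 0, 1} - {c p}))"
  have sub: "sign_pattern (ab # L) ` V \<subseteq> ?S"
  proof
    fix q assume "q \<in> sign_pattern (ab # L) ` V"
    then obtain x where x: "x \<in> V" "q = sgn (a \<bullet> x - b) # S x" using S_Cons by auto
    define y where "y = (SOME y. y \<in> V \<and> S y = S x)"
    have y: "y \<in> V \<and> S y = S x" unfolding y_def by (rule someI[of "\<lambda>y. y \<in> V \<and> S y = S x" x]) (simp add: x)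
    have cy: "c (S x) = sgn (a \<bullet> y - b)" by (simp add: c_def y_def)
    show "q \<in> ?S"
    proof (cases "sgn (a \<bullet> x - b) = c (S x)")
      case True
      then show ?thesis using x by auto
    next
      case False
      then obtain z where z: "z \<in> V" "a \<bullet> z = b" "S z = S x"
        using zero_between[OF conv x(1), of y L a b] y cy by (auto simp: S_def)
      then have "z \<in> V \<inter> H" by (simp add: H_def)
      then have "S x \<in> S ` (V \<inter> H)" using z(3) imageI by metis
      then show ?thesis using False x(2) sgn_real_cases[of "a \<bullet> x - b"] by blast
    qed
  qed
  have fin: "finite (S ` V)" "finite (S ` (V \<inter> H))" unfolding S_def by (rule finite_sign_patterns)+
  have two: "card ({-1, 0, 1 :: real} - {c p}) \<le> 2" for p
  proof -
    have "c p \<in> {-1, 0, 1}" unfolding c_def by (rule sgn_real_cases)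
    then show ?thesis by (subst card_Diff_singleton) auto
  qed
  have "card (sign_pattern (ab # L) ` V) \<le> card ?S"
    by (rule card_mono[OF _ sub]) (intro finite_UnI finite_UN_I finite_imageI fin; simp)
  also have "\<dots> \<le> card ((\<lambda>p. c p # p) ` S ` V) + card (\<Union>p\<in>S ` (V \<inter> H). (\<lambda>s. s # p) ` ({-1, 0, 1} - {c p}))"
    by (rule card_Un_le)
  also have "\<dots> \<le> card (S ` V) + (\<Sum>p\<in>S ` (V \<inter> H). 2)"
  proof (rule add_mono)
    show "card ((\<lambda>p. c p # p) ` S ` V) \<le> card (S ` V)" using fin by (intro card_image_le)
    have "card ((\<lambda>s. s # p) ` ({-1, 0, 1} - {c p})) \<le> 2" for p
      using card_image_le[of "{-1, 0, 1} - {c p}" "\<lambda>s. s # p"] two[of p] by simp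
    then show "card (\<Union>p\<in>S ` (V \<inter> H). (\<lambda>s. s # p) ` ({-1, 0, 1} - {c p})) \<le> (\<Sum>p\<in>S ` (V \<inter> H). 2)"
      by (intro order_trans[OF card_UN_le[OF fin(2)]] sum_mono)
  qed
  finally have le: "card (sign_pattern (ab # L) ` V) \<le> card (S ` V) + 2 * card (S ` (V \<inter> H))"
    by simp
  have SV: "card (S ` V) \<le> N ^ nat (aff_dim V)"
    unfolding S_def N_def by (rule Cons.IH) (use Cons.prems in auto)
  have mono: "N ^ k \<le> (N + 2) ^ k" for k by (intro power_mono) auto
  have "card (sign_pattern (ab # L) ` V) \<le> (N + 2) ^ nat (aff_dim V)"
  proof (cases "a = 0 \<or> V \<inter> H = {} \<or> V \<subseteq> H")
    case True
    then have "\<exists>s. \<forall>x\<in>V. sgn (a \<bullet> x - b) = s"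
    proof (elim disjE)
      assume "V \<inter> H = {}"
      show ?thesis
      proof (rule ccontr)
        assume "\<not> ?thesis"
        then obtain x y where "x \<in> V" "y \<in> V" "sgn (a \<bullet> x - b) \<noteq> sgn (a \<bullet> y - b)" by metis
        then obtain z where "z \<in> V" "a \<bullet> z = b"
          using zero_between[OF conv, of x y "[]" a b] by (auto simp: sign_pattern_def)
        then show False using \<open>V \<inter> H = {}\<close> by (auto simp: H_def)
      qed
    next
      assume "V \<subseteq> H"
      then have "\<forall>x\<in>V. sgn (a \<bullet> x - b) = 0" by (auto simp: H_def)
      then show ?thesis by blast
    qed auto
    then obtain s where "\<forall>x\<in>V. sgn (a \<bullet> x - b) = s" by blast
    then have "sign_pattern (ab # L) ` V = (\<lambda>p. s # p) ` S ` V" by (force simp: S_Cons)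
    then have "card (sign_pattern (ab # L) ` V) \<le> card (S ` V)"
      using fin card_image_le by metis
    then show ?thesis using SV mono[of "nat (aff_dim V)"] by linarith
  next
    case False
    then have dim: "aff_dim (V \<inter> H) = aff_dim V - 1"
      unfolding H_def using Cons.prems by (subst aff_dim_affine_Int_hyperplane) auto
    have "aff_dim (V \<inter> H) \<ge> 0" using False aff_dim_negative_iff[of "V \<inter> H"] by linarith
    then have pos: "0 < nat (aff_dim V)" "nat (aff_dim (V \<inter> H)) = nat (aff_dim V) - 1" using dim by auto
    have "card (S ` (V \<inter> H)) \<le> N ^ nat (aff_dim (V \<inter> H))"
      unfolding S_def N_def
      using False Cons.prems by (intro Cons.IH affine_Int) (auto simp: H_def affine_hyperplane)
    then have "card (sign_pattern (ab # L) ` V) \<le> N ^ nat (aff_dim V) + 2 * N ^ (nat (aff_dim V) - 1)"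
      using le SV pos by auto
    then show ?thesis using power_step[OF pos(1), of N] by linarith
  qed
  then show ?case by (simp add: N_def algebra_simps)
qed

section \<open>Entropy of partitions\<close>

definition cell :: "'a set \<Rightarrow> ('a \<Rightarrow> 'k) \<Rightarrow> 'a \<Rightarrow> 'a set" where
  "cell P \<kappa> a = {a' \<in> P. \<kappa> a' = \<kappa> a}"

text \<open>The probability that \<open>f\<close> takes different values at a uniform point of
  \<open>P\<close> and at a uniform point of the cell of that point.\<close>

definition separation :: "'a set \<Rightarrow> ('a \<Rightarrow> 'k) \<Rightarrow> ('a \<Rightarrow> 'b) \<Rightarrow> real" where
  "separation P \<kappa> f = (\<Sum>a\<in>P. card {a' \<in> cell P \<kappa> a. f a' \<noteq> f a} / card (cell P \<kappa> a)) / card P"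

text \<open>\<open>card P\<close> times the Shannon entropy of the cell of a uniform point of
  \<open>P\<close>.\<close>

definition entropy_sum :: "'a set \<Rightarrow> ('a \<Rightarrow> 'k) \<Rightarrow> real" where
  "entropy_sum P \<kappa> = (\<Sum>a\<in>P. ln (card P / card (cell P \<kappa> a)))"

lemma finite_cell: "finite P \<Longrightarrow> finite (cell P \<kappa> a)"
  by (simp add: cell_def)

lemma card_cell_pos: "finite P \<Longrightarrow> a \<in> P \<Longrightarrow> 0 < card (cell P \<kappa> a)"
  by (auto simp: cell_def card_gt_0_iff)

lemma sum_inverse_card_cell:
  assumes "finite P"
  shows "(\<Sum>a\<in>P. 1 / real (card (cell P \<kappa> a))) = card (\<kappa> ` P)"
proof -
  have "(\<Sum>a\<in>P. 1 / real (card (cell P \<kappa> a)))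
    = (\<Sum>y\<in>\<kappa> ` P. \<Sum>a\<in>{x \<in> P. \<kappa> x = y}. 1 / real (card (cell P \<kappa> a)))"
    by (rule sum.image_gen[OF assms])
  also have "\<dots> = (\<Sum>y\<in>\<kappa> ` P. 1)"
  proof (rule sum.cong)
    fix y assume "y \<in> \<kappa> ` P"
    then have "0 < card {x \<in> P. \<kappa> x = y}" using assms by (auto simp: card_gt_0_iff)
    moreover have "(\<Sum>a\<in>{x \<in> P. \<kappa> x = y}. 1 / real (card (cell P \<kappa> a)))
      = (\<Sum>a\<in>{x \<in> P. \<kappa> x = y}. 1 / real (card {x \<in> P. \<kappa> x = y}))"
      by (intro sum.cong) (auto simp: cell_def)
    ultimately show "(\<Sum>a\<in>{x \<in> P. \<kappa> x = y}. 1 / real (card (cell P \<kappa> a))) = 1" by simp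
  qed simp
  finally show ?thesis by simp
qed

text \<open>Gibbs' inequality: \<open>ln y \<le> y - 1\<close> is applied to
  \<open>card P / card (cell P \<kappa> a)\<close> divided by the number of cells. The linear terms
  add up to 0 because the reciprocal cell sizes sum to the number of cells.\<close>

lemma entropy_sum_le:
  assumes "finite P" "P \<noteq> {}"
  shows "entropy_sum P \<kappa> \<le> card P * ln (card (\<kappa> ` P))"
proof -
  define R where "R = real (card (\<kappa> ` P))"
  have R: "0 < R" using assms by (simp add: R_def card_gt_0_iff)
  have n: "0 < card P" using assms by (simp add: card_gt_0_iff)
  have "entropy_sum P \<kappa> \<le> (\<Sum>a\<in>P. ln R + (card P / R) * (1 / card (cell P \<kappa> a)) - 1)"
    unfolding entropy_sum_def
  proof (rule sum_mono)
    fix a assume "a \<in> P"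
    then have c: "0 < card (cell P \<kappa> a)" by (rule card_cell_pos[OF assms(1)])
    define x where "x = card P / card (cell P \<kappa> a)"
    have x: "0 < x" using c n by (simp add: x_def)
    have "ln x = ln R + ln (x / R)" using x R by (simp add: ln_div)
    also have "\<dots> \<le> ln R + (x / R - 1)" using x R by (intro add_left_mono ln_le_minus_one) auto
    finally show "ln (card P / card (cell P \<kappa> a)) \<le> ln R + (card P / R) * (1 / card (cell P \<kappa> a)) - 1"
      by (simp add: x_def mult.commute)
  qed
  also have "\<dots> = card P * ln R + (card P / R) * (\<Sum>a\<in>P. 1 / real (card (cell P \<kappa> a))) - card P"
    by (simp only: sum_subtractf sum.distrib sum_distrib_left[symmetric] sum_constant)
  also have "\<dots> = card P * ln R" using R by (simp add: sum_inverse_card_cell[OF assms(1)] flip: R_def)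
  finally show ?thesis by (simp add: R_def)
qed

text \<open>Pointwise: if the cell of \<open>a\<close> shrinks from \<open>c\<close> to
  \<open>c'\<close> points, the term of \<open>a\<close> grows by \<open>- ln (c' / c)\<close>,
  which is at least \<open>1 - c' / c\<close>, the proportion of the old cell separated from
  \<open>a\<close>.\<close>

lemma entropy_sum_refine:
  assumes "finite P"
  shows "entropy_sum P \<kappa> + card P * separation P \<kappa> f \<le> entropy_sum P (\<lambda>a. f a # \<kappa> a)"
proof (cases "P = {}")
  case False
  have n: "0 < card P" using assms False by (simp add: card_gt_0_iff)
  have "entropy_sum P \<kappa> + card P * separation P \<kappa> f
    = (\<Sum>a\<in>P. ln (card P / card (cell P \<kappa> a)) + card {a' \<in> cell P \<kappa> a. f a' \<noteq> f a} / card (cell P \<kappa> a))"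
    using n by (simp add: entropy_sum_def separation_def sum.distrib)
  also have "\<dots> \<le> entropy_sum P (\<lambda>a. f a # \<kappa> a)"
    unfolding entropy_sum_def
  proof (rule sum_mono)
    fix a assume a: "a \<in> P"
    define c where "c = real (card (cell P \<kappa> a))"
    define c' where "c' = real (card (cell P (\<lambda>a. f a # \<kappa> a) a))"
    have pos: "0 < c" "0 < c'" using a assms card_cell_pos by (auto simp: c_def c'_def)
    have split: "cell P \<kappa> a = cell P (\<lambda>a. f a # \<kappa> a) a \<union> {a' \<in> cell P \<kappa> a. f a' \<noteq> f a}"
      by (auto simp: cell_def)
    have "card (cell P \<kappa> a) = card (cell P (\<lambda>a. f a # \<kappa> a) a) + card {a' \<in> cell P \<kappa> a. f a' \<noteq> f a}"
      by (subst split, rule card_Un_disjoint) (use assms in \<open>auto simp: cell_def\<close>)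
    then have "card {a' \<in> cell P \<kappa> a. f a' \<noteq> f a} / c = 1 - c' / c"
      using pos by (simp add: c_def c'_def field_simps)
    also have "\<dots> \<le> - ln (c' / c)" using ln_le_minus_one[of "c' / c"] pos by simp
    finally show "ln (card P / card (cell P \<kappa> a)) + card {a' \<in> cell P \<kappa> a. f a' \<noteq> f a} / card (cell P \<kappa> a)
      \<le> ln (card P / card (cell P (\<lambda>a. f a # \<kappa> a) a))"
      using pos n by (simp add: ln_div flip: c_def c'_def)
  qed
  finally show ?thesis .
qed (simp add: entropy_sum_def separation_def)

theorem low_separation_partition:
  fixes F :: "('a \<Rightarrow> 'b) set"
  assumes P: "finite P" "P \<noteq> {}" and T: "0 < T"
    and K: "\<And>L. set L \<subseteq> F \<Longrightarrow> length L = T \<Longrightarrow> real (card ((\<lambda>a. map (\<lambda>f. f a) L) ` P)) \<le> K"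
    and \<eta>: "ln K \<le> real T * \<eta>"
  obtains L where "set L \<subseteq> F" "length L < T"
    "\<And>f. f \<in> F \<Longrightarrow> separation P (\<lambda>a. map (\<lambda>f. f a) L) f \<le> \<eta>"
proof (rule ccontr)
  let ?\<kappa> = "\<lambda>(L :: ('a \<Rightarrow> 'b) list) a. map (\<lambda>f. f a) L"
  assume neg: "\<not> thesis"
  note found = that
  have ex: "\<exists>f\<in>F. \<eta> < separation P (?\<kappa> L) f" if "set L \<subseteq> F" "length L < T" for L
    using found[of L] neg that not_less by blast
  have n: "0 < card P" using P by (simp add: card_gt_0_iff)
  \<comment> \<open>The strict inequality for positive \<open>t\<close> is what finally contradicts
    \<open>ln K \<le> T * \<eta>\<close>.\<close>
  have "\<exists>L. set L \<subseteq> F \<and> length L = t \<and> card P * (t * \<eta>) \<le> entropy_sum P (?\<kappa> L) \<and>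
      (0 < t \<longrightarrow> card P * (t * \<eta>) < entropy_sum P (?\<kappa> L))" if "t \<le> T" for t
    using that
  proof (induction t)
    case 0
    have "entropy_sum P (?\<kappa> []) = 0" using P n by (auto simp: entropy_sum_def cell_def)
    then show ?case by (intro exI[of _ "[]"]) simp
  next
    case (Suc t)
    then obtain L where L: "set L \<subseteq> F" "length L = t" "card P * (t * \<eta>) \<le> entropy_sum P (?\<kappa> L)" by auto
    obtain f where f: "f \<in> F" "\<eta> < separation P (?\<kappa> L) f" using ex[of L] L Suc.prems by auto
    have "card P * (Suc t * \<eta>) = card P * (t * \<eta>) + card P * \<eta>" by (simp add: algebra_simps)
    also have "\<dots> < entropy_sum P (?\<kappa> L) + card P * separation P (?\<kappa> L) f"
      using L(3) f(2) n by (intro add_le_less_mono) auto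
    also have "\<dots> \<le> entropy_sum P (?\<kappa> (f # L))"
      using entropy_sum_refine[OF P(1), of "?\<kappa> L" f] by simp
    finally show ?case using L f by (intro exI[of _ "f # L"]) auto
  qed
  from this[of T] T obtain L where L: "set L \<subseteq> F" "length L = T"
    "card P * (T * \<eta>) < entropy_sum P (?\<kappa> L)" by auto
  have "entropy_sum P (?\<kappa> L) \<le> card P * ln (card (?\<kappa> L ` P))" by (rule entropy_sum_le[OF P])
  also have "\<dots> \<le> card P * ln K"
    using K[OF L(1,2)] n P by (intro mult_left_mono ln_mono) (auto simp: card_gt_0_iff)
  also have "\<dots> \<le> card P * (T * \<eta>)" using \<eta> by (intro mult_left_mono) auto
  finally show False using L(3) by simp
qed

lemma card_sgn_functionals:
  fixes L :: "(real ^ 'd \<Rightarrow> real) list"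
  assumes "\<And>f. f \<in> set L \<Longrightarrow> \<exists>a b. \<forall>x. f x = sgn (a \<bullet> x - b)"
  shows "card ((\<lambda>x. map (\<lambda>f. f x) L) ` P) \<le> (2 * length L + 1) ^ CARD('d)"
proof -
  obtain A where A: "\<And>f. f \<in> set L \<Longrightarrow> f = (\<lambda>x. sgn (fst (A f) \<bullet> x - snd (A f)))"
  proof -
    have "\<exists>ab. f = (\<lambda>x. sgn (fst ab \<bullet> x - snd ab))" if f: "f \<in> set L" for f
    proof -
      obtain a b where "\<And>x. f x = sgn (a \<bullet> x - b)" using assms[OF f] by blast
      then have "f = (\<lambda>x. sgn (fst (a, b) \<bullet> x - snd (a, b)))" by auto
      then show ?thesis by blast
    qed
    then have "\<exists>A. \<forall>f\<in>set L. f = (\<lambda>x. sgn (fst (A f) \<bullet> x - snd (A f)))" by (intro bchoice) blast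
    then show ?thesis using that by blast
  qed
  have "map (\<lambda>f. f x) L = sign_pattern (map A L) x" for x
    unfolding sign_pattern_def map_map
  proof (rule map_cong[OF refl])
    fix f assume "f \<in> set L"
    from fun_cong[OF A[OF this], of x]
    show "f x = ((\<lambda>(a, b). sgn (a \<bullet> x - b)) \<circ> A) f" by (simp add: case_prod_beta)
  qed
  then have "card ((\<lambda>x. map (\<lambda>f. f x) L) ` P) = card (sign_pattern (map A L) ` P)" by simp
  also have "\<dots> \<le> card (sign_pattern (map A L) ` UNIV)"
    by (intro card_mono finite_sign_patterns) auto
  also have "\<dots> \<le> (2 * length L + 1) ^ CARD('d)"
    using card_sign_patterns[of "UNIV :: (real ^ 'd) set" "map A L"] by simp
  finally show ?thesis .
qed

theorem orientation_partition:
  fixes P :: "(real ^ 'd :: finite) set"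
  assumes P: "finite P" "P \<noteq> {}" and T: "0 < T"
    and \<eta>: "CARD('d) * ln (2 * T + 1) \<le> T * \<eta>"
  obtains \<kappa> :: "real ^ 'd \<Rightarrow> real list"
  where "card (\<kappa> ` P) \<le> (2 * T + 1) ^ CARD('d)"
    "\<And>g j. separation P \<kappa> (\<lambda>a. sgn (orient (g(j := a)))) \<le> \<eta>"
proof -
  define F where "F = {\<lambda>a. sgn (orient (g(j := a))) | (g :: 'd option \<Rightarrow> real ^ 'd) j. True}"
  have F: "\<exists>a b. \<forall>x. f x = sgn (a \<bullet> x - b)" if f: "f \<in> F" for f
  proof -
    obtain g :: "'d option \<Rightarrow> real ^ 'd" and j where "f = (\<lambda>a. sgn (orient (g(j := a))))"
      using f by (auto simp: F_def)
    then show ?thesis using orient_affine[of g j] by metis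
  qed
  have card: "card ((\<lambda>x. map (\<lambda>f. f x) L) ` P) \<le> (2 * length L + 1) ^ CARD('d)"
    if "set L \<subseteq> F" for L
    using that F by (intro card_sgn_functionals) blast
  have ln: "ln ((2 * T + 1) ^ CARD('d)) \<le> T * \<eta>" using \<eta> T by (simp add: ln_realpow add.commute)
  obtain L where L: "set L \<subseteq> F" "length L < T"
    "\<And>f. f \<in> F \<Longrightarrow> separation P (\<lambda>a. map (\<lambda>f. f a) L) f \<le> \<eta>"
  proof (rule low_separation_partition[OF P T _ ln, of F])
    show "real (card ((\<lambda>x. map (\<lambda>f. f x) L) ` P)) \<le> (2 * T + 1) ^ CARD('d)"
      if "set L \<subseteq> F" "length L = T" for L
      using card[OF that(1)] that(2) by (metis of_nat_mono of_nat_power)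
  qed blast
  show thesis
  proof
    show "card ((\<lambda>a. map (\<lambda>f. f a) L) ` P) \<le> (2 * T + 1) ^ CARD('d)"
      using L(2) by (intro order_trans[OF card[OF L(1)]] power_mono) auto
    show "separation P (\<lambda>a. map (\<lambda>f. f a) L) (\<lambda>a. sgn (orient (g(j := a)))) \<le> \<eta>" for g j
      by (rule L(3)) (auto simp: F_def)
  qed
qed

section \<open>Selecting a point common to all layers\<close>

text \<open>Let \<open>p\<close> be the point of smallest norm in the full intersection. The open
  ball of radius \<open>norm p\<close> and the sets \<open>K s\<close> have empty intersection, so
  by Helly's theorem \<open>DIM('a) + 1\<close> of these \<open>DIM('a) + 2\<close> sets already do.
  The ball is among them, since all \<open>K s\<close> contain \<open>p\<close>; so some
  \<open>K s\<close> is omitted, and dropping it does not move the nearest point.\<close>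

lemma closest_point_of_others:
  fixes K :: "'s :: finite \<Rightarrow> 'a :: euclidean_space set"
  assumes card: "CARD('s) = DIM('a) + 1"
    and K: "\<And>s. convex (K s)" "\<And>s. closed (K s)" and ne: "(\<Inter>s. K s) \<noteq> {}"
  shows "\<exists>s. closest_point (\<Inter>t\<in>UNIV - {s}. K t) 0 \<in> K s"
proof (rule ccontr)
  assume "\<not> ?thesis"
  then have neg: "closest_point (\<Inter>t\<in>UNIV - {s}. K t) 0 \<notin> K s" for s by blast
  define p where "p = closest_point (\<Inter>s. K s) 0"
  have closed: "closed (\<Inter>s. K s)" using K by (intro closed_INT) auto
  have p: "p \<in> K s" for s
    using closest_point_in_set[OF closed ne, of 0] by (auto simp: p_def)
  have p_le: "norm p \<le> norm x" if "\<And>s. x \<in> K s" for x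
    using closest_point_le[OF closed, of x 0] that by (auto simp: p_def)
  define B where "B = ball (0 :: 'a) (norm p)"
  \<comment> \<open>Helly's theorem counts sets, not indices. If two indices carried the same set,
    dropping one of them would leave the intersection unchanged.\<close>
  have inj: "inj K"
  proof (rule injI, rule ccontr)
    fix s t assume "K s = K t" "s \<noteq> t"
    then have "(\<Inter>t\<in>UNIV - {s}. K t) = (\<Inter>s. K s)" by blast
    then show False using neg[of s] p[of s] by (simp add: p_def)
  qed
  have B: "B \<notin> range K" using p by (auto simp: B_def)
  have cardF: "card (insert B (range K)) = DIM('a) + 2"
    using B inj card by (simp add: card_image)
  have "\<Inter>(insert B (range K)) = {}"
    using p_le by (fastforce simp: B_def)
  moreover have "\<forall>S\<in>insert B (range K). convex S" using K by (auto simp: B_def)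
  ultimately obtain t where t: "t \<subseteq> insert B (range K)" "card t = DIM('a) + 1" "\<Inter>t = {}"
    using Helly[of "insert B (range K)"] cardF by auto
  have "\<exists>s. K s \<notin> t"
  proof (rule ccontr)
    assume *: "\<not> ?thesis"
    show False
    proof (cases "B \<in> t")
      case True
      then have "t = insert B (range K)" using * t(1) by blast
      then show False using cardF t(2) by simp
    next
      case False
      then have "t \<subseteq> range K" using t(1) by blast
      then show False using p t(3) by blast
    qed
  qed
  then obtain s where s: "K s \<notin> t" ..
  have "norm p \<le> norm z" if "z \<in> (\<Inter>t\<in>UNIV - {s}. K t)" for z
  proof (rule ccontr)
    assume "\<not> ?thesis"
    then have "z \<in> B" by (simp add: B_def)
    then have "z \<in> \<Inter>t" using that t(1) s by blast
    then show False using t(3) by simp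
  qed
  then have "p = closest_point (\<Inter>t\<in>UNIV - {s}. K t) 0"
    using K p by (intro closest_point_unique convex_INT closed_INT) auto
  then show False using neg[of s] p[of s] by simp
qed

text \<open>The relative interiors to which this is applied need not be closed, so nearest points
  are taken in smaller sets: \<open>K f\<close> is the convex hull of one witness for each of the
  finitely many good tuples containing \<open>f\<close>. It is compact and lies in
  \<open>C f\<close>, and the witness of a good tuple stays common to its sets. That
  \<open>q s\<close> ignores entry \<open>s\<close> permits resampling this entry later.\<close>

theorem selection:
  fixes C :: "'f \<Rightarrow> 'a :: euclidean_space set"
  assumes card: "CARD('s) = DIM('a) + 1"
    and C: "finite \<E>" "\<And>f. f \<in> \<E> \<Longrightarrow> convex (C f)"
  shows "\<exists>q :: 's :: finite \<Rightarrow> ('s \<Rightarrow> 'f) \<Rightarrow> 'a. (\<forall>s y f. q s (y(s := f)) = q s y) \<and>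
    (\<forall>y. (\<forall>s. y s \<in> \<E>) \<longrightarrow> (\<Inter>s. C (y s)) \<noteq> {} \<longrightarrow> (\<exists>s. q s y \<in> C (y s)))"
proof -
  define Y where "Y = {y :: 's \<Rightarrow> 'f. (\<forall>s. y s \<in> \<E>) \<and> (\<Inter>s. C (y s)) \<noteq> {}}"
  define wit where "wit y = (SOME x. x \<in> (\<Inter>s. C (y s)))" for y :: "'s \<Rightarrow> 'f"
  define K where "K f = convex hull (wit ` {y \<in> Y. f \<in> range y})" for f
  define q where "q s y = closest_point (\<Inter>t\<in>UNIV - {s}. K (y t)) 0" for s and y :: "'s \<Rightarrow> 'f"
  have "finite (UNIV \<rightarrow>\<^sub>E \<E> :: ('s \<Rightarrow> 'f) set)" using C by (intro finite_PiE) auto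
  then have "finite Y" by (rule finite_subset[rotated]) (auto simp: Y_def PiE_def extensional_def)
  have wit: "wit y \<in> C (y s)" if "y \<in> Y" for y s
  proof -
    have "wit y \<in> (\<Inter>s. C (y s))" unfolding wit_def some_in_eq using that by (simp add: Y_def)
    then show ?thesis by blast
  qed
  have "compact (K f)" for f
    unfolding K_def using \<open>finite Y\<close> by (intro finite_imp_compact_convex_hull) auto
  then have K: "convex (K f)" "closed (K f)" for f
    by (auto simp: K_def compact_imp_closed)
  have KC: "K f \<subseteq> C f" if "f \<in> \<E>" for f
    unfolding K_def using C(2)[OF that] wit by (intro hull_minimal) auto
  show ?thesis
  proof (intro exI[of _ q] conjI allI impI)
    show "q s (y(s := f)) = q s y" for s y f
      unfolding q_def by (rule arg_cong[where f = "\<lambda>S. closest_point S 0"]) auto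
    fix y :: "'s \<Rightarrow> 'f" assume y: "\<forall>s. y s \<in> \<E>" "(\<Inter>s. C (y s)) \<noteq> {}"
    then have "y \<in> Y" by (simp add: Y_def)
    then have "wit y \<in> K (y s)" for s unfolding K_def by (intro hull_inc) auto
    then have "(\<Inter>s. K (y s)) \<noteq> {}" by blast
    from closest_point_of_others[OF card K this] show "\<exists>s. q s y \<in> C (y s)"
      unfolding q_def using KC y(1) by blast
  qed
qed

section \<open>Random intervals and cross ratios\<close>

abbreviation prob :: "'a pmf \<Rightarrow> 'a set \<Rightarrow> real" where
  "prob p \<equiv> measure_pmf.prob p"

abbreviation expectation :: "'a pmf \<Rightarrow> ('a \<Rightarrow> real) \<Rightarrow> real" where
  "expectation p \<equiv> measure_pmf.expectation p"

lemma prob_bind_pmf: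
  "prob (bind_pmf p f) X = expectation p (\<lambda>x. prob (f x) X)"
proof -
  have "ennreal (prob (bind_pmf p f) X) = (\<integral>\<^sup>+x. emeasure (f x) X \<partial>p)"
    by (simp flip: measure_pmf.emeasure_eq_measure)
  also have "\<dots> = ennreal (expectation p (\<lambda>x. prob (f x) X))"
    by (subst nn_integral_eq_integral[symmetric])
       (auto simp: measure_pmf.emeasure_eq_measure intro!: measure_pmf.integrable_const_bound[where B = 1])
  finally show ?thesis by (simp add: integral_nonneg)
qed

lemma integrable_prob_pmf: "integrable (measure_pmf p) (\<lambda>x. prob (f x) X)"
  by (rule measure_pmf.integrable_const_bound[where B = 1]) auto

lemma prob_bind_le:
  assumes "\<And>x. x \<in> set_pmf p \<Longrightarrow> prob (f x) X \<le> c"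
  shows "prob (bind_pmf p f) X \<le> c"
proof -
  have "expectation p (\<lambda>x. prob (f x) X) \<le> expectation p (\<lambda>_. c)"
    using assms by (intro integral_mono_AE integrable_prob_pmf) (auto simp: AE_measure_pmf_iff)
  then show ?thesis by (simp add: prob_bind_pmf)
qed

lemma prob_pair_pmf_Times:
  "prob (pair_pmf p q) (A \<times> B) = prob p A * prob q B"
proof -
  have "prob (pair_pmf p q) (A \<times> B)
    = expectation p (\<lambda>x. prob (map_pmf (Pair x) q) (A \<times> B))"
    unfolding pair_pmf_def by (subst prob_bind_pmf) (simp add: map_pmf_def)
  also have "\<dots> = expectation p (\<lambda>x. indicator A x * prob q B)"
  proof (rule Bochner_Integration.integral_cong)
    show "prob (map_pmf (Pair x) q) (A \<times> B) = indicator A x * prob q B" for x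
    proof (cases "x \<in> A")
      case True
      then have "Pair x -` (A \<times> B) = B" by auto
      then show ?thesis using True by simp
    next
      case False
      then have "Pair x -` (A \<times> B) = {}" by auto
      then show ?thesis using False by simp
    qed
  qed simp
  also have "\<dots> = prob p A * prob q B" by simp
  finally show ?thesis .
qed

lemma prob_pair_pmf_symmetric_le:
  assumes AB: "A \<subseteq> B \<union> {(x, y). (y, x) \<in> B}"
  shows "prob (pair_pmf p p) A \<le> 2 * prob (pair_pmf p p) B"
proof -
  have "prob (pair_pmf p p) {(x, y). (y, x) \<in> B} = prob (pair_pmf p p) B"
    by (subst pair_commute_pmf) (auto intro!: arg_cong2[where f = prob])
  moreover have "prob (pair_pmf p p) A \<le>
      prob (pair_pmf p p) B + prob (pair_pmf p p) {(x, y). (y, x) \<in> B}"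
    by (rule order_trans[OF measure_pmf.finite_measure_mono[OF AB]])
       (auto intro!: measure_Un_le)
  ultimately show ?thesis by simp
qed

lemma prob_UN_le:
  fixes c :: real
  assumes "finite J" "A \<subseteq> (\<Union>j\<in>J. B j)" "\<And>j. j \<in> J \<Longrightarrow> prob p (B j) \<le> c"
  shows "prob p A \<le> card J * c"
proof -
  have "prob p A \<le> prob p (\<Union>j\<in>J. B j)"
    using assms by (intro measure_pmf.finite_measure_mono) auto
  also have "\<dots> \<le> (\<Sum>j\<in>J. prob p (B j))"
    using assms by (intro measure_pmf.finite_measure_subadditive_finite) auto
  also have "\<dots> \<le> (\<Sum>j\<in>J. c)" using assms by (intro sum_mono) auto
  finally show ?thesis by simp
qed

text \<open>Two independent intervals through a point \<open>z\<close> meet, so a fixed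
  \<open>z\<close> is covered with probability at most the square root of the meeting probability.
  If \<open>I\<close> is the shorter interval of a near pair, the longer one contains one of
  \<open>2 * N\<close> points that continue \<open>I\<close> on both sides in steps of
  \<open>len I\<close>: the steps are too short to jump over it. Exchanging the roles gives another
  factor 2.\<close>

theorem random_interval_separation:
  fixes \<mu> :: "'i pmf" and lo hi :: "'i \<Rightarrow> real"
  assumes lohi: "\<And>I. lo I \<le> hi I" and \<theta>: "0 < \<theta>" and N: "1 / \<theta> \<le> real N"
  defines "len \<equiv> \<lambda>I. hi I - lo I"
  defines "near \<equiv> \<lambda>I K. hi I < lo K \<and> \<theta> * (lo K - hi I) < min (len I) (len K)"
  shows "prob (pair_pmf \<mu> \<mu>) {(I, K). I \<in> A \<and> K \<in> A \<and> (near I K \<or> near K I)}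
    \<le> 4 * N * sqrt (prob (pair_pmf \<mu> \<mu>)
        {(I, K). I \<in> A \<and> K \<in> A \<and> lo I \<le> hi K \<and> lo K \<le> hi I})"
    (is "_ \<le> _ * sqrt ?q")
proof -
  define B where "B = {(I, K). I \<in> A \<and> K \<in> A \<and> (near I K \<or> near K I) \<and> len I \<le> len K}"
  define S where "S z = {K \<in> A. lo K \<le> z \<and> z \<le> hi K}" for z
  have S: "prob \<mu> (S z) \<le> sqrt ?q" for z
  proof (rule real_le_rsqrt)
    have "(prob \<mu> (S z))\<^sup>2 = prob (pair_pmf \<mu> \<mu>) (S z \<times> S z)"
      by (simp add: prob_pair_pmf_Times power2_eq_square)
    also have "\<dots> \<le> ?q"
      by (intro measure_pmf.finite_measure_mono) (auto simp: S_def)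
    finally show "(prob \<mu> (S z))\<^sup>2 \<le> ?q" .
  qed
  \<comment> \<open>The first multiple of \<open>l\<close> that reaches the gap \<open>g\<close>;
    \<open>N\<close> multiples suffice because \<open>g / l\<close> is at most
    \<open>1 / \<theta>\<close>.\<close>
  have cover: "\<exists>t\<in>{1..N}. g \<le> t * l \<and> t * l \<le> g + l" if "0 < g" "\<theta> * g < l" for g l :: real
  proof -
    have l: "0 < l" using that \<theta> by (smt (verit) mult_pos_pos)
    define t where "t = nat \<lceil>g / l\<rceil>"
    have gl: "0 < g / l" using that l by simp
    have "g / l \<le> 1 / \<theta>" using that l \<theta> by (simp add: field_simps)
    then have "g / l \<le> N" using N by linarith
    then have t: "1 \<le> t" "t \<le> N" using gl by (auto simp: t_def ceiling_le_iff nat_le_iff le_nat_iff)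
    have "real t = of_int \<lceil>g / l\<rceil>" using gl by (simp add: t_def)
    then have "g / l \<le> t" "t \<le> g / l + 1" using of_int_ceiling_le_add_one[of "g / l"] by auto
    then have "g \<le> t * l" "t * l \<le> g + l" using l by (auto simp: field_simps)
    then show ?thesis using t by auto
  qed
  have fixed_I: "prob \<mu> {K. (I, K) \<in> B} \<le> 2 * N * sqrt ?q" for I
  proof -
    define Z where "Z = (\<lambda>t. hi I + real t * len I) ` {1..N} \<union> (\<lambda>t. lo I - real t * len I) ` {1..N}"
    have "{K. (I, K) \<in> B} \<subseteq> (\<Union>z\<in>Z. S z)"
    proof
      fix K assume "K \<in> {K. (I, K) \<in> B}"
      then have K: "K \<in> A" "near I K \<or> near K I" "len I \<le> len K" by (auto simp: B_def)
      from K(2) show "K \<in> (\<Union>z\<in>Z. S z)"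
      proof
        assume "near I K"
        then obtain t where t: "t \<in> {1..N}" "lo K - hi I \<le> t * len I" "t * len I \<le> lo K - hi I + len I"
          using cover[of "lo K - hi I" "len I"] by (auto simp: near_def)
        then have "K \<in> S (hi I + t * len I)" using K by (auto simp: S_def len_def)
        then show ?thesis using t(1) by (auto simp: Z_def)
      next
        assume "near K I"
        then obtain t where t: "t \<in> {1..N}" "lo I - hi K \<le> t * len I" "t * len I \<le> lo I - hi K + len I"
          using cover[of "lo I - hi K" "len I"] by (auto simp: near_def)
        then have "K \<in> S (lo I - t * len I)" using K by (auto simp: S_def len_def)
        then show ?thesis using t(1) by (auto simp: Z_def)
      qed
    qed
    moreover have "finite Z" by (simp add: Z_def)
    ultimately have "prob \<mu> {K. (I, K) \<in> B} \<le> card Z * sqrt ?q"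
      using S by (intro prob_UN_le) auto
    also have "card Z \<le> card {1..N} + card {1..N}"
      unfolding Z_def by (intro order_trans[OF card_Un_le] add_mono card_image_le) auto
    then have "real (card Z) * sqrt ?q \<le> real (2 * N) * sqrt ?q"
      by (intro mult_right_mono) auto
    finally show ?thesis by simp
  qed
  have "prob (pair_pmf \<mu> \<mu>) B \<le> 2 * N * sqrt ?q"
    unfolding pair_pmf_def
  proof (rule prob_bind_le)
    fix I
    have "prob (bind_pmf \<mu> (\<lambda>K. return_pmf (I, K))) B = prob \<mu> {K. (I, K) \<in> B}"
      by (simp add: vimage_def flip: map_pmf_def)
    then show "prob (bind_pmf \<mu> (\<lambda>K. return_pmf (I, K))) B \<le> 2 * N * sqrt (prob
        (bind_pmf \<mu> (\<lambda>x. bind_pmf \<mu> (\<lambda>y. return_pmf (x, y))))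
        {(I, K). I \<in> A \<and> K \<in> A \<and> lo I \<le> hi K \<and> lo K \<le> hi I})"
      using fixed_I[of I] by (simp add: pair_pmf_def)
  qed
  moreover have "prob (pair_pmf \<mu> \<mu>) {(I, K). I \<in> A \<and> K \<in> A \<and> (near I K \<or> near K I)}
      \<le> 2 * prob (pair_pmf \<mu> \<mu>) B"
    by (rule prob_pair_pmf_symmetric_le) (auto simp: B_def)
  ultimately show ?thesis by linarith
qed

section \<open>Cross ratios as positions of intervals\<close>

text \<open>\<open>\<beta> p q\<close> will be the orientation with two vertices replaced by
  \<open>p\<close> and \<open>q\<close>. The four values have the same sign and their cross ratio
  lies below \<open>1 - \<theta>\<close>; recording drops alone fits the one-sided bound in
  \<open>consistent_layers\<close>.\<close>

definition cross_ratio_drop :: "real \<Rightarrow> ('a \<Rightarrow> 'a \<Rightarrow> real) \<Rightarrow> 'a \<times> 'a \<Rightarrow> 'a \<times> 'a \<Rightarrow> bool" where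
  "cross_ratio_drop \<theta> \<beta> = (\<lambda>(a, a') (b, b').
     0 < \<beta> a b * \<beta> a b' \<and> 0 < \<beta> a b * \<beta> a' b \<and> 0 < \<beta> a b * \<beta> a' b' \<and>
     \<beta> a b * \<beta> a' b' < (1 - \<theta>) * (\<beta> a b' * \<beta> a' b))"

text \<open>Zeros count as flips, so the absence of flips also guarantees nonzero values.\<close>

definition sign_flip :: "('a \<Rightarrow> real) \<Rightarrow> 'a \<times> 'a \<Rightarrow> bool" where
  "sign_flip f I \<longleftrightarrow> f (fst I) * f (snd I) \<le> 0"

text \<open>The two products differ by \<open>(xa - xa') * (xb' - xb)\<close>. With gap
  \<open>g\<close> and lengths \<open>l\<close>, \<open>r\<close> the hypothesis becomes
  \<open>\<theta> * ((g + l) * (g + r)) < l * r\<close>, and keeping only \<open>g * l\<close> or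
  only \<open>g * r\<close> of the expanded product gives the two bounds.\<close>

lemma interval_gap_aux:
  fixes xa xa' xb xb' \<theta> :: real
  assumes \<theta>: "0 < \<theta>" and sep: "max xa xa' < min xb xb'"
    and cr: "(xa - xb) * (xa' - xb') < (1 - \<theta>) * ((xa - xb') * (xa' - xb))"
  shows "\<theta> * (min xb xb' - max xa xa') < min \<bar>xa - xa'\<bar> \<bar>xb - xb'\<bar>"
proof -
  define g where "g = min xb xb' - max xa xa'"
  define l where "l = \<bar>xa - xa'\<bar>"
  define r where "r = \<bar>xb - xb'\<bar>"
  have g: "0 < g" using sep by (simp add: g_def)
  have "\<theta> * ((xa - xb') * (xa' - xb)) < (xa - xa') * (xb' - xb)"
    using cr by (simp add: algebra_simps)
  moreover have pos: "0 < (xa - xb') * (xa' - xb)" using sep by (intro mult_neg_neg) auto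
  ultimately have "0 < (xa - xa') * (xb' - xb)" using \<theta> by (smt (verit) mult_pos_pos)
  then have cases: "xa > xa' \<and> xb' > xb \<or> xa < xa' \<and> xb' < xb"
    unfolding zero_less_mult_iff by auto
  then have lr: "0 < l" "0 < r" "(xa - xa') * (xb' - xb) = l * r"
    by (auto simp: l_def r_def abs_if algebra_simps)
  have "(xa - xb') * (xa' - xb) = (g + l) * (g + r)"
    using cases by (auto simp: g_def l_def r_def min_def max_def abs_if algebra_simps)
  then have key: "\<theta> * ((g + l) * (g + r)) < l * r"
    using \<open>\<theta> * _ < _\<close> lr(3) by simp
  have "\<theta> * g * l < r * l"
  proof -
    have "\<theta> * (g * l) \<le> \<theta> * ((g + l) * (g + r))"
      using \<theta> g lr by (intro mult_left_mono) (auto simp: algebra_simps)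
    then show ?thesis using key by (simp add: mult_ac)
  qed
  moreover have "\<theta> * g * r < l * r"
  proof -
    have "\<theta> * (g * r) \<le> \<theta> * ((g + l) * (g + r))"
      using \<theta> g lr by (intro mult_left_mono) (auto simp: algebra_simps)
    then show ?thesis using key by (simp add: mult_ac)
  qed
  ultimately have "\<theta> * g < r" "\<theta> * g < l" using lr by auto
  then show ?thesis by (simp add: g_def l_def r_def)
qed

lemma interval_gap:
  fixes xa xa' xb xb' \<theta> :: real
  assumes \<theta>: "0 < \<theta>"
    and pos: "0 < (xa - xb) * (xa - xb')" "0 < (xa - xb) * (xa' - xb)" "0 < (xa - xb) * (xa' - xb')"
    and cr: "(xa - xb) * (xa' - xb') < (1 - \<theta>) * ((xa - xb') * (xa' - xb))"
  shows "(max xa xa' < min xb xb' \<and>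
      \<theta> * (min xb xb' - max xa xa') < min \<bar>xa - xa'\<bar> \<bar>xb - xb'\<bar>) \<or>
    (max xb xb' < min xa xa' \<and>
      \<theta> * (min xa xa' - max xb xb') < min \<bar>xa - xa'\<bar> \<bar>xb - xb'\<bar>)"
proof (cases "xa < xb")
  case True
  then have "max xa xa' < min xb xb'" using pos by (auto simp: zero_less_mult_iff)
  then show ?thesis using interval_gap_aux[OF \<theta> _ cr] by blast
next
  case False
  then have sep: "max xb xb' < min xa xa'" using pos by (auto simp: zero_less_mult_iff)
  have "\<theta> * (min xa xa' - max xb xb') < min \<bar>xb - xb'\<bar> \<bar>xa - xa'\<bar>"
    by (rule interval_gap_aux[OF \<theta> sep]) (use cr in \<open>simp add: algebra_simps\<close>)
  then show ?thesis using sep by (simp add: min.commute)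
qed

text \<open>A pair on which \<open>s\<close> does not flip is an interval in the coordinate
  \<open>x\<close>, and \<open>\<beta> p\<close> flips on it if \<open>x p\<close> lies inside. The
  parameter \<open>t\<close> linearises the square root of the meeting probability by the inequality
  of the means, so that the bound can be averaged over the remaining vertices afterwards.\<close>

theorem prob_cross_ratio_drop:
  fixes \<mu> :: "('a \<times> 'a) pmf" and \<beta> :: "'a \<Rightarrow> 'a \<Rightarrow> real" and s :: "'a \<Rightarrow> real"
  assumes \<theta>: "0 < \<theta>" and N: "1 / \<theta> \<le> real N" and t: "0 < t"
    and pluecker: "\<And>u p q. s u \<noteq> 0 \<Longrightarrow> \<beta> p q * s u = \<beta> p u * s q - \<beta> q u * s p"
  defines "M \<equiv> pair_pmf \<mu> \<mu>"
  shows "prob M {(I, K). cross_ratio_drop \<theta> \<beta> I K} \<le>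
    2 * prob \<mu> {I. sign_flip s I} +
    2 * N * (2 * (prob M {(I, K). sign_flip (\<beta> (fst I)) K} +
                  prob M {(I, K). sign_flip (\<beta> (snd I)) K}) / t + t)"
proof (cases "\<exists>u. s u \<noteq> 0")
  case False
  then have "prob \<mu> {I. sign_flip s I} = 1" by (simp add: sign_flip_def)
  moreover have "prob M {(I, K). cross_ratio_drop \<theta> \<beta> I K} \<le> 1" by simp
  moreover have "0 \<le> 2 * N * (2 * (prob M {(I, K). sign_flip (\<beta> (fst I)) K} +
                  prob M {(I, K). sign_flip (\<beta> (snd I)) K}) / t + t)"
    using t by simp
  ultimately show ?thesis by linarith
next
  case True
  then obtain u where u: "s u \<noteq> 0" by blast
  define x where "x p = \<beta> p u / (s u * s p)" for p
  have \<beta>: "\<beta> p q = s p * s q * (x p - x q)" if "s p \<noteq> 0" "s q \<noteq> 0" for p q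
  proof -
    have "s p * s q * (x p - x q) = (\<beta> p u * s q - \<beta> q u * s p) / s u"
      using that u by (simp add: x_def field_simps)
    also have "\<dots> = \<beta> p q" unfolding pluecker[OF u, of p q, symmetric] using u by simp
    finally show ?thesis ..
  qed
  define A where "A = {I. \<not> sign_flip s I}"
  have A: "s (fst I) \<noteq> 0" "s (snd I) \<noteq> 0" "0 < s (fst I) * s (snd I)" if "I \<in> A" for I
    using that by (auto simp: A_def sign_flip_def not_le)
  define lo where "lo I = min (x (fst I)) (x (snd I))" for I
  define hi where "hi I = max (x (fst I)) (x (snd I))" for I
  have len: "hi I - lo I = \<bar>x (fst I) - x (snd I)\<bar>" for I by (auto simp: lo_def hi_def)
  define near where "near I K \<longleftrightarrow> hi I < lo K \<and> \<theta> * (lo K - hi I) < min (hi I - lo I) (hi K - lo K)" for I K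
  define meet where "meet = {(I, K). I \<in> A \<and> K \<in> A \<and> lo I \<le> hi K \<and> lo K \<le> hi I}"
  define F where "F = {(I, K). sign_flip (\<beta> (fst I)) K \<or> sign_flip (\<beta> (snd I)) K}"
  have drop: "near I K \<or> near K I" if IK: "I \<in> A" "K \<in> A" "cross_ratio_drop \<theta> \<beta> I K" for I K
  proof -
    obtain a a' b b' where ab: "I = (a, a')" "K = (b, b')" by (metis prod.exhaust)
    have nz: "s a \<noteq> 0" "s a' \<noteq> 0" "s b \<noteq> 0" "s b' \<noteq> 0" and saa: "0 < s a * s a'" and sbb: "0 < s b * s b'"
      using A[OF IK(1)] A[OF IK(2)] ab by auto
    have d: "0 < \<beta> a b * \<beta> a b'" "0 < \<beta> a b * \<beta> a' b" "0 < \<beta> a b * \<beta> a' b'"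
      "\<beta> a b * \<beta> a' b' < (1 - \<theta>) * (\<beta> a b' * \<beta> a' b)"
      using IK(3) by (auto simp: ab cross_ratio_drop_def)
    have sq: "0 < s a * s a" "0 < s b * s b" using nz by (auto simp: zero_less_mult_iff)
    define c where "c = (s a * s a') * (s b * s b')"
    have c: "0 < c" using saa sbb by (simp add: c_def)
    have "\<beta> a b * \<beta> a b' = (s a * s a) * (s b * s b') * ((x a - x b) * (x a - x b'))"
      using nz by (simp add: \<beta>)
    moreover have "0 < (s a * s a) * (s b * s b')" using sq sbb by simp
    ultimately have p1: "0 < (x a - x b) * (x a - x b')" using d(1) zero_less_mult_pos by metis
    have "\<beta> a b * \<beta> a' b = (s a * s a') * (s b * s b) * ((x a - x b) * (x a' - x b))"
      using nz by (simp add: \<beta>)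
    moreover have "0 < (s a * s a') * (s b * s b)" using sq saa by simp
    ultimately have p2: "0 < (x a - x b) * (x a' - x b)" using d(2) zero_less_mult_pos by metis
    have e3: "\<beta> a b * \<beta> a' b' = c * ((x a - x b) * (x a' - x b'))"
      and e4: "\<beta> a b' * \<beta> a' b = c * ((x a - x b') * (x a' - x b))"
      using nz by (simp_all add: \<beta> c_def)
    have p3: "0 < (x a - x b) * (x a' - x b')" using d(3) c unfolding e3 by (metis zero_less_mult_pos)
    have "c * ((x a - x b) * (x a' - x b')) < c * ((1 - \<theta>) * ((x a - x b') * (x a' - x b)))"
      using d(4) unfolding e3 e4 by (simp add: mult_ac)
    then have p4: "(x a - x b) * (x a' - x b') < (1 - \<theta>) * ((x a - x b') * (x a' - x b))"
      using c by simp
    show ?thesis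
      using interval_gap[OF \<theta> p1 p2 p3 p4] unfolding near_def len
      by (auto simp: lo_def hi_def ab)
  qed
  have flip: "I \<in> A \<Longrightarrow> K \<in> A \<Longrightarrow> p \<in> {fst I, snd I} \<Longrightarrow> lo K \<le> x p \<Longrightarrow> x p \<le> hi K \<Longrightarrow> (I, K) \<in> F" for I K p
  proof -
    assume IK: "I \<in> A" "K \<in> A" "p \<in> {fst I, snd I}" "lo K \<le> x p" "x p \<le> hi K"
    have sp: "s p \<noteq> 0" using A[OF IK(1)] IK(3) by auto
    have "(x p - x (fst K)) * (x p - x (snd K)) \<le> 0"
      using IK(4,5) by (auto simp: lo_def hi_def mult_le_0_iff min_def max_def split: if_splits)
    moreover have "0 \<le> (s p * s p) * (s (fst K) * s (snd K))"
      using A(3)[OF IK(2)] by simp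
    ultimately have "(s p * s p) * (s (fst K) * s (snd K)) * ((x p - x (fst K)) * (x p - x (snd K))) \<le> 0"
      by (simp add: mult_nonneg_nonpos)
    then have "sign_flip (\<beta> p) K"
      using A[OF IK(2)] sp by (simp add: sign_flip_def \<beta> mult_ac)
    then show "(I, K) \<in> F" using IK(3) by (auto simp: F_def)
  qed
  have lo_attained: "\<exists>p\<in>{fst I, snd I}. x p = lo I" for I by (auto simp: lo_def min_def)
  \<comment> \<open>If two intervals meet, the left end of one of them lies in the other.\<close>
  have "meet \<subseteq> F \<union> {(I, K). (K, I) \<in> F}"
  proof
    fix w assume w: "w \<in> meet"
    obtain I K where IK: "w = (I, K)" by (cases w)
    have m: "I \<in> A" "K \<in> A" "lo I \<le> hi K" "lo K \<le> hi I" using w by (auto simp: IK meet_def)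
    obtain p where p: "p \<in> {fst I, snd I}" "x p = lo I" using lo_attained by blast
    obtain q where q: "q \<in> {fst K, snd K}" "x q = lo K" using lo_attained by blast
    show "w \<in> F \<union> {(I, K). (K, I) \<in> F}"
    proof (cases "lo K \<le> lo I")
      case True
      then show ?thesis using flip[OF m(1,2) p(1)] p(2) m(3) by (simp add: IK)
    next
      case False
      then have "(K, I) \<in> F" using flip[OF m(2,1) q(1)] q(2) m(4) by simp
      then show ?thesis by (simp add: IK)
    qed
  qed
  then have "prob M meet \<le> 2 * prob M F"
    unfolding M_def by (rule prob_pair_pmf_symmetric_le)
  also have "prob M F \<le> prob M {(I, K). sign_flip (\<beta> (fst I)) K} +
      prob M {(I, K). sign_flip (\<beta> (snd I)) K}" (is "_ \<le> ?Q")
  proof -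
    have "F = {(I, K). sign_flip (\<beta> (fst I)) K} \<union> {(I, K). sign_flip (\<beta> (snd I)) K}"
      by (auto simp: F_def)
    then show ?thesis by (simp add: measure_Un_le)
  qed
  finally have meet: "prob M meet \<le> 2 * ?Q" by simp
  have near: "prob M {(I, K). I \<in> A \<and> K \<in> A \<and> (near I K \<or> near K I)}
      \<le> 4 * N * sqrt (prob M meet)"
    unfolding M_def meet_def near_def
    using random_interval_separation[of lo hi \<theta> N \<mu> A, OF _ \<theta> N]
    by (simp add: lo_def hi_def)
  have sqrt_le: "sqrt q \<le> (q / t + t) / 2" if "0 \<le> q" for q
  proof -
    have "0 \<le> (sqrt q - t)\<^sup>2" by simp
    then have "2 * sqrt q * t \<le> q + t\<^sup>2" using that by (simp add: power2_diff)
    then show ?thesis using t by (simp add: field_simps power2_eq_square)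
  qed
  have "4 * N * sqrt (prob M meet) \<le> 4 * N * ((2 * ?Q / t + t) / 2)"
  proof (rule mult_left_mono)
    have "sqrt (prob M meet) \<le> (prob M meet / t + t) / 2"
      by (rule sqrt_le) simp
    also have "\<dots> \<le> (2 * ?Q / t + t) / 2" using meet t by (simp add: divide_right_mono)
    finally show "sqrt (prob M meet) \<le> (2 * ?Q / t + t) / 2" .
  qed simp
  also have "\<dots> = 2 * N * (2 * ?Q / t + t)" by simp
  finally have near': "prob M {(I, K). I \<in> A \<and> K \<in> A \<and> (near I K \<or> near K I)}
      \<le> 2 * N * (2 * ?Q / t + t)" using near by linarith
  have "{(I, K). cross_ratio_drop \<theta> \<beta> I K} \<subseteq>
      ({I. sign_flip s I} \<times> UNIV) \<union> (UNIV \<times> {K. sign_flip s K}) \<union>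
      {(I, K). I \<in> A \<and> K \<in> A \<and> (near I K \<or> near K I)}"
    using drop by (auto simp: A_def)
  then have "prob M {(I, K). cross_ratio_drop \<theta> \<beta> I K} \<le>
      prob M (({I. sign_flip s I} \<times> UNIV) \<union> (UNIV \<times> {K. sign_flip s K}) \<union>
      {(I, K). I \<in> A \<and> K \<in> A \<and> (near I K \<or> near K I)})"
    by (intro measure_pmf.finite_measure_mono) auto
  also have "\<dots> \<le> prob M ({I. sign_flip s I} \<times> UNIV) +
      prob M (UNIV \<times> {K. sign_flip s K}) +
      prob M {(I, K). I \<in> A \<and> K \<in> A \<and> (near I K \<or> near K I)}"
    by (intro order_trans[OF measure_Un_le] add_mono measure_Un_le) auto
  also have "prob M ({I. sign_flip s I} \<times> UNIV) = prob \<mu> {I. sign_flip s I}"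
    unfolding M_def by (simp add: prob_pair_pmf_Times)
  also have "prob M (UNIV \<times> {I. sign_flip s I}) = prob \<mu> {I. sign_flip s I}"
    unfolding M_def by (simp add: prob_pair_pmf_Times)
  finally show ?thesis using near' by linarith
qed

section \<open>Resampling in product distributions\<close>

lemma Pi_pmf_UNIV_insert:
  fixes p :: "'n :: finite \<Rightarrow> 'b pmf"
  shows "Pi_pmf UNIV d p =
    bind_pmf (p i) (\<lambda>y. bind_pmf (Pi_pmf (UNIV - {i}) d p) (\<lambda>f. return_pmf (f(i := y))))"
  using Pi_pmf_insert'[of "UNIV - {i}" i d p] by (simp add: insert_absorb)

text \<open>Lets an event be estimated by fixing all coordinates and redrawing coordinate
  \<open>i\<close> alone.\<close>

lemma Pi_pmf_resample:
  fixes p :: "'n :: finite \<Rightarrow> 'b pmf"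
  shows "Pi_pmf UNIV d p = bind_pmf (Pi_pmf UNIV d p) (\<lambda>Z. map_pmf (\<lambda>I. Z(i := I)) (p i))"
proof -
  have "bind_pmf (Pi_pmf UNIV d p) (\<lambda>Z. map_pmf (\<lambda>I. Z(i := I)) (p i))
    = bind_pmf (Pi_pmf (UNIV - {i}) d p) (\<lambda>f. bind_pmf (p i) (\<lambda>I. return_pmf (f(i := I))))"
    unfolding Pi_pmf_UNIV_insert[of d p i] map_pmf_def
    by (simp add: bind_assoc_pmf bind_return_pmf bind_pmf_const)
  also have "\<dots> = Pi_pmf UNIV d p"
    unfolding Pi_pmf_UNIV_insert[of d p i] by (rule bind_commute_pmf)
  finally show ?thesis ..
qed

lemma Pi_pmf_resample2:
  fixes p :: "'n :: finite \<Rightarrow> 'b pmf"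
  assumes "i \<noteq> k"
  shows "Pi_pmf UNIV d p =
    bind_pmf (Pi_pmf UNIV d p) (\<lambda>Z. map_pmf (\<lambda>(I, K). Z(i := I, k := K)) (pair_pmf (p i) (p k)))"
proof -
  have "Pi_pmf UNIV d p = bind_pmf (Pi_pmf UNIV d p) (\<lambda>Z. map_pmf (\<lambda>K. Z(k := K)) (p k))"
    by (rule Pi_pmf_resample)
  also have "\<dots> = bind_pmf (bind_pmf (Pi_pmf UNIV d p) (\<lambda>Z. map_pmf (\<lambda>I. Z(i := I)) (p i)))
      (\<lambda>Z. map_pmf (\<lambda>K. Z(k := K)) (p k))"
    by (subst Pi_pmf_resample[of d p i]) simp
  finally show ?thesis
    by (simp add: bind_assoc_pmf map_pmf_def bind_return_pmf pair_pmf_def)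
qed

lemma Pi_pmf_map_dep:
  fixes p :: "'n :: finite \<Rightarrow> 'b pmf"
  shows "Pi_pmf UNIV d' (\<lambda>j. map_pmf (f j) (p j)) = map_pmf (\<lambda>h j. f j (h j)) (Pi_pmf UNIV d p)"
  unfolding map_pmf_def by (subst Pi_pmf_bind[where d' = d]) auto

text \<open>The reference vertex behind \<open>s\<close> is itself drawn from \<open>\<mu>\<close>:
  with \<open>s = \<beta> Z (fst W)\<close> for a random pair \<open>W\<close>, the flip probability
  of \<open>s\<close> averages to \<open>Q Z\<close>, the quantity that governs the other terms. The
  mean of \<open>Q\<close> over \<open>Z\<close> is at most \<open>\<kappa>\<close>, and
  \<open>t = sqrt \<kappa>\<close> balances \<open>\<kappa> / t\<close> against
  \<open>t\<close>.\<close>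

theorem prob_cross_ratio_drop_random:
  fixes D :: "('n :: finite \<Rightarrow> 'a) \<Rightarrow> real" and \<mu> :: "('a \<times> 'a) pmf"
  assumes pluecker: "\<And>f i k p q w u. i \<noteq> k \<Longrightarrow> D (f(i := w, k := u)) \<noteq> 0 \<Longrightarrow>
      D (f(i := p, k := q)) * D (f(i := w, k := u)) =
      D (f(i := p, k := u)) * D (f(i := w, k := q)) - D (f(i := q, k := u)) * D (f(i := w, k := p))"
    and swap: "map_pmf prod.swap \<mu> = \<mu>"
    and flip: "prob (Pi_pmf UNIV d (\<lambda>_. \<mu>))
      {Z. sign_flip (\<lambda>x. D ((fst \<circ> Z)(k := x))) (Z k)} \<le> \<kappa>"
    and \<kappa>: "0 < \<kappa>" "\<kappa> \<le> 1" and \<theta>: "0 < \<theta>" and N: "1 / \<theta> \<le> real N" and ik: "i \<noteq> k"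
  shows "prob (Pi_pmf UNIV d (\<lambda>_. \<mu>))
      {Z. cross_ratio_drop \<theta> (\<lambda>p q. D ((fst \<circ> Z)(i := p, k := q))) (Z i) (Z k)} \<le> (2 + 10 * real N) * sqrt \<kappa>"
proof -
  define Pi where "Pi = Pi_pmf UNIV d (\<lambda>_ :: 'n. \<mu>)"
  define M where "M = pair_pmf \<mu> \<mu>"
  define \<beta> where "\<beta> Z p q = D ((fst \<circ> Z)(i := p, k := q))" for Z :: "'n \<Rightarrow> 'a \<times> 'a" and p q
  define t where "t = sqrt \<kappa>"
  have t: "0 < t" "t * t = \<kappa>" using \<kappa> by (auto simp: t_def)
  define Q where "Q Z = prob M {(I, K). sign_flip (\<beta> Z (fst I)) K}" for Z
  have resample: "prob Pi X =
      expectation Pi (\<lambda>Z. prob M {(I, K). Z(i := I, k := K) \<in> X})" for X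
  proof -
    have "prob Pi X = prob
        (bind_pmf Pi (\<lambda>Z. map_pmf (\<lambda>(I, K). Z(i := I, k := K)) M)) X"
      unfolding Pi_def M_def by (subst Pi_pmf_resample2[OF ik]) simp
    then show ?thesis by (simp add: prob_bind_pmf vimage_def case_prod_beta')
  qed
  have upd: "(fst \<circ> Z(i := I, k := K))(k := x) = (fst \<circ> Z)(i := fst I, k := x)"
    "(fst \<circ> Z(i := I, k := K))(i := y, k := x) = (fst \<circ> Z)(i := y, k := x)"
    for Z :: "'n \<Rightarrow> 'a \<times> 'a" and I K x y
    using ik by auto
  have EQ: "expectation Pi Q \<le> \<kappa>"
    using flip resample[of "{Z. sign_flip (\<lambda>x. D ((fst \<circ> Z)(k := x))) (Z k)}"]
    unfolding Pi_def[symmetric] by (simp add: upd Q_def[abs_def] \<beta>_def[abs_def])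
  have bound: "prob M {(I, K). cross_ratio_drop \<theta> (\<beta> Z) I K}
      \<le> 2 * Q Z + 2 * real N * (4 * Q Z / t + t)" for Z
  proof -
    \<comment> \<open>Exchanging the two points of a pair preserves \<open>\<mu>\<close>.\<close>
    have snd: "prob M {(I, K). sign_flip (\<beta> Z (snd I)) K} = Q Z"
    proof -
      have "M = map_pmf (apfst prod.swap) M"
        unfolding M_def by (subst swap[symmetric], subst pair_map_pmf1) (simp add: swap)
      then have "Q Z = prob (map_pmf (apfst prod.swap) M) {(I, K). sign_flip (\<beta> Z (fst I)) K}"
        by (simp add: Q_def)
      then show ?thesis by (simp add: vimage_def case_prod_beta')
    qed
    have le: "prob M {(I, K). cross_ratio_drop \<theta> (\<beta> Z) I K}
      \<le> 2 * prob \<mu> {I. sign_flip (\<beta> Z (fst W)) I} + 2 * real N * (2 * (Q Z + Q Z) / t + t)" for W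
    proof -
      have "prob M {(I, K). cross_ratio_drop \<theta> (\<beta> Z) I K} \<le>
        2 * prob \<mu> {I. sign_flip (\<beta> Z (fst W)) I} +
        2 * real N * (2 * (prob M {(I, K). sign_flip (\<beta> Z (fst I)) K} +
                  prob M {(I, K). sign_flip (\<beta> Z (snd I)) K}) / t + t)"
        unfolding M_def
      proof (rule prob_cross_ratio_drop[where \<beta> = "\<beta> Z" and s = "\<beta> Z (fst W)", OF \<theta> N t(1)])
        show "\<beta> Z p q * \<beta> Z (fst W) u = \<beta> Z p u * \<beta> Z (fst W) q - \<beta> Z q u * \<beta> Z (fst W) p"
          if "\<beta> Z (fst W) u \<noteq> 0" for u p q
          using pluecker[OF ik] that unfolding \<beta>_def by blast
      qed
      then show ?thesis by (simp add: snd flip: Q_def)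
    qed
    have intA: "integrable \<mu> (\<lambda>W. prob \<mu> {I. sign_flip (\<beta> Z (fst W)) I})"
      by (rule measure_pmf.integrable_const_bound[where B = 1]) auto
    have "prob M {(I, K). cross_ratio_drop \<theta> (\<beta> Z) I K}
      \<le> expectation \<mu> (\<lambda>W. 2 * prob \<mu> {I. sign_flip (\<beta> Z (fst W)) I} +
          2 * real N * (2 * (Q Z + Q Z) / t + t))"
    proof -
      have "expectation \<mu> (\<lambda>W. prob M {(I, K). cross_ratio_drop \<theta> (\<beta> Z) I K})
        \<le> expectation \<mu> (\<lambda>W. 2 * prob \<mu> {I. sign_flip (\<beta> Z (fst W)) I} +
          2 * real N * (2 * (Q Z + Q Z) / t + t))"
        using le by (intro integral_mono) (auto intro!: intA)
      then show ?thesis by simp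
    qed
    also have "\<dots> = 2 * expectation \<mu> (\<lambda>W. prob \<mu> {I. sign_flip (\<beta> Z (fst W)) I})
        + 2 * real N * (2 * (Q Z + Q Z) / t + t)"
      using intA by simp
    also have "expectation \<mu> (\<lambda>W. prob \<mu> {I. sign_flip (\<beta> Z (fst W)) I}) = Q Z"
      unfolding Q_def M_def pair_pmf_def
      by (subst prob_bind_pmf) (simp add: vimage_def flip: map_pmf_def)
    finally show ?thesis by simp
  qed
  have intQ: "integrable Pi Q"
    unfolding Q_def by (rule measure_pmf.integrable_const_bound[where B = 1]) auto
  have "prob Pi {Z. cross_ratio_drop \<theta> (\<lambda>p q. D ((fst \<circ> Z)(i := p, k := q))) (Z i) (Z k)}
    = expectation Pi (\<lambda>Z. prob M {(I, K). cross_ratio_drop \<theta> (\<beta> Z) I K})"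
    using ik by (subst resample) (simp add: upd \<beta>_def[abs_def])
  also have "\<dots> \<le> expectation Pi (\<lambda>Z. 2 * Q Z + 2 * real N * (4 * Q Z / t + t))"
  proof (rule integral_mono)
    show "integrable Pi (\<lambda>Z. prob M {(I, K). cross_ratio_drop \<theta> (\<beta> Z) I K})"
      by (rule measure_pmf.integrable_const_bound[where B = 1]) auto
    show "integrable Pi (\<lambda>Z. 2 * Q Z + 2 * real N * (4 * Q Z / t + t))"
      by (intro Bochner_Integration.integrable_add integrable_mult_right integrable_divide
          measure_pmf.integrable_const intQ)
  qed (rule bound)
  also have "\<dots> = 2 * expectation Pi Q + 2 * real N * (4 * expectation Pi Q / t + t)"
    using intQ by simp
  also have "\<dots> \<le> 2 * \<kappa> + 2 * real N * (4 * \<kappa> / t + t)"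
    using EQ t by (intro add_mono mult_left_mono divide_right_mono) auto
  also have "4 * \<kappa> / t = 4 * t" using t by (simp add: field_simps)
  also have "2 * \<kappa> \<le> 2 * t"
    using t \<kappa> real_sqrt_le_1_iff[of \<kappa>] mult_left_le[of t t] by (simp add: t_def)
  finally have "prob Pi
      {Z. cross_ratio_drop \<theta> (\<lambda>p q. D ((fst \<circ> Z)(i := p, k := q))) (Z i) (Z k)}
    \<le> 2 * t + 2 * real N * (4 * t + t)" by (simp only:)
  also have "\<dots> = (2 + 10 * real N) * sqrt \<kappa>" by (simp add: t_def algebra_simps)
  finally show ?thesis unfolding Pi_def .
qed

section \<open>Random layers\<close>

lemma exists_other:
  assumes "CARD('s :: finite) \<ge> 2"
  shows "\<exists>t. t \<noteq> (s :: 's)"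
proof (rule ccontr)
  assume "\<not> ?thesis"
  then have "(UNIV :: 's set) = {s}" by auto
  then have "CARD('s) = card {s}" by (rule arg_cong)
  then show False using assms by simp
qed

text \<open>Only choices \<open>\<sigma>\<close>, \<open>\<tau>\<close> that differ at every vertex
  are examined, as each pair \<open>Z \<sigma> \<tau> j\<close> then joins two different layers. A
  change at one or two vertices is completed to such a \<open>\<tau>\<close> by \<open>alt\<close>;
  this is harmless because flips and drops read only first components at the other vertices.\<close>

lemma consistent_layersI:
  fixes Y :: "'n :: finite \<Rightarrow> 's :: finite \<Rightarrow> 'a" and D :: "('n \<Rightarrow> 'a) \<Rightarrow> real"
  defines "Z \<equiv> \<lambda>\<sigma> \<tau> j. (Y j (\<sigma> j), Y j (\<tau> j))"
  assumes two: "CARD('s) \<ge> 2" and \<theta>: "0 < \<theta>"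
    and noflip: "\<And>\<sigma> \<tau> k. (\<forall>j. \<sigma> j \<noteq> \<tau> j) \<Longrightarrow> \<not> sign_flip (\<lambda>x. D ((fst \<circ> Z \<sigma> \<tau>)(k := x))) (Z \<sigma> \<tau> k)"
    and nodrop: "\<And>\<sigma> \<tau> i k. (\<forall>j. \<sigma> j \<noteq> \<tau> j) \<Longrightarrow> i \<noteq> k \<Longrightarrow>
      \<not> cross_ratio_drop \<theta> (\<lambda>p q. D ((fst \<circ> Z \<sigma> \<tau>)(i := p, k := q))) (Z \<sigma> \<tau> i) (Z \<sigma> \<tau> k)"
  shows "consistent_layers \<theta> D Y"
proof -
  define h where "h \<sigma> = (\<lambda>j. Y j (\<sigma> j))" for \<sigma>
  have h_upd: "(h \<sigma>)(k := Y k s) = h (\<sigma>(k := s))" for \<sigma> k s by (auto simp: h_def)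
  have fst_Z: "fst \<circ> Z \<sigma> \<tau> = h \<sigma>" for \<sigma> \<tau> by (auto simp: Z_def h_def)
  obtain alt where alt: "\<And>s :: 's. alt s \<noteq> s" using exists_other[OF two] by metis
  have step: "0 < D (h \<sigma>) * D (h (\<sigma>(k := t)))" if "t \<noteq> \<sigma> k" for \<sigma> k t
  proof -
    define \<tau> where "\<tau> = (\<lambda>j. alt (\<sigma> j))(k := t)"
    have "\<forall>j. \<sigma> j \<noteq> \<tau> j" using that alt by (auto simp: \<tau>_def) metis
    from noflip[OF this, of k] show ?thesis
      unfolding fst_Z sign_flip_def by (simp add: Z_def \<tau>_def h_upd not_le)
  qed
  have nz: "0 < D (h \<sigma>) * D (h \<sigma>)" for \<sigma>
    using step[of "alt (\<sigma> undefined)" \<sigma> undefined] alt by (auto simp: zero_less_mult_iff)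
  \<comment> \<open>Equality of signs is transported along a chain that switches one vertex at a
    time.\<close>
  have sub: "0 < D (h \<sigma>) * D (h (\<lambda>j. if j \<in> J then \<sigma>' j else \<sigma> j))" for \<sigma> \<sigma>' J
    using finite[of J]
  proof (induction J rule: finite_induct)
    case empty
    then show ?case using nz by simp
  next
    case (insert k J)
    define \<rho> where "\<rho> = (\<lambda>j. if j \<in> J then \<sigma>' j else \<sigma> j)"
    have eq: "(\<lambda>j. if j \<in> insert k J then \<sigma>' j else \<sigma> j) = \<rho>(k := \<sigma>' k)" by (auto simp: \<rho>_def)
    have "0 < D (h \<rho>) * D (h (\<rho>(k := \<sigma>' k)))"
    proof (cases "\<sigma>' k = \<rho> k")
      case True
      then show ?thesis using nz by simp
    qed (rule step)
    then show ?case using insert.IH unfolding eq \<rho>_def[symmetric]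
      by (auto simp: zero_less_mult_iff)
  qed
  have sign: "0 < D (h \<sigma>) * D (h \<sigma>')" for \<sigma> \<sigma>' using sub[of \<sigma> UNIV \<sigma>'] by simp
  have cr: "(1 - \<theta>) * (D (h (\<sigma>(i := s))) * D (h (\<sigma>(k := s')))) \<le> D (h \<sigma>) * D (h (\<sigma>(i := s, k := s')))"
    if ik: "i \<noteq> k" for \<sigma> i k s s'
  proof (cases "s = \<sigma> i \<or> s' = \<sigma> k")
    case True
    then have eq: "D (h \<sigma>) * D (h (\<sigma>(i := s, k := s'))) = D (h (\<sigma>(i := s))) * D (h (\<sigma>(k := s')))"
    proof
      assume "s' = \<sigma> k"
      then have "\<sigma>(i := s, k := s') = \<sigma>(i := s)" "\<sigma>(k := s') = \<sigma>" using ik by auto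
      then show ?thesis by (simp only: mult.commute)
    qed simp
    have "(1 - \<theta>) * (D (h (\<sigma>(i := s))) * D (h (\<sigma>(k := s')))) \<le> 1 * (D (h (\<sigma>(i := s))) * D (h (\<sigma>(k := s'))))"
      using \<theta> sign[of "\<sigma>(i := s)" "\<sigma>(k := s')"] by (intro mult_right_mono) auto
    then show ?thesis using eq by simp
  next
    case False
    define \<tau> where "\<tau> = (\<lambda>j. alt (\<sigma> j))(i := s, k := s')"
    have ne: "\<forall>j. \<sigma> j \<noteq> \<tau> j" using False alt by (auto simp: \<tau>_def) metis
    have Zi: "Z \<sigma> \<tau> i = (Y i (\<sigma> i), Y i s)" "Z \<sigma> \<tau> k = (Y k (\<sigma> k), Y k s')"
      using ik by (auto simp: Z_def \<tau>_def)
    have "\<not> cross_ratio_drop \<theta> (\<lambda>p q. D ((h \<sigma>)(i := p, k := q))) (Y i (\<sigma> i), Y i s) (Y k (\<sigma> k), Y k s')"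
      using nodrop[OF ne ik] unfolding fst_Z Zi .
    moreover have
      "(h \<sigma>)(i := Y i (\<sigma> i), k := Y k (\<sigma> k)) = h \<sigma>"
      "(h \<sigma>)(i := Y i (\<sigma> i), k := Y k s') = h (\<sigma>(k := s'))"
      "(h \<sigma>)(i := Y i s, k := Y k (\<sigma> k)) = h (\<sigma>(i := s))"
      "(h \<sigma>)(i := Y i s, k := Y k s') = h (\<sigma>(i := s, k := s'))"
      using ik by (auto simp: h_def)
    ultimately have "\<not> D (h \<sigma>) * D (h (\<sigma>(i := s, k := s'))) <
        (1 - \<theta>) * (D (h (\<sigma>(k := s'))) * D (h (\<sigma>(i := s))))"
      using sign by (simp add: cross_ratio_drop_def del: fun_upd_apply)
    then show ?thesis by (simp only: not_less mult.commute)
  qed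
  show ?thesis
    unfolding consistent_layers_def
    by (intro conjI allI impI) (fact sign[unfolded h_def], fact cr[unfolded h_def])
qed

text \<open>Union bound over all \<open>\<sigma>\<close>, \<open>\<tau>\<close>, \<open>i\<close>,
  \<open>k\<close>, where \<open>ev i k\<close> is a flip for \<open>i = k\<close> and a drop
  otherwise. If \<open>\<sigma>\<close> and \<open>\<tau>\<close> differ everywhere, the pairs
  \<open>(y j (\<sigma> j), y j (\<tau> j))\<close> are independent with law
  \<open>\<mu>\<close>.\<close>

theorem prob_inconsistent_layers:
  fixes D :: "('n :: finite \<Rightarrow> 'a) \<Rightarrow> real" and \<mu> :: "('a \<times> 'a) pmf" and \<nu> :: "('s :: finite \<Rightarrow> 'a) pmf"
  assumes pluecker: "\<And>f i k p q w u. i \<noteq> k \<Longrightarrow> D (f(i := w, k := u)) \<noteq> 0 \<Longrightarrow>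
      D (f(i := p, k := q)) * D (f(i := w, k := u)) =
      D (f(i := p, k := u)) * D (f(i := w, k := q)) - D (f(i := q, k := u)) * D (f(i := w, k := p))"
    and pairs: "\<And>s t. s \<noteq> t \<Longrightarrow> map_pmf (\<lambda>z. (z s, z t)) \<nu> = \<mu>"
    and flip: "\<And>k. prob (Pi_pmf UNIV d (\<lambda>_. \<mu>))
      {Z. sign_flip (\<lambda>x. D ((fst \<circ> Z)(k := x))) (Z k)} \<le> \<kappa>"
    and \<kappa>: "0 < \<kappa>" "\<kappa> \<le> 1" and \<theta>: "0 < \<theta>" and N: "1 / \<theta> \<le> real N" and two: "CARD('s) \<ge> 2"
  shows "prob (Pi_pmf UNIV d' (\<lambda>_. \<nu>)) {Y. \<not> consistent_layers \<theta> D Y}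
    \<le> CARD(('n \<Rightarrow> 's) \<times> ('n \<Rightarrow> 's) \<times> 'n \<times> 'n) * ((2 + 10 * real N) * sqrt \<kappa>)"
proof -
  define Y where "Y = Pi_pmf UNIV d' (\<lambda>_ :: 'n. \<nu>)"
  define ev where "ev i k = (if i = k then {Z. sign_flip (\<lambda>x. D ((fst \<circ> Z)(k := x))) (Z k)}
    else {Z. cross_ratio_drop \<theta> (\<lambda>p q. D ((fst \<circ> Z)(i := p, k := q))) (Z i) (Z k)})"
    for i k :: 'n
  define J where "J = {(\<sigma>, \<tau>, i :: 'n, k :: 'n). \<forall>j :: 'n. \<sigma> j \<noteq> (\<tau> j :: 's)}"
  define B where "B = (\<lambda>(\<sigma>, \<tau>, i, k). {y :: 'n \<Rightarrow> 's \<Rightarrow> 'a. (\<lambda>j. (y j (\<sigma> j), y j (\<tau> j))) \<in> ev i k})"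
  have swap: "map_pmf prod.swap \<mu> = \<mu>"
  proof -
    obtain s t :: 's where st: "s \<noteq> t" using exists_other[OF two] by metis
    have "map_pmf prod.swap \<mu> = map_pmf (\<lambda>z. (z t, z s)) \<nu>"
      by (simp add: pairs[OF st, symmetric] pmf.map_comp o_def)
    then show ?thesis using pairs st by metis
  qed
  have prob_ev: "prob (Pi_pmf UNIV d (\<lambda>_. \<mu>)) (ev i k) \<le> (2 + 10 * real N) * sqrt \<kappa>" for i k
  proof (cases "i = k")
    case True
    have "\<kappa> \<le> sqrt \<kappa>"
      using \<kappa> by (intro real_le_rsqrt) (auto simp: power2_eq_square mult_left_le)
    also have "\<dots> \<le> (2 + 10 * real N) * sqrt \<kappa>"
      using \<kappa> by (simp add: algebra_simps)
    finally show ?thesis using flip[of k] True by (simp add: ev_def)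
  next
    case False
    show ?thesis
      unfolding ev_def if_not_P[OF False]
      by (rule prob_cross_ratio_drop_random[OF _ swap flip \<kappa> \<theta> N False]) (rule pluecker)
  qed
  have prob_B: "prob Y (B x) \<le> (2 + 10 * real N) * sqrt \<kappa>" if "x \<in> J" for x
  proof -
    obtain \<sigma> \<tau> i k where x: "x = (\<sigma>, \<tau>, i, k)" by (cases x) auto
    have ne: "\<sigma> j \<noteq> \<tau> j" for j using that by (auto simp: J_def x)
    define pairing where "pairing y = (\<lambda>j. (y j (\<sigma> j), y j (\<tau> j)))" for y :: "'n \<Rightarrow> 's \<Rightarrow> 'a"
    have "map_pmf pairing Y = Pi_pmf UNIV d (\<lambda>_. \<mu>)"
      unfolding Y_def pairing_def
      by (subst Pi_pmf_map_dep[symmetric, where d' = d]) (simp add: pairs ne)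
    moreover have "B x = pairing -` ev i k" by (auto simp: B_def x pairing_def)
    ultimately have "prob Y (B x) = prob (Pi_pmf UNIV d (\<lambda>_. \<mu>)) (ev i k)"
      by (metis measure_map_pmf)
    then show ?thesis using prob_ev by simp
  qed
  have "{y. \<not> consistent_layers \<theta> D y} \<subseteq> (\<Union>x\<in>J. B x)"
  proof (rule subsetI, rule ccontr)
    fix y :: "'n \<Rightarrow> 's \<Rightarrow> 'a"
    assume y: "y \<in> {y. \<not> consistent_layers \<theta> D y}" "y \<notin> (\<Union>x\<in>J. B x)"
    have no: "(\<lambda>j. (y j (\<sigma> j), y j (\<tau> j))) \<notin> ev i k" if "\<forall>j. \<sigma> j \<noteq> \<tau> j" for \<sigma> \<tau> i k
      using y(2) that by (auto simp: J_def B_def)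
    have "consistent_layers \<theta> D y"
    proof (rule consistent_layersI[OF two \<theta>])
      show "\<not> sign_flip (\<lambda>x. D ((fst \<circ> (\<lambda>j. (y j (\<sigma> j), y j (\<tau> j))))(k := x))) (y k (\<sigma> k), y k (\<tau> k))"
        if "\<forall>j. \<sigma> j \<noteq> \<tau> j" for \<sigma> \<tau> k
        using no[OF that, of k k] by (simp add: ev_def)
      show "\<not> cross_ratio_drop \<theta> (\<lambda>p q. D ((fst \<circ> (\<lambda>j. (y j (\<sigma> j), y j (\<tau> j))))(i := p, k := q)))
          (y i (\<sigma> i), y i (\<tau> i)) (y k (\<sigma> k), y k (\<tau> k))"
        if "\<forall>j. \<sigma> j \<noteq> \<tau> j" "i \<noteq> k" for \<sigma> \<tau> i k
        using no[OF that(1), of i k] that(2) by (simp add: ev_def)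
    qed
    then show False using y(1) by simp
  qed
  then have "prob Y {y. \<not> consistent_layers \<theta> D y} \<le> card J * ((2 + 10 * real N) * sqrt \<kappa>)"
    using prob_B by (intro prob_UN_le) auto
  also have "\<dots> \<le> CARD(('n \<Rightarrow> 's) \<times> ('n \<Rightarrow> 's) \<times> 'n \<times> 'n) * ((2 + 10 * real N) * sqrt \<kappa>)"
    using \<kappa> by (intro mult_right_mono of_nat_mono card_mono) auto
  finally show ?thesis unfolding Y_def .
qed

text \<open>The default value of \<open>Pi_pmf\<close> is irrelevant here and below, as all index sets are \<open>UNIV\<close>.\<close>

definition cell_pair :: "'a set \<Rightarrow> ('a \<Rightarrow> 'k) \<Rightarrow> ('a \<times> 'a) pmf" where
  "cell_pair P \<kappa> = bind_pmf (pmf_of_set P)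
     (\<lambda>a. pair_pmf (pmf_of_set (cell P \<kappa> a)) (pmf_of_set (cell P \<kappa> a)))"

text \<open>The cell is that of a uniform point, so it is drawn with probability proportional to its
  size, which makes each single entry uniform on \<open>P\<close>. The entries, one for each layer,
  are independent within the same cell.\<close>

definition cell_layers :: "'a set \<Rightarrow> ('a \<Rightarrow> 'k) \<Rightarrow> ('s :: finite \<Rightarrow> 'a) pmf" where
  "cell_layers P \<kappa> = bind_pmf (pmf_of_set P)
     (\<lambda>a. Pi_pmf UNIV undefined (\<lambda>_. pmf_of_set (cell P \<kappa> a)))"

lemma Pi_pmf_pair_marginal:
  fixes p :: "'n :: finite \<Rightarrow> 'b pmf"
  assumes "i \<noteq> k"
  shows "map_pmf (\<lambda>Z. (Z i, Z k)) (Pi_pmf UNIV d p) = pair_pmf (p i) (p k)"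
proof -
  have "map_pmf (\<lambda>Z. (Z i, Z k)) (Pi_pmf UNIV d p)
    = bind_pmf (Pi_pmf UNIV d p) (\<lambda>Z. map_pmf (\<lambda>(I, K). (I, K)) (pair_pmf (p i) (p k)))"
    using assms by (subst Pi_pmf_resample2[OF assms])
      (simp add: map_bind_pmf pmf.map_comp o_def case_prod_beta')
  then show ?thesis by (simp add: bind_pmf_const)
qed

lemma cell_layers_pair:
  "s \<noteq> t \<Longrightarrow> map_pmf (\<lambda>z. (z s, z t)) (cell_layers P \<kappa>) = cell_pair P \<kappa>"
  by (simp add: cell_layers_def cell_pair_def map_bind_pmf Pi_pmf_pair_marginal)

text \<open>The representative of the cell may serve as the first point: both laws give every pair
  from a common cell of size \<open>c\<close> the probability \<open>1 / (card P * c)\<close>. This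
  form matches \<open>separation\<close>.\<close>

lemma cell_pair_alt:
  assumes P: "finite P" "P \<noteq> {}"
  shows "cell_pair P \<kappa> = bind_pmf (pmf_of_set P) (\<lambda>a. map_pmf (Pair a) (pmf_of_set (cell P \<kappa> a)))"
proof (rule pmf_eqI)
  fix bb :: "'a \<times> 'a"
  obtain b b' where bb: "bb = (b, b')" by (cases bb)
  have fin: "finite (cell P \<kappa> a)" for a using P by (rule_tac finite_cell)
  have ne: "cell P \<kappa> a \<noteq> {}" if "a \<in> P" for a using that by (auto simp: cell_def)
  have pmf_cell: "pmf (pmf_of_set (cell P \<kappa> a)) c = (if c \<in> P \<and> \<kappa> c = \<kappa> a then 1 / card (cell P \<kappa> a) else 0)"
    if "a \<in> P" for a c
    using fin ne[OF that] by (simp add: indicator_def cell_def)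
  have "(\<Sum>a\<in>P. pmf (pair_pmf (pmf_of_set (cell P \<kappa> a)) (pmf_of_set (cell P \<kappa> a))) bb)
    = (\<Sum>a\<in>P. if a \<in> cell P \<kappa> b then
        (if b \<in> P \<and> b' \<in> P \<and> \<kappa> b = \<kappa> b' then 1 / (card (cell P \<kappa> b) * card (cell P \<kappa> b)) else 0) else 0)"
  proof (rule sum.cong)
    fix a assume a: "a \<in> P"
    have "cell P \<kappa> a = cell P \<kappa> b" if "\<kappa> a = \<kappa> b" using that by (simp add: cell_def)
    then show "pmf (pair_pmf (pmf_of_set (cell P \<kappa> a)) (pmf_of_set (cell P \<kappa> a))) bb =
        (if a \<in> cell P \<kappa> b then
          (if b \<in> P \<and> b' \<in> P \<and> \<kappa> b = \<kappa> b' then 1 / (card (cell P \<kappa> b) * card (cell P \<kappa> b)) else 0) else 0)"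
      unfolding bb pmf_pair pmf_cell[OF a] using a by (auto simp: cell_def[of P \<kappa> b])
  qed simp
  also have "\<dots> = (\<Sum>a\<in>cell P \<kappa> b.
        if b \<in> P \<and> b' \<in> P \<and> \<kappa> b = \<kappa> b' then 1 / (card (cell P \<kappa> b) * card (cell P \<kappa> b)) else 0)"
    using P by (intro sum.mono_neutral_cong_right) (auto simp: cell_def)
  also have "\<dots> = (if b \<in> P \<and> b' \<in> P \<and> \<kappa> b = \<kappa> b' then 1 / card (cell P \<kappa> b) else 0)"
    using fin ne by (auto simp: card_gt_0_iff)
  also have "\<dots> = (\<Sum>a\<in>P. if a = b then (if b' \<in> P \<and> \<kappa> b = \<kappa> b' then 1 / card (cell P \<kappa> b) else 0) else 0)"
    using P by (simp add: sum.delta)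
  also have "\<dots> = (\<Sum>a\<in>P. pmf (map_pmf (Pair a) (pmf_of_set (cell P \<kappa> a))) bb)"
  proof (rule sum.cong)
    fix a assume a: "a \<in> P"
    show "(if a = b then (if b' \<in> P \<and> \<kappa> b = \<kappa> b' then 1 / card (cell P \<kappa> b) else 0) else 0)
      = pmf (map_pmf (Pair a) (pmf_of_set (cell P \<kappa> a))) bb"
    proof (cases "a = b")
      case True
      have "inj (Pair b)" by (auto simp: inj_def)
      then show ?thesis
        using True pmf_map_inj'[OF \<open>inj (Pair b)\<close>, of "pmf_of_set (cell P \<kappa> b)" b'] pmf_cell[OF a]
        by (auto simp: bb)
    next
      case False
      then have "bb \<notin> set_pmf (map_pmf (Pair a) (pmf_of_set (cell P \<kappa> a)))" by (auto simp: bb)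
      then show ?thesis using False unfolding set_pmf_iff by simp
    qed
  qed simp
  finally show "pmf (cell_pair P \<kappa>) bb
    = pmf (bind_pmf (pmf_of_set P) (\<lambda>a. map_pmf (Pair a) (pmf_of_set (cell P \<kappa> a)))) bb"
    unfolding cell_pair_def using P by (simp add: pmf_bind_pmf_of_set)
qed

lemma map_fst_cell_pair:
  assumes "finite P" "P \<noteq> {}"
  shows "map_pmf fst (cell_pair P \<kappa>) = pmf_of_set P"
  unfolding cell_pair_alt[OF assms] by (simp add: map_bind_pmf pmf.map_comp o_def bind_return_pmf')

lemma bind_cell:
  assumes "finite P" "P \<noteq> {}"
  shows "bind_pmf (pmf_of_set P) (\<lambda>a. pmf_of_set (cell P \<kappa> a)) = pmf_of_set P"
  using map_fst_cell_pair[OF assms, of \<kappa>] by (simp add: cell_pair_def map_bind_pmf map_fst_pair_pmf)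

lemma prob_cell_pair_neq:
  assumes P: "finite P" "P \<noteq> {}"
  shows "prob (cell_pair P \<kappa>) {I. f (snd I) \<noteq> f (fst I)} = separation P \<kappa> f"
proof -
  have ne: "cell P \<kappa> a \<noteq> {}" if "a \<in> P" for a using that by (auto simp: cell_def)
  have "prob (cell_pair P \<kappa>) {I. f (snd I) \<noteq> f (fst I)}
    = (\<Sum>a\<in>P. prob (pmf_of_set (cell P \<kappa> a)) {a'. f a' \<noteq> f a}) / card P"
    unfolding cell_pair_alt[OF P] prob_bind_pmf using P by (simp add: integral_pmf_of_set vimage_def)
  also have "(\<Sum>a\<in>P. prob (pmf_of_set (cell P \<kappa> a)) {a'. f a' \<noteq> f a})
    = (\<Sum>a\<in>P. card {a' \<in> cell P \<kappa> a. f a' \<noteq> f a} / card (cell P \<kappa> a))"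
  proof (rule sum.cong)
    fix a assume "a \<in> P"
    then have "prob (pmf_of_set (cell P \<kappa> a)) {a'. f a' \<noteq> f a}
      = card (cell P \<kappa> a \<inter> {a'. f a' \<noteq> f a}) / card (cell P \<kappa> a)"
      using ne finite_cell[OF P(1)] by (intro measure_pmf_of_set) auto
    also have "cell P \<kappa> a \<inter> {a'. f a' \<noteq> f a} = {a' \<in> cell P \<kappa> a. f a' \<noteq> f a}" by auto
    finally show "prob (pmf_of_set (cell P \<kappa> a)) {a'. f a' \<noteq> f a}
      = card {a' \<in> cell P \<kappa> a. f a' \<noteq> f a} / card (cell P \<kappa> a)" .
  qed simp
  finally show ?thesis by (simp add: separation_def)
qed

lemma prob_not_inj_le:
  fixes P :: "'a set"
  assumes P: "finite P" "P \<noteq> {}"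
  shows "prob (Pi_pmf UNIV d (\<lambda>_ :: 'n :: finite. pmf_of_set P)) {f. \<not> inj f}
    \<le> (real CARD('n))\<^sup>2 / card P"
proof -
  let ?U = "Pi_pmf UNIV d (\<lambda>_ :: 'n. pmf_of_set P)"
  define J where "J = {(i :: 'n, k :: 'n). i \<noteq> k}"
  have "prob (?U) {f. \<not> inj f} \<le> card J * (1 / card P)"
  proof (rule prob_UN_le[where B = "\<lambda>(i, k). {f. f i = f k}"])
    show "{f. \<not> inj f} \<subseteq> (\<Union>j\<in>J. (\<lambda>(i, k). {f :: 'n \<Rightarrow> 'a. f i = f k}) j)"
      by (auto simp: J_def inj_def)
    fix j assume "j \<in> J"
    then obtain i k where ik: "j = (i, k)" "i \<noteq> k" by (auto simp: J_def)
    have "prob (?U) {f. f i = f k}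
      = prob (map_pmf (\<lambda>f. (f i, f k)) (?U)) {(x, y). x = y}"
      by (simp add: vimage_def)
    also have "\<dots> = prob (pair_pmf (pmf_of_set P) (pmf_of_set P)) {(x, y). x = y}"
      by (simp add: Pi_pmf_pair_marginal[OF ik(2)])
    also have "\<dots> \<le> 1 / card P"
      unfolding pair_pmf_def
    proof (rule prob_bind_le)
      fix x
      have "prob (bind_pmf (pmf_of_set P) (\<lambda>y. return_pmf (x, y))) {(x, y). x = y}
        = prob (pmf_of_set P) {x}"
        by (simp add: vimage_def flip: map_pmf_def)
      also have "\<dots> = card (P \<inter> {x}) / card P" using P by (simp add: measure_pmf_of_set)
      also have "\<dots> \<le> 1 / card P"
        using card_mono[of "{x}" "P \<inter> {x}"] by (intro divide_right_mono) auto
      finally show "prob (bind_pmf (pmf_of_set P) (\<lambda>y. return_pmf (x, y))) {(x, y). x = y}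
        \<le> 1 / card P" .
    qed
    finally show "prob (?U) ((\<lambda>(i, k). {f. f i = f k}) j)
      \<le> 1 / card P" by (simp add: ik)
  qed simp
  also have "\<dots> \<le> (CARD('n))\<^sup>2 * (1 / card P)"
  proof (intro mult_right_mono)
    have "card J \<le> CARD('n \<times> 'n)" by (intro card_mono) auto
    then show "real (card J) \<le> real ((CARD('n))\<^sup>2)"
      unfolding of_nat_le_iff by (simp add: power2_eq_square)
  qed simp
  finally show ?thesis by simp
qed

text \<open>A nonpositive product means that the signs differ or that the first value is 0. The
  former is measured by \<open>separation\<close>; the latter requires a repeated vertex, since
  \<open>D\<close> does not vanish on injective tuples, and causes the term of order
  \<open>1 / card P\<close>.\<close>

lemma prob_sign_flip_le:
  fixes D :: "('n :: finite \<Rightarrow> 'a) \<Rightarrow> real"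
  assumes P: "finite P" "P \<noteq> {}"
    and D: "\<And>f. inj f \<Longrightarrow> range f \<subseteq> P \<Longrightarrow> D f \<noteq> 0"
    and sep: "\<And>g k. separation P \<kappa> (\<lambda>a. sgn (D (g(k := a)))) \<le> \<eta>"
  shows "prob (Pi_pmf UNIV d (\<lambda>_. cell_pair P \<kappa>))
      {Z. sign_flip (\<lambda>x. D ((fst \<circ> Z)(k := x))) (Z k)} \<le> \<eta> + (real CARD('n))\<^sup>2 / card P"
proof -
  define M where "M = Pi_pmf UNIV d (\<lambda>_ :: 'n. cell_pair P \<kappa>)"
  define X where "X = {Z :: 'n \<Rightarrow> 'a \<times> 'a.
    sgn (D ((fst \<circ> Z)(k := snd (Z k)))) \<noteq> sgn (D ((fst \<circ> Z)(k := fst (Z k))))}"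
  define O' where "O' = {Z :: 'n \<Rightarrow> 'a \<times> 'a. D (fst \<circ> Z) = 0}"
  have upd: "(fst \<circ> Z)(k := fst (Z k)) = fst \<circ> Z" for Z :: "'n \<Rightarrow> 'a \<times> 'a" by auto
  have "prob M {Z. sign_flip (\<lambda>x. D ((fst \<circ> Z)(k := x))) (Z k)} \<le> prob M (X \<union> O')"
  proof (rule measure_pmf.finite_measure_mono)
    show "{Z. sign_flip (\<lambda>x. D ((fst \<circ> Z)(k := x))) (Z k)} \<subseteq> X \<union> O'"
    proof
      fix Z assume "Z \<in> {Z. sign_flip (\<lambda>x. D ((fst \<circ> Z)(k := x))) (Z k)}"
      then have "D (fst \<circ> Z) * D ((fst \<circ> Z)(k := snd (Z k))) \<le> 0"
        unfolding sign_flip_def using upd[of Z] by simp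
      then show "Z \<in> X \<union> O'"
        unfolding X_def O'_def mem_Collect_eq Un_iff upd by (auto simp: mult_le_0_iff sgn_if)
    qed
  qed simp
  also have "\<dots> \<le> prob M X + prob M O'" by (rule measure_Un_le) auto
  also have "prob M X \<le> \<eta>"
  proof -
    have "prob M X
      = prob (bind_pmf M (\<lambda>Z. map_pmf (\<lambda>I. Z(k := I)) (cell_pair P \<kappa>))) X"
      unfolding M_def by (subst Pi_pmf_resample[of d "\<lambda>_. cell_pair P \<kappa>" k]) simp
    also have "\<dots> \<le> \<eta>"
    proof (rule prob_bind_le)
      fix Z :: "'n \<Rightarrow> 'a \<times> 'a"
      have upd': "(fst \<circ> Z(k := I))(k := x) = (fst \<circ> Z)(k := x)" for I x by auto
      have "prob (map_pmf (\<lambda>I. Z(k := I)) (cell_pair P \<kappa>)) X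
        = prob (cell_pair P \<kappa>)
          {I. sgn (D ((fst \<circ> Z)(k := snd I))) \<noteq> sgn (D ((fst \<circ> Z)(k := fst I)))}"
        unfolding measure_map_pmf vimage_def X_def mem_Collect_eq upd' by simp
      also have "\<dots> \<le> \<eta>"
        using prob_cell_pair_neq[OF P, of \<kappa> "\<lambda>a. sgn (D ((fst \<circ> Z)(k := a)))"] sep[of "fst \<circ> Z" k] by simp
      finally show "prob (map_pmf (\<lambda>I. Z(k := I)) (cell_pair P \<kappa>)) X \<le> \<eta>" .
    qed
    finally show ?thesis .
  qed
  also have "prob M O' \<le> (real CARD('n))\<^sup>2 / card P"
  proof -
    let ?U = "Pi_pmf UNIV (fst d) (\<lambda>_ :: 'n. pmf_of_set P)"
    have "prob M O' = prob (map_pmf (\<lambda>Z. fst \<circ> Z) M) {f. D f = 0}"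
      by (simp add: O'_def vimage_def)
    also have "map_pmf (\<lambda>Z. fst \<circ> Z) M = ?U"
      unfolding M_def by (subst Pi_pmf_map[symmetric]) (simp_all add: map_fst_cell_pair[OF P])
    also have "prob (?U) {f. D f = 0}
      \<le> prob (?U) {f. \<not> inj f}"
    proof (rule measure_pmf.finite_measure_mono_AE)
      show "AE f in measure_pmf (?U).
          f \<in> {f. D f = 0} \<longrightarrow> f \<in> {f. \<not> inj f}"
        unfolding AE_measure_pmf_iff
      proof (intro ballI impI)
        fix f assume "f \<in> set_pmf (?U)" and f0: "f \<in> {f. D f = 0}"
        then have "range f \<subseteq> P" using P by (auto simp: set_Pi_pmf PiE_dflt_def)
        then show "f \<in> {f. \<not> inj f}" using D f0 by auto
      qed
    qed simp
    also have "\<dots> \<le> (real CARD('n))\<^sup>2 / card P" by (rule prob_not_inj_le[OF P])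
    finally show ?thesis .
  qed
  finally show ?thesis unfolding M_def by simp
qed

lemma Pi_pmf_transpose:
  fixes p :: "'n :: finite \<Rightarrow> 'a pmf"
  shows "map_pmf (\<lambda>Y (s :: 's :: finite) j. Y j s) (Pi_pmf UNIV d1 (\<lambda>j. Pi_pmf UNIV d2 (\<lambda>_. p j)))
    = Pi_pmf UNIV d3 (\<lambda>_. Pi_pmf UNIV d4 p)"
proof (rule pmf_eqI)
  fix y :: "'s \<Rightarrow> 'n \<Rightarrow> 'a"
  let ?T = "\<lambda>Y (s :: 's) (j :: 'n). Y j s :: 'a"
  have inj: "inj ?T"
  proof (rule injI)
    fix Y Y' :: "'n \<Rightarrow> 's \<Rightarrow> 'a" assume "?T Y = ?T Y'"
    then have "Y j s = Y' j s" for j s by (auto dest: fun_cong)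
    then show "Y = Y'" by auto
  qed
  have "pmf (map_pmf ?T (Pi_pmf UNIV d1 (\<lambda>j. Pi_pmf UNIV d2 (\<lambda>_. p j)))) (?T (\<lambda>j s. y s j))
    = pmf (Pi_pmf UNIV d1 (\<lambda>j. Pi_pmf UNIV d2 (\<lambda>_. p j))) (\<lambda>j s. y s j)"
    by (rule pmf_map_inj'[OF inj])
  also have "\<dots> = (\<Prod>j\<in>UNIV. \<Prod>s\<in>UNIV. pmf (p j) (y s j))" by (simp add: pmf_Pi)
  also have "\<dots> = (\<Prod>s\<in>UNIV. \<Prod>j\<in>UNIV. pmf (p j) (y s j))" by (rule prod.swap)
  also have "\<dots> = pmf (Pi_pmf UNIV d3 (\<lambda>_. Pi_pmf UNIV d4 p)) y" by (simp add: pmf_Pi)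
  finally show "pmf (map_pmf ?T (Pi_pmf UNIV d1 (\<lambda>j. Pi_pmf UNIV d2 (\<lambda>_. p j)))) y
    = pmf (Pi_pmf UNIV d3 (\<lambda>_. Pi_pmf UNIV d4 p)) y" by simp
qed

section \<open>Layers as independent simplices on randomly chosen cells\<close>

definition cell_product :: "'a set \<Rightarrow> ('a \<Rightarrow> 'k) \<Rightarrow> ('n :: finite \<Rightarrow> 'a) \<Rightarrow> ('n \<Rightarrow> 'a) pmf" where
  "cell_product P \<kappa> a = Pi_pmf UNIV undefined (\<lambda>j. pmf_of_set (cell P \<kappa> (a j)))"

definition random_layers :: "'a set \<Rightarrow> ('a \<Rightarrow> 'k) \<Rightarrow> ('n :: finite \<Rightarrow> 's :: finite \<Rightarrow> 'a) pmf" where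
  "random_layers P \<kappa> = Pi_pmf UNIV undefined (\<lambda>_. cell_layers P \<kappa>)"

definition uniform_tuple :: "'a set \<Rightarrow> ('n :: finite \<Rightarrow> 'a) pmf" where
  "uniform_tuple P = Pi_pmf UNIV undefined (\<lambda>_. pmf_of_set P)"

text \<open>\<open>random_layers\<close> is indexed by the vertex first, as the consistency
  estimates need. Read by layers it is a mixture: given the points \<open>a\<close> that select the
  cells, the layers are independent copies of \<open>cell_product P \<kappa> a\<close>.\<close>

lemma transpose_random_layers:
  "map_pmf (\<lambda>Y (s :: 's :: finite) (j :: 'n :: finite). Y j s) (random_layers P \<kappa>) =
    bind_pmf (uniform_tuple P) (\<lambda>a. Pi_pmf UNIV undefined (\<lambda>_. cell_product P \<kappa> a))"
  unfolding random_layers_def cell_layers_def uniform_tuple_def cell_product_def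
  by (subst Pi_pmf_bind[where d' = undefined])
    (simp_all add: map_bind_pmf Pi_pmf_transpose[where ?d3.0 = undefined and ?d4.0 = undefined])

lemma bind_cell_product:
  assumes "finite P" "P \<noteq> {}"
  shows "bind_pmf (uniform_tuple P) (cell_product P \<kappa>) = (uniform_tuple P :: ('n :: finite \<Rightarrow> 'a) pmf)"
  unfolding uniform_tuple_def cell_product_def
  by (subst Pi_pmf_bind[symmetric]) (simp_all add: bind_cell[OF assms])

lemma uniform_tuple_eq:
  assumes "finite P" "P \<noteq> {}"
  shows "uniform_tuple P = pmf_of_set {f :: 'n :: finite \<Rightarrow> 'a. range f \<subseteq> P}"
proof -
  have "PiE_dflt UNIV undefined (\<lambda>_. P) = {f :: 'n \<Rightarrow> 'a. range f \<subseteq> P}"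
    by (auto simp: PiE_dflt_def)
  then show ?thesis unfolding uniform_tuple_def using assms by (subst Pi_pmf_of_set) auto
qed

lemma finite_card_tuples:
  assumes "finite P"
  shows "finite {f :: 'n :: finite \<Rightarrow> 'a. range f \<subseteq> P}"
    "card {f :: 'n :: finite \<Rightarrow> 'a. range f \<subseteq> P} = card P ^ CARD('n)"
proof -
  have eq: "PiE_dflt UNIV undefined (\<lambda>_. P) = {f :: 'n \<Rightarrow> 'a. range f \<subseteq> P}"
    by (auto simp: PiE_dflt_def)
  show "finite {f :: 'n \<Rightarrow> 'a. range f \<subseteq> P}"
    unfolding eq[symmetric] using assms by (intro finite_PiE_dflt) auto
  show "card {f :: 'n \<Rightarrow> 'a. range f \<subseteq> P} = card P ^ CARD('n)"
    unfolding eq[symmetric] using assms by (subst card_PiE_dflt) auto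
qed

lemma prob_uniform_tuple:
  assumes P: "finite P" "P \<noteq> {}" and E: "\<And>f. f \<in> \<E> \<Longrightarrow> range f \<subseteq> P"
  shows "prob (uniform_tuple P) (\<E> :: ('n :: finite \<Rightarrow> 'a) set) = card \<E> / real (card P) ^ CARD('n)"
proof -
  obtain p where "p \<in> P" using P by blast
  then have "(\<lambda>_. p) \<in> {f :: 'n \<Rightarrow> 'a. range f \<subseteq> P}" by auto
  then have "{f :: 'n \<Rightarrow> 'a. range f \<subseteq> P} \<noteq> {}" by blast
  moreover have "{f. range f \<subseteq> P} \<inter> \<E> = \<E>" using E by auto
  ultimately show ?thesis
    unfolding uniform_tuple_eq[OF P] using finite_card_tuples[OF P(1), where 'n = 'n]
    by (simp add: measure_pmf_of_set)
qed

text \<open>Given \<open>a\<close>, all layers lie in the family with probability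
  \<open>x a ^ m\<close>, and \<open>x\<close> has mean \<open>e\<close>. Jensen's inequality for
  the power comes from the tangent at \<open>e\<close>, that is, from Bernoulli's
  inequality.\<close>

lemma prob_all_layers_ge:
  fixes \<E> :: "('n :: finite \<Rightarrow> 'a) set"
  assumes P: "finite P" "P \<noteq> {}" and E: "\<And>f. f \<in> \<E> \<Longrightarrow> range f \<subseteq> P"
  shows "(card \<E> / real (card P) ^ CARD('n)) ^ CARD('s :: finite) \<le>
    prob (random_layers P \<kappa>) {Y :: 'n \<Rightarrow> 's \<Rightarrow> 'a. \<forall>s. (\<lambda>j. Y j s) \<in> \<E>}"
proof -
  define e where "e = card \<E> / real (card P) ^ CARD('n)"
  define m where "m = CARD('s)"
  define x where "x a = prob (cell_product P \<kappa> a) \<E>" for a :: "'n \<Rightarrow> 'a"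
  have m: "0 < m" by (simp add: m_def)
  have int: "integrable (uniform_tuple P) x"
    unfolding x_def by (rule measure_pmf.integrable_const_bound[where B = 1]) auto
  have "e = prob (bind_pmf (uniform_tuple P) (cell_product P \<kappa>)) \<E>"
    unfolding bind_cell_product[OF P] e_def using prob_uniform_tuple[OF P E] by simp
  then have Ex: "expectation (uniform_tuple P) x = e"
    by (simp add: prob_bind_pmf x_def[abs_def])
  have "prob (random_layers P \<kappa>) {Y :: 'n \<Rightarrow> 's \<Rightarrow> 'a. \<forall>s. (\<lambda>j. Y j s) \<in> \<E>}
    = prob (map_pmf (\<lambda>Y (s :: 's) j. Y j s) (random_layers P \<kappa>)) (Pi UNIV (\<lambda>_. \<E>))"
    by (simp add: vimage_def Pi_def)
  also have "\<dots> = expectation (uniform_tuple P) (\<lambda>a. x a ^ m)"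
    unfolding transpose_random_layers prob_bind_pmf by (simp add: measure_Pi_pmf_Pi x_def m_def)
  also have "\<dots> \<ge> e ^ m"
  proof (cases "e = 0")
    case True
    moreover have "0 \<le> expectation (uniform_tuple P) (\<lambda>a. x a ^ m)"
      by (rule Bochner_Integration.integral_nonneg) (simp add: x_def)
    ultimately show ?thesis using m by (simp add: zero_power)
  next
    case False
    moreover have "0 \<le> e" by (simp add: e_def)
    ultimately have e: "0 < e" by simp
    have "e ^ m = expectation (uniform_tuple P) (\<lambda>a. e ^ m + real m * e ^ (m - 1) * (x a - e))"
      using int Ex by simp
    also have "\<dots> \<le> expectation (uniform_tuple P) (\<lambda>a. x a ^ m)"
    proof (rule integral_mono)
      show "integrable (uniform_tuple P) (\<lambda>a. e ^ m + real m * e ^ (m - 1) * (x a - e))"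
        using int by simp
      show "integrable (uniform_tuple P) (\<lambda>a. x a ^ m)"
        by (rule measure_pmf.integrable_const_bound[where B = 1]) (auto simp: x_def power_le_one)
      fix a
      have "1 + real m * (x a / e - 1) \<le> (1 + (x a / e - 1)) ^ m"
        using e by (intro Bernoulli_inequality) (simp add: x_def)
      then have "e ^ m * (1 + real m * (x a / e - 1)) \<le> e ^ m * (x a / e) ^ m"
        using e by (intro mult_left_mono) auto
      moreover have "e ^ m * (x a / e) ^ m = x a ^ m" using e by (simp add: power_divide)
      moreover have "e ^ m * (1 + real m * (x a / e - 1)) = e ^ m + real m * e ^ (m - 1) * (x a - e)"
        using e m by (cases m) (simp_all add: field_simps)
      ultimately show "e ^ m + real m * e ^ (m - 1) * (x a - e) \<le> x a ^ m" by linarith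
    qed
    finally show ?thesis .
  qed
  finally show ?thesis by (simp add: e_def m_def)
qed

text \<open>If the layers have a common point, some layer \<open>s\<close> contains
  \<open>q s y\<close>. As this point does not depend on layer \<open>s\<close>, redrawing that
  layer hits it with probability at most \<open>c\<close>.\<close>

lemma prob_common_point_le:
  fixes \<beta> :: "'f pmf" and C :: "'f \<Rightarrow> 'b :: euclidean_space set" and c :: real
  assumes card: "CARD('s :: finite) = DIM('b) + 1"
    and C: "finite \<E>" "\<And>f. f \<in> \<E> \<Longrightarrow> convex (C f)"
    and M: "\<And>x. prob \<beta> {f \<in> \<E>. x \<in> C f} \<le> c"
  shows "prob (Pi_pmf UNIV d (\<lambda>_ :: 's. \<beta>)) {y. (\<forall>s. y s \<in> \<E>) \<and> (\<Inter>s. C (y s)) \<noteq> {}}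
    \<le> CARD('s) * c"
proof -
  obtain q :: "'s \<Rightarrow> ('s \<Rightarrow> 'f) \<Rightarrow> 'b" where q: "\<And>s y f. q s (y(s := f)) = q s y"
    "\<And>y. (\<forall>s. y s \<in> \<E>) \<Longrightarrow> (\<Inter>s. C (y s)) \<noteq> {} \<Longrightarrow> \<exists>s. q s y \<in> C (y s)"
    using selection[where C = C, OF card C(1)] C(2) by metis
  define B where "B s = {y :: 's \<Rightarrow> 'f. y s \<in> \<E> \<and> q s y \<in> C (y s)}" for s
  show ?thesis
  proof (rule prob_UN_le[where B = B and J = UNIV])
    show "{y. (\<forall>s. y s \<in> \<E>) \<and> (\<Inter>s. C (y s)) \<noteq> {}} \<subseteq> (\<Union>s\<in>UNIV. B s)"
      using q(2) by (fastforce simp: B_def)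
    fix s
    have "prob (Pi_pmf UNIV d (\<lambda>_ :: 's. \<beta>)) (B s)
      = prob (bind_pmf (Pi_pmf UNIV d (\<lambda>_ :: 's. \<beta>)) (\<lambda>Z. map_pmf (\<lambda>I. Z(s := I)) \<beta>)) (B s)"
      by (subst Pi_pmf_resample[of d "\<lambda>_. \<beta>" s]) simp
    also have "\<dots> \<le> c"
    proof (rule prob_bind_le)
      fix Z :: "'s \<Rightarrow> 'f"
      have "prob (map_pmf (\<lambda>I. Z(s := I)) \<beta>) (B s) = prob \<beta> {f \<in> \<E>. q s Z \<in> C f}"
        by (simp add: B_def q(1) vimage_def)
      then show "prob (map_pmf (\<lambda>I. Z(s := I)) \<beta>) (B s) \<le> c" using M by simp
    qed
    finally show "prob (Pi_pmf UNIV d (\<lambda>_ :: 's. \<beta>)) (B s) \<le> c" .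
  qed simp
qed

text \<open>For cells selected by \<open>a\<close>, every tuple has probability at most
  \<open>w a\<close>, the product of the reciprocal cell sizes, so a point lying in at most
  \<open>M\<close> sets is hit with probability at most \<open>M * w a\<close>. The mean reciprocal
  cell size is the number of cells divided by \<open>card P\<close>.\<close>

theorem prob_layers_common_point_le:
  fixes \<E> :: "('n :: finite \<Rightarrow> 'a) set" and C :: "('n \<Rightarrow> 'a) \<Rightarrow> 'b :: euclidean_space set" and M :: real
  assumes card: "CARD('s :: finite) = DIM('b) + 1" and P: "finite P" "P \<noteq> {}"
    and E: "finite \<E>" and C: "\<And>f. f \<in> \<E> \<Longrightarrow> convex (C f)"
    and M: "\<And>x. real (card {f \<in> \<E>. x \<in> C f}) \<le> M"
  shows "prob (random_layers P \<kappa>)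
      {Y :: 'n \<Rightarrow> 's \<Rightarrow> 'a. (\<forall>s. (\<lambda>j. Y j s) \<in> \<E>) \<and> (\<Inter>s. C (\<lambda>j. Y j s)) \<noteq> {}}
    \<le> CARD('s) * M * (card (\<kappa> ` P) / card P) ^ CARD('n)"
proof -
  define X where "X = {y :: 's \<Rightarrow> 'n \<Rightarrow> 'a. (\<forall>s. y s \<in> \<E>) \<and> (\<Inter>s. C (y s)) \<noteq> {}}"
  define w where "w a = (\<Prod>j\<in>UNIV. 1 / real (card (cell P \<kappa> (a j))))" for a :: "'n \<Rightarrow> 'a"
  have intw: "integrable (uniform_tuple P) w"
    unfolding w_def uniform_tuple_def using P
    by (intro integrable_prod_Pi_pmf integrable_measure_pmf_finite) auto
  have Ew: "expectation (uniform_tuple P) w = (card (\<kappa> ` P) / card P) ^ CARD('n)"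
  proof -
    have "expectation (uniform_tuple P) w
      = (\<Prod>j\<in>(UNIV :: 'n set). expectation (pmf_of_set P) (\<lambda>a. 1 / real (card (cell P \<kappa> a))))"
      unfolding w_def uniform_tuple_def using P
      by (intro expectation_prod_Pi_pmf integrable_measure_pmf_finite) auto
    then show ?thesis using P by (simp add: integral_pmf_of_set sum_inverse_card_cell)
  qed
  have "prob (random_layers P \<kappa>)
      {Y :: 'n \<Rightarrow> 's \<Rightarrow> 'a. (\<forall>s. (\<lambda>j. Y j s) \<in> \<E>) \<and> (\<Inter>s. C (\<lambda>j. Y j s)) \<noteq> {}}
    = prob (map_pmf (\<lambda>Y s j. Y j s) (random_layers P \<kappa>)) X"
    by (simp add: X_def vimage_def)
  also have "\<dots> = expectation (uniform_tuple P)
      (\<lambda>a. prob (Pi_pmf UNIV undefined (\<lambda>_ :: 's. cell_product P \<kappa> a)) X)"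
    unfolding transpose_random_layers prob_bind_pmf ..
  also have "\<dots> \<le> expectation (uniform_tuple P) (\<lambda>a. real CARD('s) * (M * w a))"
  proof (rule integral_mono_AE)
    show "integrable (uniform_tuple P)
        (\<lambda>a. prob (Pi_pmf UNIV undefined (\<lambda>_ :: 's. cell_product P \<kappa> a)) X)"
      by (rule measure_pmf.integrable_const_bound[where B = 1]) auto
    show "integrable (uniform_tuple P) (\<lambda>a. real CARD('s) * (M * w a))" using intw by simp
    show "AE a in measure_pmf (uniform_tuple P).
        prob (Pi_pmf UNIV undefined (\<lambda>_ :: 's. cell_product P \<kappa> a)) X
        \<le> real CARD('s) * (M * w a)"
      unfolding AE_measure_pmf_iff
    proof
      fix a assume "a \<in> set_pmf (uniform_tuple P :: ('n \<Rightarrow> 'a) pmf)"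
      then have a: "a j \<in> P" for j
        using P unfolding uniform_tuple_def by (auto simp: set_Pi_pmf PiE_dflt_def)
      have ne: "cell P \<kappa> (a j) \<noteq> {}" for j using a[of j] by (auto simp: cell_def)
      have fin: "finite (cell P \<kappa> (a j))" for j by (rule finite_cell[OF P(1)])
      have pmf_le: "pmf (cell_product P \<kappa> a) f \<le> w a" for f
        unfolding cell_product_def w_def using ne fin
        by (subst pmf_Pi') (auto intro!: prod_mono simp: indicator_def divide_right_mono)
      have w0: "0 \<le> w a" by (auto simp: w_def intro!: prod_nonneg)
      have bound: "prob (cell_product P \<kappa> a) {f \<in> \<E>. x \<in> C f} \<le> M * w a" for x
      proof -
        have "prob (cell_product P \<kappa> a) {f \<in> \<E>. x \<in> C f}
          = (\<Sum>f\<in>{f \<in> \<E>. x \<in> C f}. pmf (cell_product P \<kappa> a) f)"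
          using E by (intro measure_measure_pmf_finite) auto
        also have "\<dots> \<le> (\<Sum>f\<in>{f \<in> \<E>. x \<in> C f}. w a)" by (intro sum_mono pmf_le)
        also have "\<dots> = card {f \<in> \<E>. x \<in> C f} * w a" by simp
        also have "\<dots> \<le> M * w a" using M w0 by (intro mult_right_mono) auto
        finally show ?thesis .
      qed
      show "prob (Pi_pmf UNIV undefined (\<lambda>_ :: 's. cell_product P \<kappa> a)) X
          \<le> real CARD('s) * (M * w a)"
        unfolding X_def by (rule prob_common_point_le[OF card E]) (erule C, rule bound)
    qed
  qed
  also have "\<dots> = CARD('s) * M * (card (\<kappa> ` P) / card P) ^ CARD('n)" using Ew by simp
  finally show ?thesis .
qed

section \<open>Assembling the bound\<close>

lemma prob_inconsistent_orient:
  assumes \<theta>: "0 < \<theta>"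
  shows "\<exists>K\<ge>1. \<forall>P (\<kappa> :: real ^ 'd :: finite \<Rightarrow> real list) \<eta>. finite P \<longrightarrow> P \<noteq> {} \<longrightarrow> general_position P \<longrightarrow>
    (\<forall>g j. separation P \<kappa> (\<lambda>a. sgn (orient (g(j := a)))) \<le> \<eta>) \<longrightarrow>
    0 < \<eta> \<longrightarrow> \<eta> + (real CARD('d option))\<^sup>2 / card P \<le> 1 \<longrightarrow>
    prob (random_layers P \<kappa>)
      {Y :: 'd option \<Rightarrow> 'd option \<Rightarrow> real ^ 'd. \<not> consistent_layers \<theta> orient Y}
      \<le> K * sqrt (\<eta> + (real CARD('d option))\<^sup>2 / card P)"
proof -
  obtain N :: nat where N: "1 / \<theta> \<le> real N" using real_arch_simple by blast
  define c where "c = CARD(('d option \<Rightarrow> 'd option) \<times> ('d option \<Rightarrow> 'd option) \<times> 'd option \<times> 'd option)"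
  define K where "K = real c * (2 + 10 * real N)"
  have "1 \<le> c" unfolding c_def by (simp only: Suc_le_eq One_nat_def zero_less_card_finite)
  then have "1 * 1 \<le> K" unfolding K_def by (intro mult_mono) auto
  then have K: "1 \<le> K" by simp
  show ?thesis
  proof (intro exI[of _ K] conjI K allI impI)
    fix P and \<kappa> :: "real ^ 'd \<Rightarrow> real list" and \<eta> :: real
    assume P: "finite P" "P \<noteq> {}" "general_position P"
      and sep: "\<forall>g j. separation P \<kappa> (\<lambda>a. sgn (orient (g(j := a)))) \<le> \<eta>"
      and \<eta>: "0 < \<eta>" "\<eta> + (real CARD('d option))\<^sup>2 / card P \<le> 1"
    let ?k = "\<eta> + (real CARD('d option))\<^sup>2 / card P"
    have "prob (Pi_pmf UNIV undefined (\<lambda>_. cell_layers P \<kappa>))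
        {Y :: 'd option \<Rightarrow> 'd option \<Rightarrow> real ^ 'd. \<not> consistent_layers \<theta> orient Y}
      \<le> c * ((2 + 10 * real N) * sqrt ?k)"
      unfolding c_def
    proof (rule prob_inconsistent_layers)
      show "orient (f(i := p, k := q)) * orient (f(i := w, k := u)) =
          orient (f(i := p, k := u)) * orient (f(i := w, k := q)) -
          orient (f(i := q, k := u)) * orient (f(i := w, k := p))"
        if "i \<noteq> k" "orient (f(i := w, k := u)) \<noteq> 0" for f :: "'d option \<Rightarrow> real ^ 'd" and i k p q w u
        using orient_pluecker[OF that] .
      show "map_pmf (\<lambda>z. (z s, z t)) (cell_layers P \<kappa>) = cell_pair P \<kappa>" if "s \<noteq> t" for s t :: "'d option"
        using that by (rule cell_layers_pair)
      show "prob (Pi_pmf UNIV undefined (\<lambda>_ :: 'd option. cell_pair P \<kappa>))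
          {Z. sign_flip (\<lambda>x. orient ((fst \<circ> Z)(k := x))) (Z k)} \<le> ?k" for k
        using sep orient_nonzero[OF P(3)] by (intro prob_sign_flip_le P(1,2)) blast+
      show "0 < ?k" using \<eta> by (simp add: add_pos_nonneg)
      show "2 \<le> CARD('d option)" by (simp add: Suc_le_eq)
    qed (use \<eta> \<theta> N in auto)
    then show "prob (random_layers P \<kappa>)
        {Y :: 'd option \<Rightarrow> 'd option \<Rightarrow> real ^ 'd. \<not> consistent_layers \<theta> orient Y} \<le> K * sqrt ?k"
      by (simp add: random_layers_def K_def mult.assoc)
  qed
qed

text \<open>Consistent layers that lie in the family have a common point. Removing the inconsistent
  ones leaves at least half of the probability, which is compared with the upper bound given by the
  most pierced point. The parameters \<open>\<eta>\<close> and \<open>T\<close> stay free until the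
  density is known.\<close>

theorem many_pierced_tuples:
  "\<exists>K\<ge>1. \<forall>P (\<E> :: ('d :: finite option \<Rightarrow> real ^ 'd) set) \<eta> T.
    finite P \<longrightarrow> P \<noteq> {} \<longrightarrow> general_position P \<longrightarrow> (\<forall>f\<in>\<E>. range f \<subseteq> P) \<longrightarrow>
    0 < \<eta> \<longrightarrow> \<eta> + (real CARD('d option))\<^sup>2 / card P \<le> 1 \<longrightarrow>
    0 < T \<longrightarrow> CARD('d) * ln (2 * real T + 1) \<le> T * \<eta> \<longrightarrow>
    K * sqrt (\<eta> + (real CARD('d option))\<^sup>2 / card P)
      \<le> (card \<E> / real (card P) ^ CARD('d option)) ^ CARD('d option) / 2 \<longrightarrow>
    (\<exists>x. (card \<E> / real (card P) ^ CARD('d option)) ^ CARD('d option) / 2 \<le>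
      CARD('d option) * card {f \<in> \<E>. pierces x (range f)} *
        ((2 * real T + 1) ^ CARD('d) / card P) ^ CARD('d option))"
proof -
  obtain \<theta> where \<theta>: "\<theta> > 0"
    "\<And>Y :: 'd option \<Rightarrow> 'd option \<Rightarrow> real ^ 'd. consistent_layers \<theta> orient Y \<Longrightarrow>
      \<exists>x. \<forall>s. x \<in> rel_interior (convex hull (range (\<lambda>j. Y j s)))"
    using simplices_common_point[where 'd = 'd and 's = "'d option"] by blast
  obtain K where K: "K \<ge> 1" "\<And>P (\<kappa> :: real ^ 'd \<Rightarrow> real list) \<eta>. finite P \<Longrightarrow> P \<noteq> {} \<Longrightarrow> general_position P \<Longrightarrow>
    (\<forall>g j. separation P \<kappa> (\<lambda>a. sgn (orient (g(j := a)))) \<le> \<eta>) \<Longrightarrow>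
    0 < \<eta> \<Longrightarrow> \<eta> + (real CARD('d option))\<^sup>2 / card P \<le> 1 \<Longrightarrow>
    prob (random_layers P \<kappa>)
      {Y :: 'd option \<Rightarrow> 'd option \<Rightarrow> real ^ 'd. \<not> consistent_layers \<theta> orient Y}
      \<le> K * sqrt (\<eta> + (real CARD('d option))\<^sup>2 / card P)"
    using prob_inconsistent_orient[where 'd = 'd, OF \<theta>(1)] by blast
  show ?thesis
  proof (intro exI[of _ K] conjI K(1) allI impI)
    fix P and \<E> :: "('d option \<Rightarrow> real ^ 'd) set" and \<eta> :: real and T :: nat
    assume P: "finite P" "P \<noteq> {}" "general_position P" and E: "\<forall>f\<in>\<E>. range f \<subseteq> P"
      and \<eta>: "0 < \<eta>" "\<eta> + (real CARD('d option))\<^sup>2 / card P \<le> 1"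
      and T: "0 < T" "CARD('d) * ln (2 * real T + 1) \<le> T * \<eta>"
      and small: "K * sqrt (\<eta> + (real CARD('d option))\<^sup>2 / card P)
        \<le> (card \<E> / real (card P) ^ CARD('d option)) ^ CARD('d option) / 2"
    define e where "e = (card \<E> / real (card P) ^ CARD('d option)) ^ CARD('d option)"
    define C where "C f = rel_interior (convex hull (range f))" for f :: "'d option \<Rightarrow> real ^ 'd"
    obtain \<kappa> :: "real ^ 'd \<Rightarrow> real list" where \<kappa>: "card (\<kappa> ` P) \<le> (2 * T + 1) ^ CARD('d)"
      "\<And>g j. separation P \<kappa> (\<lambda>a. sgn (orient (g(j := a)))) \<le> \<eta>"
      using orientation_partition[OF P(1,2) T] by blast
    have finE: "finite \<E>"
      using E finite_subset[OF _ finite_card_tuples(1)[OF P(1)], of \<E>] by auto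
    \<comment> \<open>Only finitely many counts occur, so some point attains the largest
      one.\<close>
    define S where "S = (\<lambda>x. card {f \<in> \<E>. x \<in> C f}) ` UNIV"
    have "S \<subseteq> {..card \<E>}" using finE by (auto simp: S_def intro: card_mono)
    then have finS: "finite S" by (rule finite_subset) simp
    have "Max S \<in> S" by (rule Max_in[OF finS]) (simp add: S_def)
    then obtain x where x: "Max S = card {f \<in> \<E>. x \<in> C f}" by (auto simp: S_def)
    have max: "real (card {f \<in> \<E>. y \<in> C f}) \<le> card {f \<in> \<E>. x \<in> C f}" for y
      using Max_ge[OF finS, of "card {f \<in> \<E>. y \<in> C f}"] by (simp add: S_def x[symmetric])
    let ?L = "random_layers P \<kappa> :: ('d option \<Rightarrow> 'd option \<Rightarrow> real ^ 'd) pmf"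
    let ?common = "{Y :: 'd option \<Rightarrow> 'd option \<Rightarrow> real ^ 'd. (\<forall>s. (\<lambda>j. Y j s) \<in> \<E>) \<and> (\<Inter>s. C (\<lambda>j. Y j s)) \<noteq> {}}"
    have "e \<le> prob ?L {Y. \<forall>s. (\<lambda>j. Y j s) \<in> \<E>}"
      unfolding e_def using E by (intro prob_all_layers_ge[OF P(1,2)]) auto
    also have "\<dots> \<le> prob ?L (?common \<union> {Y. \<not> consistent_layers \<theta> orient Y})"
    proof (rule measure_pmf.finite_measure_mono)
      show "{Y. \<forall>s. (\<lambda>j. Y j s) \<in> \<E>} \<subseteq> ?common \<union> {Y. \<not> consistent_layers \<theta> orient Y}"
      proof
        fix Y :: "'d option \<Rightarrow> 'd option \<Rightarrow> real ^ 'd"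
        assume Y: "Y \<in> {Y. \<forall>s. (\<lambda>j. Y j s) \<in> \<E>}"
        show "Y \<in> ?common \<union> {Y. \<not> consistent_layers \<theta> orient Y}"
        proof (cases "consistent_layers \<theta> orient Y")
          case True
          then obtain z where "\<And>s. z \<in> C (\<lambda>j. Y j s)"
            using \<theta>(2) unfolding C_def by blast
          then show ?thesis using Y by auto
        qed simp
      qed
    qed simp
    also have "\<dots> \<le> prob ?L ?common + prob ?L {Y. \<not> consistent_layers \<theta> orient Y}"
      by (rule measure_Un_le) auto
    also have "prob ?L {Y. \<not> consistent_layers \<theta> orient Y} \<le> e / 2"
      using K(2)[OF P _ \<eta>, of \<kappa>] \<kappa>(2) small by (simp add: e_def)
    finally have "e / 2 \<le> prob ?L ?common" by simp
    also have "\<dots> \<le> CARD('d option) * real (card {f \<in> \<E>. x \<in> C f}) *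
        (card (\<kappa> ` P) / card P) ^ CARD('d option)"
      by (rule prob_layers_common_point_le[OF _ P(1,2) finE _ max])
         (simp_all add: C_def convex_rel_interior)
    also have "\<dots> \<le> CARD('d option) * real (card {f \<in> \<E>. x \<in> C f}) *
        ((2 * real T + 1) ^ CARD('d) / card P) ^ CARD('d option)"
    proof (intro mult_left_mono power_mono divide_right_mono)
      show "real (card (\<kappa> ` P)) \<le> (2 * real T + 1) ^ CARD('d)"
        using of_nat_mono[OF \<kappa>(1), where 'a = real] by (simp add: add.commute)
    qed auto
    finally show "\<exists>x. (card \<E> / real (card P) ^ CARD('d option)) ^ CARD('d option) / 2 \<le>
      CARD('d option) * card {f \<in> \<E>. pierces x (range f)} *
        ((2 * real T + 1) ^ CARD('d) / card P) ^ CARD('d option)"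
      unfolding e_def C_def pierces_def of_nat_mult by (rule exI)
  qed
qed

section \<open>From ordered tuples to sets, and the choice of constants\<close>

text \<open>Translates between sets and their enumerations by \<open>'n\<close>; the crude factor
  \<open>CARD('n) ^ CARD('n)\<close> depends on the dimension only.\<close>

lemma card_tuples_of_sets:
  fixes E :: "'a set set"
  assumes E: "finite E" "\<And>\<tau>. \<tau> \<in> E \<Longrightarrow> finite \<tau> \<and> card \<tau> = CARD('n :: finite)"
  shows "card E \<le> card {f :: 'n \<Rightarrow> 'a. range f \<in> E}"
    and "card {f :: 'n \<Rightarrow> 'a. range f \<in> E} \<le> CARD('n) ^ CARD('n) * card E"
proof -
  have "{f :: 'n \<Rightarrow> 'a. range f \<in> E} \<subseteq> {f. range f \<subseteq> \<Union>E}" by auto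
  moreover have "finite (\<Union>E)" using E by auto
  ultimately have fin: "finite {f :: 'n \<Rightarrow> 'a. range f \<in> E}"
    using finite_card_tuples(1) finite_subset by blast
  have "\<exists>f :: 'n \<Rightarrow> 'a. range f = \<tau>" if \<tau>: "\<tau> \<in> E" for \<tau>
  proof -
    obtain h where "bij_betw h (UNIV :: 'n set) \<tau>"
      using finite_same_card_bij[of "UNIV :: 'n set" \<tau>] E(2)[OF \<tau>] by auto
    then show ?thesis by (auto simp: bij_betw_def)
  qed
  then obtain g :: "'a set \<Rightarrow> 'n \<Rightarrow> 'a" where g: "\<And>\<tau>. \<tau> \<in> E \<Longrightarrow> range (g \<tau>) = \<tau>" by metis
  have "inj_on g E" using g by (metis inj_onI)
  then have "card E = card (g ` E)" by (simp add: card_image)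
  also have "\<dots> \<le> card {f :: 'n \<Rightarrow> 'a. range f \<in> E}" using g fin by (intro card_mono) auto
  finally show "card E \<le> card {f :: 'n \<Rightarrow> 'a. range f \<in> E}" .
  have "{f :: 'n \<Rightarrow> 'a. range f \<in> E} = (\<Union>\<tau>\<in>E. {f. range f = \<tau>})" by auto
  then have "card {f :: 'n \<Rightarrow> 'a. range f \<in> E} \<le> (\<Sum>\<tau>\<in>E. card {f :: 'n \<Rightarrow> 'a. range f = \<tau>})"
    using card_UN_le[OF E(1)] by metis
  also have "\<dots> \<le> (\<Sum>\<tau>\<in>E. CARD('n) ^ CARD('n))"
  proof (rule sum_mono)
    fix \<tau> assume "\<tau> \<in> E"
    then have \<tau>: "finite \<tau>" "card \<tau> = CARD('n)" using E by auto
    have "card {f :: 'n \<Rightarrow> 'a. range f = \<tau>} \<le> card {f :: 'n \<Rightarrow> 'a. range f \<subseteq> \<tau>}"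
      using finite_card_tuples(1)[OF \<tau>(1)] by (intro card_mono) auto
    then show "card {f :: 'n \<Rightarrow> 'a. range f = \<tau>} \<le> CARD('n) ^ CARD('n)"
      using finite_card_tuples(2)[OF \<tau>(1), where 'n = 'n] \<tau>(2) by simp
  qed
  finally show "card {f :: 'n \<Rightarrow> 'a. range f \<in> E} \<le> CARD('n) ^ CARD('n) * card E"
    by (simp add: mult.commute)
qed

text \<open>Any exponent above 1 is possible in place of 4/3; this one is small enough for \<open>exponent_le\<close>.\<close>

lemma step_count_exists:
  fixes A :: real and d :: nat
  assumes A: "0 < A" "A \<le> 1" and d: "0 < d"
  obtains T :: nat where "0 < T" "d * ln (2 * real T + 1) \<le> T * A"
    "2 * real T + 1 \<le> 48 * (6 * d / A) powr (4 / 3)"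
proof
  define X where "X = 6 * d / A"
  \<comment> \<open>The witness is \<open>T = N ^ 4\<close>: the logarithm is then at most
    \<open>6 * N\<close>, and the requirement becomes \<open>6 * d \<le> N ^ 3 * A\<close>, which
    \<open>N\<close> of order \<open>X powr (1 / 3)\<close> meets.\<close>
  define N where "N = nat \<lceil>X powr (1 / 3)\<rceil>"
  have "1 \<le> real d" using d by simp
  then have "A \<le> 6 * real d" using A by linarith
  then have X: "1 \<le> X" using A by (simp add: X_def)
  have y1: "1 \<le> X powr (1 / 3)" using X by (simp add: ge_one_powr_ge_zero)
  have "real N = of_int \<lceil>X powr (1 / 3)\<rceil>" using y1 by (simp add: N_def)
  then have N: "X powr (1 / 3) \<le> N" "real N \<le> 2 * X powr (1 / 3)"
    using y1 of_int_ceiling_le_add_one[of "X powr (1 / 3)"] le_of_int_ceiling[of "X powr (1 / 3)"]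
    by linarith+
  have N1: "1 \<le> real N" using N y1 by linarith
  have "X = (X powr (1 / 3)) ^ 3" using X by (simp add: powr_powr flip: powr_realpow)
  also have "\<dots> \<le> real N ^ 3" using N y1 by (intro power_mono) auto
  finally have XN: "6 * d \<le> real N ^ 3 * A" using A by (simp add: X_def field_simps)
  show "0 < N ^ 4" using N1 by simp
  have N4: "2 * real (N ^ 4) + 1 \<le> 3 * real N ^ 4" using N1 by simp
  have "ln (2 * real (N ^ 4) + 1) \<le> ln (3 * real N ^ 4)"
    using N4 by (intro ln_mono) (auto intro: add_nonneg_pos)
  also have "\<dots> = ln 3 + 4 * ln (real N)" using N1 by (simp add: ln_mult ln_realpow)
  also have "\<dots> \<le> 2 + 4 * (real N - 1)"
    using ln_le_minus_one[of 3] ln_le_minus_one[of "real N"] N1 by (intro add_mono mult_left_mono) auto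
  also have "\<dots> \<le> 6 * real N" using N1 by simp
  finally have "d * ln (2 * real (N ^ 4) + 1) \<le> d * (6 * real N)" by (intro mult_left_mono) auto
  also have "\<dots> = real N * (6 * d)" by simp
  also have "\<dots> \<le> real N * (real N ^ 3 * A)" using XN by (intro mult_left_mono) auto
  also have "\<dots> = real (N ^ 4) * A" by (simp add: power_numeral_reduce)
  finally show "d * ln (2 * real (N ^ 4) + 1) \<le> (N ^ 4) * A" .
  have "2 * real (N ^ 4) + 1 \<le> 3 * (2 * X powr (1 / 3)) ^ 4"
    using N4 power_mono[OF N(2), of 4] by simp
  also have "\<dots> = 48 * X powr (4 / 3)" using X by (simp add: power_mult_distrib powr_powr flip: powr_realpow)
  finally show "2 * real (N ^ 4) + 1 \<le> 48 * (6 * d / A) powr (4 / 3)" by (simp add: X_def)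
qed

text \<open>The left-hand sides are the exponents that arise for many and for few points. With
  \<open>x = real d\<close> the first claim reduces to
  \<open>3 * x ^ 4 - 8 * x\<^sup>2 - 5 * x - 3 \<ge> 0\<close>, and division by \<open>x - 2\<close>
  leaves a positive quotient and a positive remainder.\<close>

lemma exponent_le:
  assumes "d \<ge> 2"
  shows "real (d + 1) + 8 * real d * (real (d + 1))\<^sup>2 / 3 \<le> real ((d ^ 4 + d) * (d + 1))"
    and "2 * (real (d + 1))\<^sup>2 \<le> real ((d ^ 4 + d) * (d + 1))"
proof -
  define x where "x = real d"
  have x: "2 \<le> x" using assms by (simp add: x_def)
  have "3 * x ^ 4 - 8 * x\<^sup>2 - 5 * x - 3 = (x - 2) * (3 * x ^ 3 + 6 * x\<^sup>2 + 4 * x + 3) + 3"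
    by (simp add: algebra_simps power_numeral_reduce)
  also have "\<dots> \<ge> 0" using x by simp
  finally have "1 + 8 * x * (x + 1) / 3 \<le> x ^ 4 + x"
    by (simp add: field_simps power2_eq_square)
  then have 1: "(x + 1) * (1 + 8 * x * (x + 1) / 3) \<le> (x + 1) * (x ^ 4 + x)"
    using x by (intro mult_left_mono) auto
  then show "real (d + 1) + 8 * real d * (real (d + 1))\<^sup>2 / 3 \<le> real ((d ^ 4 + d) * (d + 1))"
    by (simp add: x_def[symmetric] algebra_simps power2_eq_square)
  have "2 * (x + 1) \<le> 1 + 8 * x * (x + 1) / 3"
  proof -
    have "2 * (x + 1) \<le> x * (x + 1)" using x by (intro mult_right_mono) auto
    also have "\<dots> \<le> 8 * (x * (x + 1)) / 3" using x by (auto simp: field_simps)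
    finally show ?thesis by simp
  qed
  then have "(x + 1) * (2 * (x + 1)) \<le> (x + 1) * (1 + 8 * x * (x + 1) / 3)"
    using x by (intro mult_left_mono) auto
  then have "(x + 1) * (2 * (x + 1)) \<le> (x + 1) * (x ^ 4 + x)" using 1 by linarith
  then show "2 * (real (d + 1))\<^sup>2 \<le> real ((d ^ 4 + d) * (d + 1))"
    by (simp add: x_def[symmetric] algebra_simps power2_eq_square)
qed

theorem theorem1p4:
  fixes d :: nat and \<delta> :: real
  assumes "d = CARD('d::finite)" and "d \<ge> 2" and "\<delta> > 0"
  shows "\<exists>c::real. c > 0 \<and>
    (\<forall>(\<epsilon>::real) (n::nat) (P :: (real ^ 'd) set) (E :: (real ^ 'd) set set).
       0 < \<epsilon> \<longrightarrow> \<epsilon> \<le> 1 \<longrightarrow>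
       finite P \<longrightarrow> card P = n \<longrightarrow> general_position P \<longrightarrow>
       E \<subseteq> nsets P (d + 1) \<longrightarrow>
       real (card E) \<ge> \<epsilon> * real (n choose (d + 1)) \<longrightarrow>
       (\<exists>x :: real ^ 'd.
          real (card {\<tau> \<in> E. pierces x \<tau>})
            \<ge> c * \<epsilon> powr (real ((d ^ 4 + d) * (d + 1)) + \<delta>) * real (n choose (d + 1))))"
proof -
  define m where "m = CARD('d option)"
  have md: "m = d + 1" by (simp add: m_def assms(1))
  have m0: "0 < m" by (simp add: md)
  obtain K where K: "1 \<le> K"
    and pierced: "\<And>P (\<E> :: ('d option \<Rightarrow> real ^ 'd) set) \<eta> T.
      finite P \<Longrightarrow> P \<noteq> {} \<Longrightarrow> general_position P \<Longrightarrow> (\<forall>f\<in>\<E>. range f \<subseteq> P) \<Longrightarrow>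
      0 < \<eta> \<Longrightarrow> \<eta> + (real m)\<^sup>2 / card P \<le> 1 \<Longrightarrow> 0 < T \<Longrightarrow> d * ln (2 * real T + 1) \<le> T * \<eta> \<Longrightarrow>
      K * sqrt (\<eta> + (real m)\<^sup>2 / card P) \<le> (card \<E> / real (card P) ^ m) ^ m / 2 \<Longrightarrow>
      \<exists>x. (card \<E> / real (card P) ^ m) ^ m / 2 \<le>
        m * card {f \<in> \<E>. pierces x (range f)} * ((2 * real T + 1) ^ d / card P) ^ m"
    using many_pierced_tuples[where 'd = 'd] unfolding m_def assms(1) by blast
  \<comment> \<open>Chosen so that \<open>(e0 ^ m / (2 * K))\<^sup>2 = 2 * A\<close> below: one
    \<open>A\<close> is the separation, the other absorbs
    \<open>(real m)\<^sup>2 / card P\<close>.\<close>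
  define a where "a = 1 / (8 * K\<^sup>2 * real m ^ (2 * m * m))"
  define B where "B = (48 * (6 * d / a) powr (4 / 3)) ^ (d * m)"
  \<comment> \<open>Collects the losses: 2 for the inconsistent layers, \<open>m\<close> for the
    layer that is redrawn, \<open>m ^ m\<close> for the orderings of a simplex,
    \<open>m ^ (m * m)\<close> from \<open>e0 ^ m\<close>, and \<open>B\<close> for the number of
    cells.\<close>
  define c1 where "c1 = 1 / (2 * m * real m ^ m * real m ^ (m * m) * B)"
  \<comment> \<open>The first entry serves the case of few points, the second that of many
    points.\<close>
  define c where "c = min ((a / (real m)\<^sup>2) ^ m) c1"
  have a0: "0 < a" using K m0 by (simp add: a_def)
  have a1: "a \<le> 1 / 8"
  proof -
    have "1 * 1 \<le> K\<^sup>2 * real m ^ (2 * m * m)"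
      using K m0 by (intro mult_mono one_le_power) auto
    then show ?thesis by (simp add: a_def field_simps)
  qed
  have B0: "0 < B" using a0 assms(2) by (simp add: B_def)
  have c1: "0 < c1" using B0 m0 by (simp add: c1_def)
  have c: "0 < c" "c \<le> (a / (real m)\<^sup>2) ^ m" "c \<le> c1" using a0 m0 c1 by (auto simp: c_def)
  have "\<exists>x. c * \<epsilon> powr (real ((d ^ 4 + d) * (d + 1)) + \<delta>) * real (n choose (d + 1))
      \<le> real (card {\<tau> \<in> E. pierces x \<tau>})"
    if \<epsilon>: "0 < \<epsilon>" "\<epsilon> \<le> 1" and P: "finite P" "card P = n" "general_position P"
      and E: "E \<subseteq> nsets P (d + 1)" and Ecard: "\<epsilon> * real (n choose (d + 1)) \<le> real (card E)"
    for \<epsilon> n and P :: "(real ^ 'd) set" and E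
  proof (cases "n < m")
    case True
    then have zero: "n choose (d + 1) = 0" by (simp add: md binomial_eq_0)
    show ?thesis unfolding zero by simp
  next
    case False
    then have nm: "m \<le> n" by simp
    then have n0: "0 < n" using m0 by simp
    have Pne: "P \<noteq> {}" using P n0 by auto
    have finE: "finite E" using E finite_imp_finite_nsets[OF P(1)] finite_subset by blast
    have E\<tau>: "finite \<tau> \<and> card \<tau> = CARD('d option)" if "\<tau> \<in> E" for \<tau>
      using E that by (auto simp: nsets_def assms(1))
    have binom: "real (n choose (d + 1)) \<le> real n ^ m"
      using of_nat_mono[OF binomial_le_pow[OF nm], where 'a = real] by (simp add: md)
    define q where "q = real ((d ^ 4 + d) * (d + 1)) + \<delta>"
    \<comment> \<open>The separation allowed in the partition; the exponent \<open>2 * m\<close>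
      makes up for the square root in the probability of inconsistent layers.\<close>
    define A where "A = a * \<epsilon> ^ (2 * m)"
    have A: "0 < A" "A \<le> 1 / 8"
      using a0 a1 \<epsilon> mult_mono[OF a1 power_le_one[of \<epsilon> "2 * m"]] by (simp_all add: A_def)
    show ?thesis
    \<comment> \<open>With so few points the number of simplices asked for is at most 1, and any
      simplex of \<open>E\<close> has a point that pierces it.\<close>
    proof (cases "n * A < (real m)\<^sup>2")
      case True
      have "0 < real (n choose (d + 1))" using nm by (simp add: md)
      then have "0 < real (card E)" using Ecard \<epsilon> by (intro less_le_trans[OF _ Ecard]) simp
      then obtain \<tau> where \<tau>: "\<tau> \<in> E" by fastforce
      then have "\<tau> \<noteq> {}" using E\<tau>[OF \<tau>] by auto
      then have "rel_interior (convex hull \<tau>) \<noteq> {}"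
        by (simp add: rel_interior_eq_empty)
      then obtain x where x: "pierces x \<tau>" by (auto simp: pierces_def)
      have "0 < card {\<tau> \<in> E. pierces x \<tau>}" using x \<tau> finE by (auto simp: card_gt_0_iff)
      then have one: "1 \<le> real (card {\<tau> \<in> E. pierces x \<tau>})" by simp
      have "\<epsilon> powr q \<le> \<epsilon> powr (2 * (real m)\<^sup>2)"
        using exponent_le(2)[OF assms(2)] assms(3) \<epsilon> by (intro powr_mono') (auto simp: q_def md)
      also have "2 * (real m)\<^sup>2 = real (2 * m * m)" by (simp add: power2_eq_square)
      also have "\<epsilon> powr real (2 * m * m) = (\<epsilon> ^ (2 * m)) ^ m"
        by (simp only: powr_realpow[OF \<epsilon>(1)] power_mult)
      finally have "c * \<epsilon> powr q * real (n choose (d + 1))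
        \<le> (a / (real m)\<^sup>2) ^ m * (\<epsilon> ^ (2 * m)) ^ m * real n ^ m"
        using c binom \<epsilon> by (intro mult_mono) auto
      also have "\<dots> = (n * A / (real m)\<^sup>2) ^ m"
        by (simp add: A_def power_mult_distrib[symmetric] mult_ac)
      also have "\<dots> \<le> 1"
        using True A m0 by (intro power_le_one) auto
      finally show ?thesis using one unfolding q_def by (intro exI[of _ x]) linarith
    next
      case False
      obtain T where T: "0 < T" "d * ln (2 * real T + 1) \<le> T * A"
        "2 * real T + 1 \<le> 48 * (6 * d / A) powr (4 / 3)"
        using step_count_exists[of A d] A assms(2) by auto
      define \<E> where "\<E> = {f :: 'd option \<Rightarrow> real ^ 'd. range f \<in> E}"
      define e1 where "e1 = card \<E> / real (card P) ^ m"
      \<comment> \<open>A lower bound for the density \<open>e1\<close> of ordered tuples, from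
        \<open>(n / m) ^ m \<le> n choose m\<close>.\<close>
      define e0 where "e0 = \<epsilon> / real m ^ m"
      have e0: "0 < e0" using \<epsilon> m0 by (simp add: e0_def)
      have "e0 * real n ^ m = \<epsilon> * (real n / real m) ^ m"
        by (simp add: e0_def power_divide)
      also have "\<dots> \<le> \<epsilon> * real (n choose m)"
        using binomial_ge_n_over_k_pow_k[OF nm, where 'a = real] \<epsilon> by (intro mult_left_mono) auto
      also have "\<dots> \<le> card E" using Ecard by (simp add: md)
      also have "\<dots> \<le> card \<E>"
        using card_tuples_of_sets(1)[OF finE E\<tau>] by (simp add: \<E>_def)
      finally have e01: "e0 \<le> e1" using n0 by (simp add: e1_def P(2) field_simps)
      have mn: "(real m)\<^sup>2 / card P \<le> A" using False n0 by (simp add: P(2) field_simps)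
      have "K * sqrt (A + (real m)\<^sup>2 / card P) \<le> K * sqrt ((e0 ^ m / (2 * K))\<^sup>2)"
      proof (intro mult_left_mono real_sqrt_le_mono)
        have "(e0 ^ m / (2 * K))\<^sup>2 = 2 * A"
          using K m0 by (simp add: e0_def A_def a_def power_divide power_mult_distrib
            power_mult[symmetric] mult_ac)
        then show "A + (real m)\<^sup>2 / card P \<le> (e0 ^ m / (2 * K))\<^sup>2" using mn by simp
      qed (use K in auto)
      also have "\<dots> = e0 ^ m / 2" using K e0 by simp
      also have "\<dots> \<le> e1 ^ m / 2" using e01 e0 by (intro divide_right_mono power_mono) auto
      finally have small: "K * sqrt (A + (real m)\<^sup>2 / card P) \<le> e1 ^ m / 2" .
      have "\<forall>f\<in>\<E>. range f \<subseteq> P" using E by (auto simp: \<E>_def nsets_def)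
      then obtain x where x: "e1 ^ m / 2 \<le>
          m * card {f \<in> \<E>. pierces x (range f)} * ((2 * real T + 1) ^ d / card P) ^ m"
        using pierced[OF P(1) Pne P(3), of \<E> A T] A mn T(1,2) small unfolding e1_def by auto
      define p where "p = real (card {\<tau> \<in> E. pierces x \<tau>})"
      \<comment> \<open>The power of \<open>\<epsilon>\<close> lost to the number of cells:
        \<open>\<epsilon> ^ (2 * m)\<close> from \<open>A\<close> enters the bound on
        \<open>2 * T + 1\<close> with exponent \<open>- 4 / 3\<close>, and that bound is raised to
        the power \<open>d * m\<close>.\<close>
      define g where "g = \<epsilon> powr (8 * real d * (real m)\<^sup>2 / 3)"
      have g: "0 < g" using \<epsilon> by (simp add: g_def)
      have p: "real (card {f \<in> \<E>. pierces x (range f)}) \<le> real m ^ m * p"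
      proof -
        have "{f \<in> \<E>. pierces x (range f)} = {f. range f \<in> {\<tau> \<in> E. pierces x \<tau>}}"
          by (auto simp: \<E>_def)
        then have "card {f \<in> \<E>. pierces x (range f)} \<le> m ^ m * card {\<tau> \<in> E. pierces x \<tau>}"
          using card_tuples_of_sets(2)[of "{\<tau> \<in> E. pierces x \<tau>}", where 'n = "'d option"] finE E\<tau>
          by (simp add: m_def)
        from of_nat_mono[OF this, where 'a = real] show ?thesis by (simp add: p_def)
      qed
      have R: "((2 * real T + 1) ^ d) ^ m * g \<le> B"
      proof -
        have split: "6 * d / A = (6 * d / a) * \<epsilon> powr (- real (2 * m))"
          by (simp only: A_def powr_minus_divide powr_realpow[OF \<epsilon>(1)]) simp
        have X: "(6 * d / A) powr (4 / 3) = (6 * d / a) powr (4 / 3) * \<epsilon> powr (- (8 * real m / 3))"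
          unfolding split using a0 by (subst powr_mult) (simp_all add: powr_powr)
        have "((2 * real T + 1) ^ d) ^ m \<le> (48 * (6 * d / A) powr (4 / 3)) ^ (d * m)"
          unfolding power_mult[symmetric] using T(3) by (intro power_mono) auto
        also have "\<dots> = B * (\<epsilon> powr (- (8 * real m / 3))) ^ (d * m)"
          unfolding X B_def by (simp add: power_mult_distrib)
        also have "(\<epsilon> powr (- (8 * real m / 3))) ^ (d * m) = \<epsilon> powr (- (8 * real d * (real m)\<^sup>2 / 3))"
          using \<epsilon> by (simp add: powr_powr power2_eq_square mult_ac flip: powr_realpow)
        also have "\<dots> = 1 / g" by (simp add: g_def powr_minus_divide)
        finally show ?thesis using g by (simp add: field_simps)
      qed
      have "\<epsilon> powr q \<le> \<epsilon> powr (real m + 8 * real d * (real m)\<^sup>2 / 3)"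
        using exponent_le(1)[OF assms(2)] assms(3) \<epsilon> by (intro powr_mono') (auto simp: q_def md)
      also have "\<dots> = \<epsilon> ^ m * g" using \<epsilon> by (simp add: g_def powr_add powr_realpow)
      finally have "c * \<epsilon> powr q * real (n choose (d + 1)) \<le> c1 * (\<epsilon> ^ m * g) * real n ^ m"
        using c c1 binom \<epsilon> g by (intro mult_mono) auto
      also have "\<dots> \<le> p"
      proof -
        have "e0 ^ m / 2 \<le> e1 ^ m / 2" using e01 e0 by (intro divide_right_mono power_mono) auto
        also have "\<dots> \<le> m * card {f \<in> \<E>. pierces x (range f)} * ((2 * real T + 1) ^ d / card P) ^ m"
          by (rule x)
        also have "\<dots> \<le> m * (real m ^ m * p) * ((2 * real T + 1) ^ d / card P) ^ m"
          using p unfolding of_nat_mult by (intro mult_right_mono mult_left_mono) auto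
        also have "\<dots> = m * real m ^ m * p * ((2 * real T + 1) ^ d) ^ m / real n ^ m"
          by (simp add: P(2) power_divide)
        finally have "e0 ^ m * real n ^ m * g \<le> 2 * (m * real m ^ m * p) * (((2 * real T + 1) ^ d) ^ m * g)"
          using n0 g by (simp add: field_simps)
        also have "\<dots> \<le> 2 * (m * real m ^ m * p) * B"
          using R by (intro mult_left_mono) (auto simp: p_def)
        finally have "e0 ^ m * real n ^ m * g \<le> (2 * m * real m ^ m * B) * p" by (simp add: mult_ac)
        moreover have "c1 * (\<epsilon> ^ m * g) * real n ^ m = (e0 ^ m * real n ^ m * g) / (2 * m * real m ^ m * B)"
          by (simp add: c1_def e0_def power_divide power_mult mult_ac)
        ultimately show ?thesis using m0 B0 by (simp add: pos_divide_le_eq mult_ac)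
      qed
      finally show ?thesis unfolding q_def p_def by blast
    qed
  qed
  then show ?thesis using c(1) by blast
qed

end
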